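(* Let $L$ be a linear connection on a vector bundle $F$ over $M$ and $L'$ a torsionfree connection on $TM$. Let $R=R^{\kappa,DL}$, where $\kappa:T^2F\to T^2F$ is the canonical flip and $DL$ is the multilinear connection on $T^2F=TTF$ derived from $L$ (using $L$ and $L'$), and let $\tilde R$ be the action of $R$ on the axes-bundle $A^2F$. Then $R$ does not depend on the choice of $L'$. Moreover, $R$ belongs to the subgroup $\mathrm{Gm}^{2,3}(TTF)$, i.e. $\tilde R_x$ has only one non-trivial component, namely the top curvature form $$\tilde R^\Lambda:\ \varepsilon_1TM\times\varepsilon_2TM\times\varepsilon_0F\to\varepsilon_0\varepsilon_1\varepsilon_2F,$$ where $\Lambda=(e_1,e_2,e_3)$. In other words, for $v=(v_\alpha)\in(A^2F)_x$, $$\tilde R_x(v)=v+\tilde R_x^\Lambda(\varepsilon_1v_1,\varepsilon_2v_2)\,\varepsilon_0v_0 .$$ In a chart, with Christoffel tensor $b_x$ of $L$, the top curvature form $\tilde R^\Lambda_x$ is given by $$\tilde R^\Lambda_x(v_1,v_2)w_0=b_x(b_x(w_0,v_2),v_1)-b_x(b_x(w_0,v_1),v_2)+\partial_{v_2}b_x(w_0,v_1)-\partial_{v_1}b_x(w_0,v_2).$$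
   Context: $\mathbb{K}$ is a commutative unital Hausdorff topological ring with open dense unit group and continuous inversion; topological modules are Hausdorff. A map $f:V\supset U\to W$ is $C^1$ if there is a continuous $f^{[1]}$ on $\{(x,v,t)\in U\times V\times\mathbb{K}:x+tv\in U\}$ with $f(x+tv)-f(x)=tf^{[1]}(x,v,t)$; $\partial_vf(x)=df(x)v=f^{[1]}(x,v,0)$; $C^{j+1}$ means $C^1$ with $f^{[1]}$ of class $C^j$; smooth means $C^j$ for all $j$. Manifolds, vector bundles and tangent bundles are defined by charts; $M$ is modelled on $V$, the fibers of $F$ on $W$; everything is smooth. In $\partial_vb_x$ the derivative is with respect to $x$ in direction $v$. Coordinates. In a bundle chart over $U\subset V$, points of $F$ are $x+\varepsilon_0w_0$, points of $TF$ are $x+\varepsilon_0w_0+\varepsilon_1v_1+\varepsilon_0\varepsilon_1w_{01}$, and points of $T^2F=T_{\varepsilon_2}T_{\varepsilon_1}F$ are $x+\varepsilon_0w_0+\varepsilon_1v_1+\varepsilon_2v_2+\varepsilon_0\varepsilon_1w_{01}+\varepsilon_0\varepsilon_2w_{02}+\varepsilon_1\varepsilon_2v_{12}+\varepsilon_0\varepsilon_1\varepsilon_2w_{012}$ ($w$'s in $W$, $v$'s in $V$; $x\in U$). The axes-bundle $A^2F$ is the direct sum over $M$ of seven vector bundles, one for each monomial $\varepsilon^\alpha$, $0\ne\alpha\in\{0,1\}^3$ (a copy of $F$ if $\varepsilon_0$ occurs in the monomial, a copy of $TM$ otherwise). For $v=(v_\alpha)\in(A^2F)_x$, the components on the $\varepsilon_0$-,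 $\varepsilon_1$- and $\varepsilon_2$-axes are written $v_0\in F_x$ (also $w_0$), $v_1\in T_xM$, $v_2\in T_xM$. The canonical flip $\kappa$ exchanges $\varepsilon_1$ and $\varepsilon_2$ in $T^2F$, and acts in the same way on $A^2F$. The symbols $e_1,e_2,e_3$ are the three canonical basis elements of $\{0,1\}^3$, corresponding to the three axes $\varepsilon_0F$, $\varepsilon_1TM$, $\varepsilon_2TM$, so that $\Lambda=(e_1,e_2,e_3)$ is the longest partition of $(1,1,1)$. Linear connections. A linear connection $L$ on $F$ is a smooth family of $\mathbb{K}$-module structures $L_x$ on the fibers of $TF\to M$ such that in each bundle chart there are bilinear maps $b_x:W\times V\to W$ (the Christoffel tensor, smooth in all variables) such that $L_x$ is the push-forward of the chart's linear structure on $(TF)_x=W\times V\times W$ under $(w,v,w')\mapsto(w,v,w'+b_x(w,v))$. Its splitting map is $\Phi_1:F\oplus TM\oplus F\to TF$, in charts $(x;\varepsilon_0w,\varepsilon_1v,\varepsilon_0\varepsilon_1w')\mapsto x+\varepsilon_0w+\varepsilon_1v+\varepsilon_0\varepsilon_1(w'+b_x(w,v))$. For $F=TM$ the connection is called torsionfree if all $b_x$ are symmetric. Let $c_x$ be the Christoffel tensor of $L'$. Derived connection. $\Phi_2=D\Phi_1:A^2F\to T^2F$ is the bundle isomorphism obtained by composing the tangent map $T\Phi_1$ (taken with respect to $\varepsilon_2$) with the splitting isomorphisms given by $L$ on the copies of $F$ and by $L'$ on the copies of $TM$; in charts, with $v=\varepsilon_0w_0+\varepsilon_1v_1+\varepsilon_2v_2+\varepsilon_0\varepsilon_1w_{01}+\varepsilon_0\varepsilon_2w_{02}+\varepsilon_1\varepsilon_2v_{12}+\varepsilon_0\varepsilon_1\varepsilon_2w_{012}$,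 $$\begin{aligned}\Phi_2(x,v)=\;&x+v+\varepsilon_0\varepsilon_1b_x(w_0,v_1)+\varepsilon_0\varepsilon_2b_x(w_0,v_2)+\varepsilon_1\varepsilon_2c_x(v_1,v_2)\\&+\varepsilon_0\varepsilon_1\varepsilon_2\big(b_x(w_0,v_{12})+b_x(w_{01},v_2)+b_x(w_{02},v_1)+b_x(w_0,c_x(v_1,v_2))+b_x(b_x(w_0,v_2),v_1)+\partial_{v_2}b_x(w_0,v_1)\big).\end{aligned}$$ $DL$ is the push-forward by $\Phi_2$ of the canonical linear structure of $A^2F$. Curvature. $R^{\kappa,DL}:=\kappa\circ\Phi_2\circ\kappa^{-1}\circ\Phi_2^{-1}:T^2F\to T^2F$ and $\tilde R:=\Phi_2^{-1}\circ R\circ\Phi_2:A^2F\to A^2F$. The group $\mathrm{Gm}^{2,3}$ of a fiber $(TTF)_x$ consists of the maps which, in bundle charts, are the identity plus a trilinear map in $(w_0,v_1,v_2)$ with values in the $\varepsilon_0\varepsilon_1\varepsilon_2$-component.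
   Formalization: The displayed chart formula for the top curvature form is proved with the opposite overall sign: with R = κ∘Φ₂∘κ⁻¹∘Φ₂⁻¹ the printed sign is false, e.g. for b_x(w,v) = θ_x(v)w with θ = x dy on the trivial line bundle over R². *)

theory Defs
  imports "HOL-Analysis.Analysis"
begin

section \<open>Base ring and topological modules\<close>

class dense_unit_ring = comm_ring_1 + topological_ab_group_add + topological_comm_monoid_mult + t2_space +
  assumes open_units: "open {r. r dvd 1}"
    and dense_units: "open U \<Longrightarrow> U \<noteq> {} \<Longrightarrow> U \<inter> {r. r dvd 1} \<noteq> {}"
    and continuous_unit_inverse:
      "r dvd 1 \<Longrightarrow> ((\<lambda>r. THE s. r * s = 1) \<longlongrightarrow> (THE s. r * s = 1)) (at r within {r. r dvd 1})"

instance prod :: (topological_monoid_add, topological_monoid_add) topological_monoid_add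
proof
  fix a b :: "'a \<times> 'b"
  show "((\<lambda>x. fst x + snd x) \<longlongrightarrow> a + b) (nhds a \<times>\<^sub>F nhds b)"
    unfolding plus_prod_def
    by (intro tendsto_intros filterlim_fst filterlim_snd)
qed

instance prod :: (topological_comm_monoid_add, topological_comm_monoid_add) topological_comm_monoid_add ..

instance prod :: (topological_group_add, topological_group_add) topological_group_add
proof
  fix a :: "'a \<times> 'b"
  have "((\<lambda>x. (- fst x, - snd x)) \<longlongrightarrow> (- fst a, - snd a)) (nhds a)"
    by (intro tendsto_intros filterlim_ident)
  then show "(uminus \<longlongrightarrow> - a) (nhds a)"
    by (simp add: uminus_prod_def[abs_def])
qed

instance prod :: (topological_ab_group_add, topological_ab_group_add) topological_ab_group_add ..

text \<open>A topological module is a type of sort \<open>{topological_ab_group_add, t2_space}\<close> together with a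
  scalar multiplication \<open>s\<close>.\<close>

definition topological_module ::
    "('k::dense_unit_ring \<Rightarrow> 'e::{topological_ab_group_add, t2_space} \<Rightarrow> 'e) \<Rightarrow> bool" where
  "topological_module s \<longleftrightarrow> module s \<and> continuous_on UNIV (\<lambda>(r, x). s r x)"

definition prod_scale :: "('k \<Rightarrow> 'e \<Rightarrow> 'e) \<Rightarrow> ('k \<Rightarrow> 'g \<Rightarrow> 'g) \<Rightarrow> 'k \<Rightarrow> 'e \<times> 'g \<Rightarrow> 'e \<times> 'g" where
  "prod_scale s s' r = map_prod (s r) (s' r)"

definition bilinear_map ::
    "('k::dense_unit_ring \<Rightarrow> 'a::ab_group_add \<Rightarrow> 'a) \<Rightarrow> ('k \<Rightarrow> 'b::ab_group_add \<Rightarrow> 'b)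
      \<Rightarrow> ('k \<Rightarrow> 'c::ab_group_add \<Rightarrow> 'c) \<Rightarrow> ('a \<Rightarrow> 'b \<Rightarrow> 'c) \<Rightarrow> bool" where
  "bilinear_map sa sb sc b \<longleftrightarrow>
     (\<forall>y. module_hom sa sc (\<lambda>x. b x y)) \<and> (\<forall>x. module_hom sb sc (\<lambda>y. b x y))"

definition trilinear_map ::
    "('k::dense_unit_ring \<Rightarrow> 'a::ab_group_add \<Rightarrow> 'a) \<Rightarrow> ('k \<Rightarrow> 'b::ab_group_add \<Rightarrow> 'b)
      \<Rightarrow> ('k \<Rightarrow> 'c::ab_group_add \<Rightarrow> 'c) \<Rightarrow> ('k \<Rightarrow> 'd::ab_group_add \<Rightarrow> 'd)
      \<Rightarrow> ('a \<Rightarrow> 'b \<Rightarrow> 'c \<Rightarrow> 'd) \<Rightarrow> bool" where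
  "trilinear_map sa sb sc sd g \<longleftrightarrow>
     (\<forall>y z. module_hom sa sd (\<lambda>x. g x y z)) \<and> (\<forall>x z. module_hom sb sd (\<lambda>y. g x y z)) \<and>
     (\<forall>x y. module_hom sc sd (\<lambda>z. g x y z))"


section \<open>Differential calculus\<close>

text \<open>The iterated difference quotients of a map on \<open>E\<close> live on the modules
  \<open>E\<^sub>0 = E\<close>, \<open>E\<^sub>n\<^sub>+\<^sub>1 = E\<^sub>n \<times> E\<^sub>n \<times> K\<close>, i.e. on a different type for each order.
  To have a recursion inside one type, all \<open>E\<^sub>n\<close> are realised in a single datatype, \<open>E\<^sub>n\<close> as the set
  of complete trees of depth \<open>n\<close>; \<open>Ext x v t\<close> stands for the triple \<open>(x, v, t)\<close>.\<close>

datatype ('e, 'k) pt =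
    Pt (pt_val: 'e)
  | Ext (pt_base: "('e, 'k) pt") (pt_dir: "('e, 'k) pt") (pt_par: 'k)

primrec pt_top :: "nat \<Rightarrow> ('e::topological_space, 'k::topological_space) pt topology" where
  "pt_top 0 = pullback_topology (range Pt) pt_val euclidean"
| "pt_top (Suc n) =
     pullback_topology {Ext x v t |x v t. True} (\<lambda>p. (pt_base p, pt_dir p, pt_par p))
       (prod_topology (pt_top n) (prod_topology (pt_top n) euclidean))"

fun pt_add :: "('e::ab_group_add, 'k::ab_group_add) pt \<Rightarrow> ('e, 'k) pt \<Rightarrow> ('e, 'k) pt" where
  "pt_add (Pt x) (Pt y) = Pt (x + y)"
| "pt_add (Ext x v t) (Ext y w r) = Ext (pt_add x y) (pt_add v w) (t + r)"
| "pt_add _ _ = undefined"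

primrec pt_scale :: "('k::times \<Rightarrow> 'e \<Rightarrow> 'e) \<Rightarrow> 'k \<Rightarrow> ('e, 'k) pt \<Rightarrow> ('e, 'k) pt" where
  "pt_scale s r (Pt x) = Pt (s r x)"
| "pt_scale s r (Ext x v t) = Ext (pt_scale s r x) (pt_scale s r v) (r * t)"

definition pt_dom ::
    "('k::dense_unit_ring \<Rightarrow> 'e::{topological_ab_group_add, t2_space} \<Rightarrow> 'e) \<Rightarrow> nat
      \<Rightarrow> ('e, 'k) pt set \<Rightarrow> ('e, 'k) pt set" where
  "pt_dom s n U =
     {Ext x v t |x v t. x \<in> U \<and> v \<in> topspace (pt_top n) \<and> pt_add x (pt_scale s t v) \<in> U}"

text \<open>\<open>g\<close> is a continuous map \<open>f\<^sup>[\<^sup>1\<^sup>]\<close> for \<open>f\<close> on \<open>U \<subseteq> E\<^sub>n\<close>.\<close>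

definition diff_quotient ::
    "('k::dense_unit_ring \<Rightarrow> 'e::{topological_ab_group_add, t2_space} \<Rightarrow> 'e)
      \<Rightarrow> ('k \<Rightarrow> 'g::{topological_ab_group_add, t2_space} \<Rightarrow> 'g) \<Rightarrow> nat \<Rightarrow> ('e, 'k) pt set
      \<Rightarrow> (('e, 'k) pt \<Rightarrow> 'g) \<Rightarrow> (('e, 'k) pt \<Rightarrow> 'g) \<Rightarrow> bool" where
  "diff_quotient s s' n U f g \<longleftrightarrow>
     continuous_map (subtopology (pt_top (Suc n)) (pt_dom s n U)) euclidean g \<and>
     (\<forall>x v t. Ext x v t \<in> pt_dom s n U \<longrightarrow>
        f (pt_add x (pt_scale s t v)) - f x = s' t (g (Ext x v t)))"

primrec C_on ::
    "('k::dense_unit_ring \<Rightarrow> 'e::{topological_ab_group_add, t2_space} \<Rightarrow> 'e)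
      \<Rightarrow> ('k \<Rightarrow> 'g::{topological_ab_group_add, t2_space} \<Rightarrow> 'g) \<Rightarrow> nat \<Rightarrow> nat \<Rightarrow> ('e, 'k) pt set
      \<Rightarrow> (('e, 'k) pt \<Rightarrow> 'g) \<Rightarrow> bool" where
  "C_on s s' 0 = (\<lambda>n U f. continuous_map (subtopology (pt_top n) U) euclidean f)"
| "C_on s s' (Suc j) = (\<lambda>n U f.
     \<exists>g. diff_quotient s s' n U f g \<and> C_on s s' j (Suc n) (pt_dom s n U) g)"

definition smooth_on ::
    "('k::dense_unit_ring \<Rightarrow> 'e::{topological_ab_group_add, t2_space} \<Rightarrow> 'e)
      \<Rightarrow> ('k \<Rightarrow> 'g::{topological_ab_group_add, t2_space} \<Rightarrow> 'g)
      \<Rightarrow> 'e set \<Rightarrow> ('e \<Rightarrow> 'g) \<Rightarrow> bool" where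
  "smooth_on s s' U f \<longleftrightarrow> open U \<and> (\<forall>j. C_on s s' j 0 (Pt ` U) (f \<circ> pt_val))"

text \<open>\<open>diffl s s' U f x v = df(x)v = \<partial>\<^sub>vf(x)\<close>. For \<open>f\<close> of class \<open>C\<^sup>1\<close> on the open set \<open>U\<close> the map
  \<open>f\<^sup>[\<^sup>1\<^sup>]\<close> is unique on its domain, because the units are dense.\<close>

definition diffl ::
    "('k::dense_unit_ring \<Rightarrow> 'e::{topological_ab_group_add, t2_space} \<Rightarrow> 'e)
      \<Rightarrow> ('k \<Rightarrow> 'g::{topological_ab_group_add, t2_space} \<Rightarrow> 'g)
      \<Rightarrow> 'e set \<Rightarrow> ('e \<Rightarrow> 'g) \<Rightarrow> 'e \<Rightarrow> 'e \<Rightarrow> 'g" where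
  "diffl s s' U f x v =
     (SOME g. diff_quotient s s' 0 (Pt ` U) (f \<circ> pt_val) g) (Ext (Pt x) (Pt v) 0)"


section \<open>Manifolds and tangent bundles\<close>

text \<open>A manifold is given by its atlas. The topology is the one for which the charts are
  homeomorphisms between open sets; it is determined by the atlas and is not needed below.\<close>

record ('k, 'i, 'm, 'e) mfd =
  charts :: "'i set"
  cdom :: "'i \<Rightarrow> 'm set"
  cmap :: "'i \<Rightarrow> 'm \<Rightarrow> 'e"
  mscale :: "'k \<Rightarrow> 'e \<Rightarrow> 'e"

definition points :: "('k, 'i, 'm, 'e) mfd \<Rightarrow> 'm set" where
  "points A = (\<Union>i\<in>charts A. cdom A i)"

definition img :: "('k, 'i, 'm, 'e) mfd \<Rightarrow> 'i \<Rightarrow> 'e set" where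
  "img A i = cmap A i ` cdom A i"

definition pt_of :: "('k, 'i, 'm, 'e) mfd \<Rightarrow> 'i \<Rightarrow> 'e \<Rightarrow> 'm" where
  "pt_of A i x = inv_into (cdom A i) (cmap A i) x"

definition loc_dom ::
    "('k, 'i, 'm, 'e) mfd \<Rightarrow> ('k, 'j, 'n, 'g) mfd \<Rightarrow> ('m \<Rightarrow> 'n) \<Rightarrow> 'i \<Rightarrow> 'j \<Rightarrow> 'e set" where
  "loc_dom A B f i j = {x \<in> img A i. f (pt_of A i x) \<in> cdom B j}"

definition loc_map ::
    "('k, 'i, 'm, 'e) mfd \<Rightarrow> ('k, 'j, 'n, 'g) mfd \<Rightarrow> ('m \<Rightarrow> 'n) \<Rightarrow> 'i \<Rightarrow> 'j \<Rightarrow> 'e \<Rightarrow> 'g" where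
  "loc_map A B f i j x = cmap B j (f (pt_of A i x))"

definition smooth_manifold ::
    "('k::dense_unit_ring, 'i, 'm, 'e::{topological_ab_group_add, t2_space}) mfd \<Rightarrow> bool" where
  "smooth_manifold A \<longleftrightarrow>
     topological_module (mscale A) \<and>
     (\<forall>i\<in>charts A. inj_on (cmap A i) (cdom A i) \<and> open (img A i)) \<and>
     (\<forall>i\<in>charts A. \<forall>j\<in>charts A.
        smooth_on (mscale A) (mscale A) (loc_dom A A id i j) (loc_map A A id i j))"

definition tangent_loc ::
    "('k::dense_unit_ring, 'i, 'm, 'e::{topological_ab_group_add, t2_space}) mfd
      \<Rightarrow> ('k, 'j, 'n, 'g::{topological_ab_group_add, t2_space}) mfd
      \<Rightarrow> ('m \<Rightarrow> 'n) \<Rightarrow> 'i \<Rightarrow> 'j \<Rightarrow> 'e \<times> 'e \<Rightarrow> 'g \<times> 'g" where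
  "tangent_loc A B f i j = (\<lambda>(x, v).
     (loc_map A B f i j x,
      diffl (mscale A) (mscale B) (loc_dom A B f i j) (loc_map A B f i j) x v))"

text \<open>A tangent vector is the equivalence class of all its chart representatives \<open>(i, x, v)\<close>.\<close>

definition tangent_vec ::
    "('k::dense_unit_ring, 'i, 'm, 'e::{topological_ab_group_add, t2_space}) mfd
      \<Rightarrow> 'i \<Rightarrow> 'e \<times> 'e \<Rightarrow> ('i \<times> 'e \<times> 'e) set" where
  "tangent_vec A i z =
     {(j, tangent_loc A A id i j z) |j. j \<in> charts A \<and> fst z \<in> loc_dom A A id i j}"

definition tangent ::
    "('k::dense_unit_ring, 'i, 'm, 'e::{topological_ab_group_add, t2_space}) mfd
      \<Rightarrow> ('k, 'i, ('i \<times> 'e \<times> 'e) set, 'e \<times> 'e) mfd" where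
  "tangent A =
     \<lparr>charts = charts A,
      cdom = (\<lambda>i. tangent_vec A i ` (img A i \<times> UNIV)),
      cmap = (\<lambda>i p. THE z. (i, z) \<in> p),
      mscale = prod_scale (mscale A) (mscale A)\<rparr>"

definition foot ::
    "('k, 'i, 'm, 'e) mfd \<Rightarrow> ('i \<times> 'e \<times> 'e) set \<Rightarrow> 'm" where
  "foot A p = (THE m. \<exists>i x v. (i, x, v) \<in> p \<and> m = pt_of A i x)"

definition tangent_map ::
    "('k::dense_unit_ring, 'i, 'm, 'e::{topological_ab_group_add, t2_space}) mfd
      \<Rightarrow> ('k, 'j, 'n, 'g::{topological_ab_group_add, t2_space}) mfd
      \<Rightarrow> ('m \<Rightarrow> 'n) \<Rightarrow> ('i \<times> 'e \<times> 'e) set \<Rightarrow> ('j \<times> 'g \<times> 'g) set" where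
  "tangent_map A B f p =
     (THE q. q \<in> points (tangent B) \<and>
        (\<forall>(i, z)\<in>p. \<forall>j\<in>charts B. fst z \<in> loc_dom A B f i j \<longrightarrow> (j, tangent_loc A B f i j z) \<in> q))"


section \<open>Vector bundles\<close>

text \<open>Charts of the base and bundle charts are indexed by the same set, the bundle chart \<open>i\<close> being
  defined over the domain of the chart \<open>i\<close> of the base. The module structure of the fibers is the
  one carried over by the bundle charts.\<close>

record ('k, 'i, 'm, 'p, 'v, 'w) vbundle =
  base :: "('k, 'i, 'm, 'v) mfd"
  tot :: "('k, 'i, 'p, 'v \<times> 'w) mfd"
  vproj :: "'p \<Rightarrow> 'm"
  fscale :: "'k \<Rightarrow> 'w \<Rightarrow> 'w"

definition vector_bundle ::
    "('k::dense_unit_ring, 'i, 'm, 'p, 'v::{topological_ab_group_add, t2_space},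
      'w::{topological_ab_group_add, t2_space}) vbundle \<Rightarrow> bool" where
  "vector_bundle F \<longleftrightarrow>
     smooth_manifold (base F) \<and> smooth_manifold (tot F) \<and> topological_module (fscale F) \<and>
     mscale (tot F) = prod_scale (mscale (base F)) (fscale F) \<and>
     charts (tot F) = charts (base F) \<and>
     (\<forall>i\<in>charts (base F).
        cdom (tot F) i = {p \<in> points (tot F). vproj F p \<in> cdom (base F) i} \<and>
        img (tot F) i = img (base F) i \<times> UNIV \<and>
        (\<forall>p\<in>cdom (tot F) i. fst (cmap (tot F) i p) = cmap (base F) i (vproj F p))) \<and>
     (\<forall>i\<in>charts (base F). \<forall>j\<in>charts (base F). \<forall>x\<in>loc_dom (base F) (base F) id i j.
        module_hom (fscale F) (fscale F) (\<lambda>w. snd (loc_map (tot F) (tot F) id i j (x, w))))"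

definition tangent_bundle ::
    "('k::dense_unit_ring, 'i, 'm, 'v::{topological_ab_group_add, t2_space}) mfd
      \<Rightarrow> ('k, 'i, 'm, ('i \<times> 'v \<times> 'v) set, 'v, 'v) vbundle" where
  "tangent_bundle M = \<lparr>base = M, tot = tangent M, vproj = foot M, fscale = mscale M\<rparr>"

definition fiber :: "('k, 'i, 'm, 'p, 'v, 'w) vbundle \<Rightarrow> 'm \<Rightarrow> 'p set" where
  "fiber F m = {p \<in> points (tot F). vproj F p = m}"

definition fiber_zero :: "('k, 'i, 'm, 'p, 'v, 'w::zero) vbundle \<Rightarrow> 'm \<Rightarrow> 'p" where
  "fiber_zero F m =
     (THE p. p \<in> fiber F m \<and>
        (\<forall>i\<in>charts (base F). m \<in> cdom (base F) i \<longrightarrow> snd (cmap (tot F) i p) = 0))"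

definition fiber_add :: "('k, 'i, 'm, 'p, 'v, 'w::plus) vbundle \<Rightarrow> 'p \<Rightarrow> 'p \<Rightarrow> 'p" where
  "fiber_add F p q =
     (THE r. r \<in> fiber F (vproj F p) \<and>
        (\<forall>i\<in>charts (base F). vproj F p \<in> cdom (base F) i \<longrightarrow>
           snd (cmap (tot F) i r) = snd (cmap (tot F) i p) + snd (cmap (tot F) i q)))"


section \<open>Linear connections\<close>

text \<open>The module structures on the fibers of \<open>TF \<rightarrow> M\<close>, given by two operations on \<open>TF\<close>
  (relevant only for arguments over the same point of \<open>M\<close>). In the chart of \<open>TF\<close> the point
  \<open>x + \<epsilon>\<^sub>0w + \<epsilon>\<^sub>1v + \<epsilon>\<^sub>0\<epsilon>\<^sub>1w'\<close> is \<open>((x, w), (v, w'))\<close>.\<close>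

record ('k, 'q) fiber_structure =
  ladd :: "'q \<Rightarrow> 'q \<Rightarrow> 'q"
  lscale :: "'k \<Rightarrow> 'q \<Rightarrow> 'q"

type_synonym ('k, 'i, 'v, 'w) connection =
  "('k, ('i \<times> ('v \<times> 'w) \<times> ('v \<times> 'w)) set) fiber_structure"

text \<open>\<open>b\<close> is the Christoffel tensor of \<open>L\<close> in the chart \<open>i\<close>, with \<open>b x w v = b\<^sub>x(w, v)\<close>.\<close>

definition christoffel ::
    "('k::dense_unit_ring, 'i, 'm, 'p, 'v::{topological_ab_group_add, t2_space},
      'w::{topological_ab_group_add, t2_space}) vbundle
      \<Rightarrow> ('k, 'i, 'v, 'w) connection \<Rightarrow> 'i \<Rightarrow> ('v \<Rightarrow> 'w \<Rightarrow> 'v \<Rightarrow> 'w) \<Rightarrow> bool" where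
  "christoffel F L i b \<longleftrightarrow>
     (let sV = mscale (base F); sW = fscale F; U = img (base F) i;
          lin = prod_scale sW (prod_scale sV sW);
          P = (\<lambda>x (w, v, w'). pt_of (tangent (tot F)) i ((x, w), (v, w' + b x w v)))
      in (\<forall>x\<in>U. bilinear_map sW sV sW (b x)) \<and>
         smooth_on (prod_scale sV (prod_scale sW sV)) sW (U \<times> UNIV \<times> UNIV) (\<lambda>(x, w, v). b x w v) \<and>
         (\<forall>x\<in>U. \<forall>y z. ladd L (P x y) (P x z) = P x (y + z)) \<and>
         (\<forall>x\<in>U. \<forall>r y. lscale L r (P x y) = P x (lin r y)))"

definition linear_connection ::
    "('k::dense_unit_ring, 'i, 'm, 'p, 'v::{topological_ab_group_add, t2_space},
      'w::{topological_ab_group_add, t2_space}) vbundle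
      \<Rightarrow> ('k, 'i, 'v, 'w) connection \<Rightarrow> bool" where
  "linear_connection F L \<longleftrightarrow> (\<forall>i\<in>charts (base F). \<exists>b. christoffel F L i b)"

definition torsionfree_connection ::
    "('k::dense_unit_ring, 'i, 'm, 'v::{topological_ab_group_add, t2_space}) mfd
      \<Rightarrow> ('k, 'i, 'v, 'v) connection \<Rightarrow> bool" where
  "torsionfree_connection M L \<longleftrightarrow>
     linear_connection (tangent_bundle M) L \<and>
     (\<forall>i\<in>charts M. \<forall>b. christoffel (tangent_bundle M) L i b \<longrightarrow>
        (\<forall>x\<in>img M i. \<forall>u v. b x u v = b x v u))"


section \<open>The splitting map of a connection\<close>

text \<open>The bundle \<open>F \<oplus> TM \<oplus> F\<close> over \<open>M\<close>.\<close>

definition split_bundle ::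
    "('k::dense_unit_ring, 'i, 'm, 'p, 'v::{topological_ab_group_add, t2_space},
      'w::{topological_ab_group_add, t2_space}) vbundle
      \<Rightarrow> ('k, 'i, 'p \<times> ('i \<times> 'v \<times> 'v) set \<times> 'p, 'v \<times> 'w \<times> 'v \<times> 'w) mfd" where
  "split_bundle F =
     \<lparr>charts = charts (base F),
      cdom = (\<lambda>i. {(p, t, q). p \<in> cdom (tot F) i \<and> t \<in> cdom (tangent (base F)) i \<and>
                             q \<in> cdom (tot F) i \<and>
                             vproj F p = foot (base F) t \<and> vproj F q = foot (base F) t}),
      cmap = (\<lambda>i (p, t, q). (cmap (base F) i (foot (base F) t), snd (cmap (tot F) i p),
                             snd (cmap (tangent (base F)) i t), snd (cmap (tot F) i q))),
      mscale = prod_scale (mscale (base F))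
                 (prod_scale (fscale F) (prod_scale (mscale (base F)) (fscale F)))\<rparr>"

definition splitting ::
    "('k::dense_unit_ring, 'i, 'm, 'p, 'v::{topological_ab_group_add, t2_space},
      'w::{topological_ab_group_add, t2_space}) vbundle
      \<Rightarrow> ('k, 'i, 'v, 'w) connection \<Rightarrow> 'p \<times> ('i \<times> 'v \<times> 'v) set \<times> 'p
      \<Rightarrow> ('i \<times> ('v \<times> 'w) \<times> ('v \<times> 'w)) set" where
  "splitting F L z =
     (THE p. p \<in> points (tangent (tot F)) \<and>
        (\<forall>i\<in>charts (base F). \<forall>b. z \<in> cdom (split_bundle F) i \<and> christoffel F L i b \<longrightarrow>
           p \<in> cdom (tangent (tot F)) i \<and>
           cmap (tangent (tot F)) i p =
             (case cmap (split_bundle F) i z of (x, w, v, w') \<Rightarrow> ((x, w), (v, w' + b x w v)))))"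


section \<open>The derived connection on the second tangent bundle\<close>

text \<open>Points of the axes-bundle; the field \<open>ax\<^sub>\<alpha>\<close> is the component on the axis \<open>\<epsilon>\<^sup>\<alpha>\<close>.\<close>

record ('p, 't) axes =
  ax0 :: 'p
  ax1 :: 't
  ax2 :: 't
  ax01 :: 'p
  ax02 :: 'p
  ax12 :: 't
  ax012 :: 'p

type_synonym ('i, 'p, 'v) axes_point = "('p, ('i \<times> 'v \<times> 'v) set) axes"

type_synonym ('i, 'v, 'w) second_tangent_point =
  "('i \<times> (('v \<times> 'w) \<times> ('v \<times> 'w)) \<times> (('v \<times> 'w) \<times> ('v \<times> 'w))) set"

definition axes_fiber ::
    "('k::dense_unit_ring, 'i, 'm, 'p, 'v::{topological_ab_group_add, t2_space}, 'w) vbundle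
      \<Rightarrow> 'm \<Rightarrow> ('i, 'p, 'v) axes_point set" where
  "axes_fiber F m =
     {a. {ax0 a, ax01 a, ax02 a, ax012 a} \<subseteq> fiber F m \<and>
         {ax1 a, ax2 a, ax12 a} \<subseteq> fiber (tangent_bundle (base F)) m}"

definition axes_bundle ::
    "('k::dense_unit_ring, 'i, 'm, 'p, 'v::{topological_ab_group_add, t2_space}, 'w) vbundle
      \<Rightarrow> ('i, 'p, 'v) axes_point set" where
  "axes_bundle F = (\<Union>m\<in>points (base F). axes_fiber F m)"

text \<open>In a chart, the point \<open>x + \<Sum>\<^sub>\<alpha> \<epsilon>\<^sup>\<alpha>u\<^sub>\<alpha>\<close> of \<open>T\<^sup>2F\<close> is
  \<open>(((x, w\<^sub>0), (v\<^sub>1, w\<^sub>0\<^sub>1)), ((v\<^sub>2, w\<^sub>0\<^sub>2), (v\<^sub>1\<^sub>2, w\<^sub>0\<^sub>1\<^sub>2)))\<close>.\<close>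

definition second_tangent ::
    "('k::dense_unit_ring, 'i, 'm, 'p, 'v::{topological_ab_group_add, t2_space},
      'w::{topological_ab_group_add, t2_space}) vbundle
      \<Rightarrow> ('k, 'i, ('i, 'v, 'w) second_tangent_point,
          (('v \<times> 'w) \<times> ('v \<times> 'w)) \<times> (('v \<times> 'w) \<times> ('v \<times> 'w))) mfd" where
  "second_tangent F = tangent (tangent (tot F))"

definition second_tangent_fiber ::
    "('k::dense_unit_ring, 'i, 'm, 'p, 'v::{topological_ab_group_add, t2_space},
      'w::{topological_ab_group_add, t2_space}) vbundle
      \<Rightarrow> 'm \<Rightarrow> ('i, 'v, 'w) second_tangent_point set" where
  "second_tangent_fiber F m =
     {p \<in> points (second_tangent F). vproj F (foot (tot F) (foot (tangent (tot F)) p)) = m}"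

text \<open>The identification \<open>TF \<times>\<^bsub>TM\<^esub> TTM \<times>\<^bsub>TM\<^esub> TF \<cong> T(F \<oplus> TM \<oplus> F)\<close>, inverse to the tangent maps of the
  three projections.\<close>

definition tangent_split ::
    "('k::dense_unit_ring, 'i, 'm, 'p, 'v::{topological_ab_group_add, t2_space},
      'w::{topological_ab_group_add, t2_space}) vbundle
      \<Rightarrow> ('i \<times> ('v \<times> 'w) \<times> ('v \<times> 'w)) set \<Rightarrow> ('i \<times> ('v \<times> 'v) \<times> ('v \<times> 'v)) set
      \<Rightarrow> ('i \<times> ('v \<times> 'w) \<times> ('v \<times> 'w)) set
      \<Rightarrow> ('i \<times> ('v \<times> 'w \<times> 'v \<times> 'w) \<times> ('v \<times> 'w \<times> 'v \<times> 'w)) set" where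
  "tangent_split F p t q =
     (THE z. z \<in> points (tangent (split_bundle F)) \<and>
        tangent_map (split_bundle F) (tot F) fst z = p \<and>
        tangent_map (split_bundle F) (tangent (base F)) (fst \<circ> snd) z = t \<and>
        tangent_map (split_bundle F) (tot F) (snd \<circ> snd) z = q)"

text \<open>\<open>\<Phi>\<^sub>2 = D\<Phi>\<^sub>1\<close>: the tangent map of \<open>\<Phi>\<^sub>1\<close> with respect to \<open>\<epsilon>\<^sub>2\<close>, after splitting the three components
  \<open>\<epsilon>\<^sub>0F\<close>, \<open>\<epsilon>\<^sub>1TM\<close>, \<open>\<epsilon>\<^sub>0\<epsilon>\<^sub>1F\<close> (together with their \<open>\<epsilon>\<^sub>2\<close>-tangent components) by \<open>L\<close>, \<open>L'\<close>, \<open>L\<close>.\<close>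

definition derived_splitting ::
    "('k::dense_unit_ring, 'i, 'm, 'p, 'v::{topological_ab_group_add, t2_space},
      'w::{topological_ab_group_add, t2_space}) vbundle
      \<Rightarrow> ('k, 'i, 'v, 'w) connection \<Rightarrow> ('k, 'i, 'v, 'v) connection
      \<Rightarrow> ('i, 'p, 'v) axes_point \<Rightarrow> ('i, 'v, 'w) second_tangent_point" where
  "derived_splitting F L L' a =
     tangent_map (split_bundle F) (tangent (tot F)) (splitting F L)
       (tangent_split F
          (splitting F L (ax0 a, ax2 a, ax02 a))
          (splitting (tangent_bundle (base F)) L' (ax1 a, ax2 a, ax12 a))
          (splitting F L (ax01 a, ax2 a, ax012 a)))"


section \<open>The canonical flip and curvature\<close>

definition flip :: "('i \<times> ('e \<times> 'e) \<times> ('e \<times> 'e)) set \<Rightarrow> ('i \<times> ('e \<times> 'e) \<times> ('e \<times> 'e)) set" where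
  "flip p = (\<lambda>(i, (x0, x1), (x2, x12)). (i, (x0, x2), (x1, x12))) ` p"

definition flip_axes :: "('p, 't) axes \<Rightarrow> ('p, 't) axes" where
  "flip_axes a = a\<lparr>ax1 := ax2 a, ax2 := ax1 a, ax01 := ax02 a, ax02 := ax01 a\<rparr>"

definition curvature ::
    "('k::dense_unit_ring, 'i, 'm, 'p, 'v::{topological_ab_group_add, t2_space},
      'w::{topological_ab_group_add, t2_space}) vbundle
      \<Rightarrow> ('k, 'i, 'v, 'w) connection \<Rightarrow> ('k, 'i, 'v, 'v) connection
      \<Rightarrow> ('i, 'v, 'w) second_tangent_point \<Rightarrow> ('i, 'v, 'w) second_tangent_point" where
  "curvature F L L' =
     flip \<circ> derived_splitting F L L' \<circ> inv_into (axes_bundle F) flip_axes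
       \<circ> inv_into (axes_bundle F) (derived_splitting F L L')"

definition axes_curvature ::
    "('k::dense_unit_ring, 'i, 'm, 'p, 'v::{topological_ab_group_add, t2_space},
      'w::{topological_ab_group_add, t2_space}) vbundle
      \<Rightarrow> ('k, 'i, 'v, 'w) connection \<Rightarrow> ('k, 'i, 'v, 'v) connection
      \<Rightarrow> ('i, 'p, 'v) axes_point \<Rightarrow> ('i, 'p, 'v) axes_point" where
  "axes_curvature F L L' =
     inv_into (axes_bundle F) (derived_splitting F L L') \<circ> curvature F L L' \<circ> derived_splitting F L L'"

text \<open>Sign: \<open>\<Phi>\<^sub>2 o axes_curvature\<close> is the flip-conjugate of \<open>\<Phi>\<^sub>2\<close>, whose \<open>\<epsilon>\<^sub>0\<epsilon>\<^sub>1\<epsilon>\<^sub>2\<close>-component contains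
  \<open>b\<^sub>x(b\<^sub>x(w\<^sub>0, v\<^sub>1), v\<^sub>2) + \<partial>\<^bsub>v1\<^esub>b\<^sub>x(w\<^sub>0, v\<^sub>2)\<close>, while that of \<open>\<Phi>\<^sub>2\<close> contains
  \<open>b\<^sub>x(b\<^sub>x(w\<^sub>0, v\<^sub>2), v\<^sub>1) + \<partial>\<^bsub>v2\<^esub>b\<^sub>x(w\<^sub>0, v\<^sub>1)\<close>. The component of \<open>axes_curvature\<close> is the first expression
  minus the second, which is the negative of the classical curvature \<open>R(v\<^sub>1, v\<^sub>2)w\<^sub>0\<close> of the covariant
  derivative \<open>\<nabla>\<^sub>vs = \<partial>\<^sub>vs - b\<^sub>x(s, v)\<close>.\<close>

text \<open>The component belonging to the partition \<open>(e\<^sub>1, e\<^sub>2, e\<^sub>3)\<close> of a multilinear self-map \<open>h\<close> of the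
  axes-bundle: the \<open>\<epsilon>\<^sub>0\<epsilon>\<^sub>1\<epsilon>\<^sub>2\<close>-component of the value at a point with components on the \<open>\<epsilon>\<^sub>0\<close>-, \<open>\<epsilon>\<^sub>1\<close>-
  and \<open>\<epsilon>\<^sub>2\<close>-axis only. All other components with values in the \<open>\<epsilon>\<^sub>0\<epsilon>\<^sub>1\<epsilon>\<^sub>2\<close>-axis vanish there.\<close>

definition top_component ::
    "('k::dense_unit_ring, 'i, 'm, 'p, 'v::{topological_ab_group_add, t2_space},
      'w::{topological_ab_group_add, t2_space}) vbundle
      \<Rightarrow> (('i, 'p, 'v) axes_point \<Rightarrow> ('i, 'p, 'v) axes_point)
      \<Rightarrow> ('i \<times> 'v \<times> 'v) set \<Rightarrow> ('i \<times> 'v \<times> 'v) set \<Rightarrow> 'p \<Rightarrow> 'p" where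
  "top_component F h v1 v2 w0 =
     (let o_F = fiber_zero F (vproj F w0);
          o_T = fiber_zero (tangent_bundle (base F)) (vproj F w0)
      in ax012 (h \<lparr>ax0 = w0, ax1 = v1, ax2 = v2, ax01 = o_F, ax02 = o_F, ax12 = o_T, ax012 = o_F\<rparr>))"

text \<open>The group of self-maps of the fiber \<open>(TTF)\<^sub>m\<close> that are, in bundle charts, the identity plus a
  trilinear map in \<open>(w\<^sub>0, v\<^sub>1, v\<^sub>2)\<close> with values in the \<open>\<epsilon>\<^sub>0\<epsilon>\<^sub>1\<epsilon>\<^sub>2\<close>-component. Maps are considered only on
  that fiber.\<close>

definition Gm23 ::
    "('k::dense_unit_ring, 'i, 'm, 'p, 'v::{topological_ab_group_add, t2_space},
      'w::{topological_ab_group_add, t2_space}) vbundle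
      \<Rightarrow> 'm \<Rightarrow> (('i, 'v, 'w) second_tangent_point \<Rightarrow> ('i, 'v, 'w) second_tangent_point) set" where
  "Gm23 F m =
     {h. h ` second_tangent_fiber F m \<subseteq> second_tangent_fiber F m \<and>
         (\<forall>i\<in>charts (base F). m \<in> cdom (base F) i \<longrightarrow>
            (\<exists>g. trilinear_map (fscale F) (mscale (base F)) (mscale (base F)) (fscale F) g \<and>
               (\<forall>p\<in>second_tangent_fiber F m.
                  cmap (second_tangent F) i (h p) =
                    (case cmap (second_tangent F) i p of
                       (((x, w0), (v1, w01)), ((v2, w02), (v12, w012))) \<Rightarrow>
                         (((x, w0), (v1, w01)), ((v2, w02), (v12, w012 + g w0 v1 v2)))))))}"

end

theory Submission
  imports Defs
begin

text \<open>
  Over a chart of the base every fiber of \<open>A\<^sup>2F\<close> and of \<open>T\<^sup>2F\<close> is a product of seven modules, and there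
  \<open>\<Phi>\<^sub>2\<close> is triangular: the components on the axes \<open>\<epsilon>\<^sub>0\<close>, \<open>\<epsilon>\<^sub>1\<close>, \<open>\<epsilon>\<^sub>2\<close> are kept, each of the three components of
  degree two is shifted by a bilinear term in \<open>b\<close> or \<open>c\<close>, and the top component is shifted by a sum in which it
  does not occur itself (\<open>derived_splitting_axes_pt\<close>). Conjugating with the flip exchanges \<open>v\<^sub>1\<close> with \<open>v\<^sub>2\<close> and
  \<open>w\<^sub>0\<^sub>1\<close> with \<open>w\<^sub>0\<^sub>2\<close>. All shifts in degree two are compatible with this exchange, the one on the axis
  \<open>\<epsilon>\<^sub>1\<epsilon>\<^sub>2\<close> because \<open>c\<close> is symmetric, and in the top shift only \<open>b(b(w\<^sub>0, v\<^sub>2), v\<^sub>1) + \<partial>\<^bsub>v2\<^esub>b(w\<^sub>0, v\<^sub>1)\<close> is not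
  invariant. Hence \<open>\<kappa> o \<Phi>\<^sub>2 o \<kappa>\<close> is \<open>\<Phi>\<^sub>2\<close> followed by a translation of the top component by \<open>curv\<close>, an
  expression that depends on \<open>w\<^sub>0\<close>, \<open>v\<^sub>1\<close>, \<open>v\<^sub>2\<close> and \<open>b\<close> only (\<open>derived_splitting_flip_axes_pt\<close>). As \<open>\<Phi>\<^sub>2\<close> keeps
  these three components and commutes with translations of the top component, both \<open>R\<close> and its conjugate by \<open>\<Phi>\<^sub>2\<close>
  are this translation (\<open>curvature_second_pt\<close>, \<open>axes_curvature_axes_pt\<close>). All assertions can be read off: the
  formula for the top form, its trilinearity, and independence of \<open>L'\<close>, since \<open>c\<close> has cancelled.

  The longer part of the proof justifies the computation in charts, because tangent vectors, splitting maps and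
  tangent maps are defined by what they are in \<^emph>\<open>all\<close> charts. Four facts are behind this.

  \<^item> Difference quotients are determined by their values at invertible parameters, since the units are dense.
    So derivatives are unique, linear in the direction, and obey the chain rule; and the second derivative is
    symmetric, because both orders of differentiation are limits of the same second difference
    (\<open>second_derivative_symmetric\<close>).

  \<^item> By the chain rule, a tangent vector and the image of a tangent vector under a tangent map have the expected
    representatives in every chart (\<open>tangent_vec_change_chart\<close>, \<open>tangent_map_tangent_vec\<close>). An atlas of class
    \<open>C\<^sup>2\<close> induces an atlas of class \<open>C\<^sup>1\<close> on the tangent bundle, so that for \<open>T\<^sup>2F\<close> derivatives of order two
    suffice.

  \<^item> The flip is well defined on \<open>T\<^sup>2F\<close> by the symmetry of the second derivatives of the transition maps
    (\<open>flip_tangent_vec\<close>).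

  \<^item> The splitting map of a connection is well defined by the transformation rule of Christoffel tensors
    (\<open>christoffel_transform\<close>). It holds because both charts carry the same addition on the fibers of \<open>TF\<close>: the
    difference of the two sides is a map of \<open>(w, v)\<close> that is additive in the pair and vanishes when one of
    the entries is zero.
\<close>

section \<open>Topological modules\<close>

lemma topological_moduleD:
  assumes "topological_module s"
  shows "module s"
    and "s r (x + y) = s r x + s r y"
    and "s (r + q) x = s r x + s q x"
    and "s r (s q x) = s (r * q) x"
    and "s 1 x = x"
    and "s 0 x = 0"
    and "s r 0 = 0"
    and "s r (x - y) = s r x - s r y"
    and "s r (- x) = - s r x"
proof -
  show "module s" using assms by (simp add: topological_module_def)
  then interpret module s .
  show "s r (x + y) = s r x + s r y"
    and "s (r + q) x = s r x + s q x"
    and "s r (s q x) = s (r * q) x"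
    and "s 1 x = x"
    and "s 0 x = 0"
    and "s r 0 = 0"
    and "s r (x - y) = s r x - s r y"
    and "s r (- x) = - s r x"
    by (simp_all add: scale_right_distrib scale_left_distrib scale_right_diff_distrib)
qed

lemma continuous_on_module_scale:
  assumes "topological_module s" "continuous_on A f" "continuous_on A g"
  shows "continuous_on A (\<lambda>x. s (f x) (g x))"
proof -
  have c: "continuous_on UNIV (\<lambda>(r, x). s r x)" using assms(1) by (simp add: topological_module_def)
  have "continuous_on A (\<lambda>x. (f x, g x))" by (intro continuous_on_Pair assms)
  from continuous_on_compose2[OF c this] show ?thesis by simp
qed

lemma topological_module_prod:
  assumes "topological_module s" "topological_module s'"
  shows "topological_module (prod_scale s s')"
proof -
  have "module (prod_scale s s')"
    by unfold_locales
      (auto simp: prod_scale_def topological_moduleD[OF assms(1)] topological_moduleD[OF assms(2)])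
  moreover have "continuous_on UNIV (\<lambda>(r, x). prod_scale s s' r x)"
    unfolding prod_scale_def split_beta map_prod_def
    by (intro continuous_on_Pair continuous_on_module_scale[OF assms(1)]
        continuous_on_module_scale[OF assms(2)] continuous_intros)
  ultimately show ?thesis by (simp add: topological_module_def)
qed

lemma topological_module_mult: "topological_module ((*) :: 'k::dense_unit_ring \<Rightarrow> 'k \<Rightarrow> 'k)"
proof -
  have "module ((*) :: 'k \<Rightarrow> 'k \<Rightarrow> 'k)" by unfold_locales (auto simp: algebra_simps)
  moreover have "continuous_on UNIV (\<lambda>(r :: 'k, x). r * x)"
    unfolding split_beta by (intro continuous_intros)
  ultimately show ?thesis by (simp add: topological_module_def)
qed

lemma unit_scale_cancel:
  assumes "topological_module s" "r dvd 1" "s r a = s r b"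
  shows "a = b"
proof -
  obtain k where k: "1 = r * k" using assms(2) by (auto elim: dvdE)
  have "a = s k (s r a)" using k by (simp add: topological_moduleD[OF assms(1)] mult.commute)
  also have "\<dots> = s k (s r b)" by (simp add: assms(3))
  also have "\<dots> = b" using k by (simp add: topological_moduleD[OF assms(1)] mult.commute)
  finally show ?thesis .
qed

text \<open>Every nonempty open set of scalars contains a unit, so the open set on which two continuous maps differ is
  empty as soon as it contains no unit. All uniqueness statements about derivatives rest on this.\<close>

lemma eq_if_eq_on_units:
  fixes f g :: "'k::dense_unit_ring \<Rightarrow> 'g::t2_space"
  assumes "open T" "continuous_on T f" "continuous_on T g"
    and eq: "\<And>t. t \<in> T \<Longrightarrow> t dvd 1 \<Longrightarrow> f t = g t"
    and "t \<in> T"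
  shows "f t = g t"
proof (rule ccontr)
  assume "f t \<noteq> g t"
  from hausdorff[OF this] obtain A B
    where AB: "open A" "open B" "f t \<in> A" "g t \<in> B" "A \<inter> B = {}"
    by auto
  define D where "D = (f -` A \<inter> T) \<inter> (g -` B \<inter> T)"
  have "open (f -` A \<inter> T)"
    using continuous_on_open_vimage[OF assms(1), of f] assms(2) AB(1) by simp
  moreover have "open (g -` B \<inter> T)"
    using continuous_on_open_vimage[OF assms(1), of g] assms(3) AB(2) by simp
  ultimately have "open D" unfolding D_def by (rule open_Int)
  moreover have "t \<in> D" using AB \<open>t \<in> T\<close> by (auto simp: D_def)
  ultimately have "D \<inter> {r. r dvd 1} \<noteq> {}" by (intro dense_units) auto
  then obtain u where "u \<in> D" "u dvd 1" by auto
  then show False using eq[of u] AB by (auto simp: D_def)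
qed


section \<open>Maps of class \<open>C\<^sup>1\<close>\<close>

definition dq_dom ::
    "('k::dense_unit_ring \<Rightarrow> 'e::{topological_ab_group_add, t2_space} \<Rightarrow> 'e) \<Rightarrow> 'e set
      \<Rightarrow> ('e \<times> 'e \<times> 'k) set" where
  "dq_dom s U = {(x, v, t). x \<in> U \<and> x + s t v \<in> U}"

text \<open>The difference quotient of order one on a product type. Class \<open>C\<^sup>2\<close> is obtained by using it once more on
  the larger product, with no recursion through modules of different types.\<close>

definition is_dq ::
    "('k::dense_unit_ring \<Rightarrow> 'e::{topological_ab_group_add, t2_space} \<Rightarrow> 'e)
      \<Rightarrow> ('k \<Rightarrow> 'g::{topological_ab_group_add, t2_space} \<Rightarrow> 'g) \<Rightarrow> 'e set
      \<Rightarrow> ('e \<Rightarrow> 'g) \<Rightarrow> ('e \<times> 'e \<times> 'k \<Rightarrow> 'g) \<Rightarrow> bool" where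
  "is_dq s s' U f g \<longleftrightarrow> continuous_on (dq_dom s U) g \<and>
     (\<forall>x v t. x \<in> U \<longrightarrow> x + s t v \<in> U \<longrightarrow> f (x + s t v) - f x = s' t (g (x, v, t)))"

definition C1_on ::
    "('k::dense_unit_ring \<Rightarrow> 'e::{topological_ab_group_add, t2_space} \<Rightarrow> 'e)
      \<Rightarrow> ('k \<Rightarrow> 'g::{topological_ab_group_add, t2_space} \<Rightarrow> 'g) \<Rightarrow> 'e set
      \<Rightarrow> ('e \<Rightarrow> 'g) \<Rightarrow> bool" where
  "C1_on s s' U f \<longleftrightarrow>
     topological_module s \<and> topological_module s' \<and> open U \<and> (\<exists>g. is_dq s s' U f g)"

text \<open>Only the first difference quotient has to be of class \<open>C\<^sup>1\<close>; it lives on an open set of the module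
  \<open>E \<times> E \<times> K\<close>.\<close>

definition C2_on ::
    "('k::dense_unit_ring \<Rightarrow> 'e::{topological_ab_group_add, t2_space} \<Rightarrow> 'e)
      \<Rightarrow> ('k \<Rightarrow> 'g::{topological_ab_group_add, t2_space} \<Rightarrow> 'g) \<Rightarrow> 'e set
      \<Rightarrow> ('e \<Rightarrow> 'g) \<Rightarrow> bool" where
  "C2_on s s' U f \<longleftrightarrow>
     topological_module s \<and> topological_module s' \<and> open U \<and>
     (\<exists>g. is_dq s s' U f g \<and> C1_on (prod_scale s (prod_scale s (*))) s' (dq_dom s U) g)"

lemma C1_onD:
  assumes "C1_on s s' U f"
  shows "topological_module s" "topological_module s'" "open U"
  using assms by (auto simp: C1_on_def)

lemma C2_on_imp_C1_on: "C2_on s s' U f \<Longrightarrow> C1_on s s' U f"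
  by (auto simp: C1_on_def C2_on_def)

lemma open_line_vimage:
  assumes "topological_module s" "open U"
  shows "open {t. x + s t v \<in> U}"
proof -
  have "continuous_on UNIV (\<lambda>t. x + s t v)"
    by (intro continuous_intros continuous_on_module_scale[OF assms(1)])
  from open_vimage[OF assms(2) this] show ?thesis by (simp add: vimage_def)
qed

lemma open_dq_dom:
  fixes s :: "'k::dense_unit_ring \<Rightarrow> 'e::{topological_ab_group_add, t2_space} \<Rightarrow> 'e"
  assumes "topological_module s" "open U"
  shows "open (dq_dom s U)"
proof -
  have "continuous_on UNIV (\<lambda>z. fst z + s (snd (snd z)) (fst (snd z)))"
    by (intro continuous_intros continuous_on_module_scale[OF assms(1)])
  from open_vimage[OF assms(2) this]
  have "open {z. fst z + s (snd (snd z)) (fst (snd z)) \<in> U}" by (simp add: vimage_def)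
  moreover have "open {z :: 'e \<times> 'e \<times> 'k. fst z \<in> U}"
    using open_vimage_fst[OF assms(2)] by (simp add: vimage_def)
  moreover have "dq_dom s U = {z. fst z \<in> U} \<inter> {z. fst z + s (snd (snd z)) (fst (snd z)) \<in> U}"
    by (auto simp: dq_dom_def)
  ultimately show ?thesis by (simp add: open_Int)
qed

lemma continuous_on_dq_line:
  assumes "is_dq s s' U f g" "x \<in> U"
  shows "continuous_on {t. x + s t v \<in> U} (\<lambda>t. g (x, v, t))"
proof -
  have g: "continuous_on (dq_dom s U) g" using assms(1) by (simp add: is_dq_def)
  show ?thesis
    by (rule continuous_on_compose2[OF g])
      (auto simp: dq_dom_def assms(2) intro!: continuous_on_Pair continuous_on_const continuous_on_id)
qed

text \<open>The value of a difference quotient at the parameter \<open>0\<close> depends only on the increments of the map along a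
  line: for units \<open>t\<close> near \<open>0\<close> the increment can be divided by \<open>t\<close>, and the case \<open>t = 0\<close> follows by density.
  The two maps may be defined on different modules, which allows partial derivatives to be compared with
  derivatives of restrictions.\<close>

lemma is_dq_eq_along_line:
  assumes s: "topological_module s" and s2: "topological_module s2" and s': "topological_module s'"
    and U: "open U" and U2: "open U2"
    and g: "is_dq s s' U f g" and g2: "is_dq s2 s' U2 f2 g2"
    and x: "x \<in> U" and x2: "x2 \<in> U2"
    and N: "open N" "0 \<in> N"
    and eq: "\<And>t. t \<in> N \<Longrightarrow> x + s t v \<in> U \<Longrightarrow> x2 + s2 t v2 \<in> U2 \<Longrightarrow>
        f (x + s t v) - f x = f2 (x2 + s2 t v2) - f2 x2"
  shows "g (x, v, 0) = g2 (x2, v2, 0)"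
proof -
  define T where "T = N \<inter> {t. x + s t v \<in> U} \<inter> {t. x2 + s2 t v2 \<in> U2}"
  have T: "open T" unfolding T_def
    by (intro open_Int N open_line_vimage s s2 U U2)
  have c: "continuous_on T (\<lambda>t. g (x, v, t))"
    using continuous_on_dq_line[OF g x] by (rule continuous_on_subset) (auto simp: T_def)
  have c2: "continuous_on T (\<lambda>t. g2 (x2, v2, t))"
    using continuous_on_dq_line[OF g2 x2] by (rule continuous_on_subset) (auto simp: T_def)
  show ?thesis
  proof (rule eq_if_eq_on_units[OF T c c2])
    fix t :: 'a assume t: "t \<in> T" "t dvd 1"
    have "s' t (g (x, v, t)) = s' t (g2 (x2, v2, t))"
      using eq[of t] t g g2 x x2 by (simp add: is_dq_def T_def)
    then show "g (x, v, t) = g2 (x2, v2, t)" using unit_scale_cancel[OF s' t(2)] by blast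
  next
    show "0 \<in> T" using N x x2 by (simp add: T_def topological_moduleD[OF s] topological_moduleD[OF s2])
  qed
qed


section \<open>Comparison with the calculus on trees\<close>

text \<open>The identification of \<open>E \<times> E \<times> K\<close> with the complete trees of depth one.\<close>

definition pt_of_triple :: "'e \<times> 'e \<times> 'k \<Rightarrow> ('e, 'k) pt" where
  "pt_of_triple = (\<lambda>(x, v, t). Ext (Pt x) (Pt v) t)"

definition triple_of_pt :: "('e, 'k) pt \<Rightarrow> 'e \<times> 'e \<times> 'k" where
  "triple_of_pt p = (pt_val (pt_base p), pt_val (pt_dir p), pt_par p)"

lemma triple_of_pt_of_triple [simp]: "triple_of_pt (pt_of_triple z) = z"
  by (cases z) (simp add: pt_of_triple_def triple_of_pt_def)

lemma topspace_pt_top_0 [simp]: "topspace (pt_top 0) = range Pt"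
  by (auto simp: topspace_pullback_topology)

lemma continuous_map_Pt: "continuous_map euclidean (pt_top 0) Pt"
  by (auto simp: intro!: continuous_map_pullback' simp: comp_def)

lemma continuous_map_pt_val: "continuous_map (pt_top 0) euclidean pt_val"
  using continuous_map_pullback[of euclidean euclidean id "range Pt" pt_val] by (simp add: comp_def)

lemma continuous_map_Ext:
  assumes "continuous_map X (pt_top n) a" "continuous_map X (pt_top n) b" "continuous_map X euclidean c"
  shows "continuous_map X (pt_top (Suc n)) (\<lambda>z. Ext (a z) (b z) (c z))"
  unfolding pt_top.simps
  by (rule continuous_map_pullback') (auto simp: comp_def continuous_map_paired assms)

lemma continuous_map_pt_parts:
  "continuous_map (pt_top (Suc n)) (pt_top n) pt_base"
  "continuous_map (pt_top (Suc n)) (pt_top n) pt_dir"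
  "continuous_map (pt_top (Suc n)) euclidean pt_par"
proof -
  have "continuous_map (pt_top (Suc n)) (prod_topology (pt_top n) (prod_topology (pt_top n) euclidean))
      (\<lambda>p. (pt_base p, pt_dir p, pt_par p))"
    unfolding pt_top.simps
    using continuous_map_pullback[OF continuous_map_id,
        of "{Ext x v t |x v t. True}" "\<lambda>p. (pt_base p, pt_dir p, pt_par p)"]
    by (simp only: id_comp)
  then show "continuous_map (pt_top (Suc n)) (pt_top n) pt_base"
    "continuous_map (pt_top (Suc n)) (pt_top n) pt_dir"
    "continuous_map (pt_top (Suc n)) euclidean pt_par"
    by (auto simp: continuous_map_paired)
qed

lemma continuous_map_pt_of_triple: "continuous_map euclidean (pt_top (Suc 0)) pt_of_triple"
proof -
  have c: "continuous_map euclidean (pt_top 0) (\<lambda>z. Pt (f z))"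
    if "continuous_on UNIV f" for f :: "'a \<times> 'a \<times> 'b \<Rightarrow> 'a"
    using continuous_map_compose[OF that[folded continuous_map_iff_continuous2] continuous_map_Pt]
    by (simp only: comp_def)
  have eq: "pt_of_triple = (\<lambda>z :: 'a \<times> 'a \<times> 'b. Ext (Pt (fst z)) (Pt (fst (snd z))) (snd (snd z)))"
    by (rule HOL.ext) (simp add: pt_of_triple_def split_beta)
  show ?thesis
    unfolding eq
    by (intro continuous_map_Ext c)
      (simp_all only: continuous_map_iff_continuous2 continuous_on_fst continuous_on_snd continuous_on_id)
qed

lemma continuous_map_triple_of_pt: "continuous_map (pt_top (Suc 0)) euclidean triple_of_pt"
proof -
  have "continuous_map (pt_top (Suc 0)) (prod_topology euclidean (prod_topology euclidean euclidean))
      (\<lambda>p. (pt_val (pt_base p), pt_val (pt_dir p), pt_par p))"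
    unfolding continuous_map_paired
    using continuous_map_compose[OF continuous_map_pt_parts(1)[of 0] continuous_map_pt_val]
      continuous_map_compose[OF continuous_map_pt_parts(2)[of 0] continuous_map_pt_val]
      continuous_map_pt_parts(3)[of 0]
    by (simp only: comp_def)
  then show ?thesis unfolding triple_of_pt_def[abs_def] prod_topology_euclidean .
qed

lemma topspace_pt_top_Suc_0: "topspace (pt_top (Suc 0)) = range pt_of_triple"
proof -
  have "topspace (pt_top (Suc 0)) = {Ext x v t |x v t. True} \<inter>
      (\<lambda>p. (pt_base p, pt_dir p, pt_par p)) -` (range Pt \<times> range Pt \<times> UNIV)"
    by (simp add: topspace_pullback_topology Int_commute del: pt_top.simps(1))
  also have "\<dots> = range pt_of_triple" by (auto simp: pt_of_triple_def image_iff)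
  finally show ?thesis .
qed

lemma pt_dom_0: "pt_dom s 0 (Pt ` U) = pt_of_triple ` dq_dom s U"
  by (auto simp: pt_dom_def dq_dom_def pt_of_triple_def image_iff simp del: pt_top.simps)

lemma pt_add_scale_pt_of_triple:
  "pt_add (pt_of_triple a) (pt_scale s t (pt_of_triple b)) = pt_of_triple (a + prod_scale s (prod_scale s (*)) t b)"
  by (cases a; cases b) (simp add: pt_of_triple_def prod_scale_def)

lemma pt_dom_Suc_0:
  "pt_dom s (Suc 0) (pt_of_triple ` A) =
     (\<lambda>(a, b, t). Ext (pt_of_triple a) (pt_of_triple b) t) ` dq_dom (prod_scale s (prod_scale s (*))) A"
proof -
  have inj: "inj pt_of_triple" by (metis injI triple_of_pt_of_triple)
  have "pt_dom s (Suc 0) (pt_of_triple ` A) = {Ext (pt_of_triple a) (pt_of_triple b) t |a b t. a \<in> A \<and>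
      pt_add (pt_of_triple a) (pt_scale s t (pt_of_triple b)) \<in> pt_of_triple ` A}"
    unfolding pt_dom_def topspace_pt_top_Suc_0 by blast
  also have "\<dots> = {Ext (pt_of_triple a) (pt_of_triple b) t |a b t.
      (a, b, t) \<in> dq_dom (prod_scale s (prod_scale s (*))) A}"
    by (simp only: pt_add_scale_pt_of_triple inj_image_mem_iff[OF inj]) (simp only: dq_dom_def mem_Collect_eq case_prod_conv)
  also have "\<dots> = (\<lambda>(a, b, t). Ext (pt_of_triple a) (pt_of_triple b) t) ` dq_dom (prod_scale s (prod_scale s (*))) A"
    by (simp only: image_def Bex_def split_paired_Ex case_prod_conv) blast
  finally show ?thesis .
qed

lemma continuous_on_triple_iff:
  fixes g :: "('e::topological_space, 'k::topological_space) pt \<Rightarrow> 'g::topological_space"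
  shows "continuous_map (subtopology (pt_top (Suc 0)) (pt_of_triple ` A)) euclidean g \<longleftrightarrow>
     continuous_on A (g \<circ> pt_of_triple)"
proof
  assume g: "continuous_map (subtopology (pt_top (Suc 0)) (pt_of_triple ` A)) euclidean g"
  have "continuous_map (top_of_set A) (subtopology (pt_top (Suc 0)) (pt_of_triple ` A)) pt_of_triple"
    by (auto simp: continuous_map_in_subtopology continuous_map_from_subtopology continuous_map_pt_of_triple
        simp del: pt_top.simps)
  from continuous_map_compose[OF this g] show "continuous_on A (g \<circ> pt_of_triple)" by simp
next
  assume g: "continuous_on A (g \<circ> pt_of_triple)"
  have "continuous_map (subtopology (pt_top (Suc 0)) (pt_of_triple ` A)) (top_of_set A) triple_of_pt"
    by (auto simp: continuous_map_in_subtopology continuous_map_from_subtopology continuous_map_triple_of_pt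
        simp del: pt_top.simps)
  from continuous_map_compose[OF this, of euclidean "g \<circ> pt_of_triple"] g
  have "continuous_map (subtopology (pt_top (Suc 0)) (pt_of_triple ` A)) euclidean (g \<circ> pt_of_triple \<circ> triple_of_pt)" by simp
  then show "continuous_map (subtopology (pt_top (Suc 0)) (pt_of_triple ` A)) euclidean g"
    by (rule continuous_map_eq) auto
qed

lemma diff_quotient_iff_is_dq:
  "diff_quotient s s' 0 (Pt ` U) (f \<circ> pt_val) g \<longleftrightarrow> is_dq s s' U f (g \<circ> pt_of_triple)"
proof -
  have "(\<forall>x v t. Ext x v t \<in> pt_dom s 0 (Pt ` U) \<longrightarrow>
        (f \<circ> pt_val) (pt_add x (pt_scale s t v)) - (f \<circ> pt_val) x = s' t (g (Ext x v t))) \<longleftrightarrow>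
     (\<forall>x v t. x \<in> U \<longrightarrow> x + s t v \<in> U \<longrightarrow> f (x + s t v) - f x = s' t ((g \<circ> pt_of_triple) (x, v, t)))"
    unfolding pt_dom_0 by (force simp: dq_dom_def pt_of_triple_def)
  then show ?thesis
    unfolding diff_quotient_def is_dq_def pt_dom_0 continuous_on_triple_iff by simp
qed

text \<open>The difference quotient chosen in the definition of the differential agrees at \<open>t = 0\<close> with any other one, by
  uniqueness along lines.\<close>

lemma diffl_eq_is_dq:
  assumes s: "topological_module s" and s': "topological_module s'" and U: "open U"
    and g: "is_dq s s' U f g" and x: "x \<in> U"
  shows "diffl s s' U f x v = g (x, v, 0)"
proof -
  define h where "h = (SOME h. diff_quotient s s' 0 (Pt ` U) (f \<circ> pt_val) h)"
  have "diff_quotient s s' 0 (Pt ` U) (f \<circ> pt_val) (g \<circ> triple_of_pt)"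
    unfolding diff_quotient_iff_is_dq using g by (simp add: comp_def)
  then have "diff_quotient s s' 0 (Pt ` U) (f \<circ> pt_val) h"
    unfolding h_def by (rule someI[where P = "diff_quotient s s' 0 (Pt ` U) (f \<circ> pt_val)"])
  then have h: "is_dq s s' U f (h \<circ> pt_of_triple)" by (simp add: diff_quotient_iff_is_dq)
  have "(h \<circ> pt_of_triple) (x, v, 0) = g (x, v, 0)"
    by (rule is_dq_eq_along_line[OF s s s' U U h g x x open_UNIV]) auto
  then show ?thesis by (simp add: diffl_def h_def pt_of_triple_def)
qed

text \<open>Unfolds two steps of the recursion over trees and transports the resulting difference quotients to
  product types.\<close>

lemma smooth_on_imp_C2_on:
  assumes s: "topological_module s" and s': "topological_module s'" and f: "smooth_on s s' U f"
  shows "C2_on s s' U f"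
proof -
  have U: "open U" using f by (simp add: smooth_on_def)
  have "C_on s s' (Suc (Suc 0)) 0 (Pt ` U) (f \<circ> pt_val)" using f by (simp only: smooth_on_def)
  then obtain g h where g: "diff_quotient s s' 0 (Pt ` U) (f \<circ> pt_val) g"
    and h: "diff_quotient s s' (Suc 0) (pt_dom s 0 (Pt ` U)) g h"
    by auto
  let ?s = "prod_scale s (prod_scale s (*))"
  let ?e = "\<lambda>(a, b, t). Ext (pt_of_triple a) (pt_of_triple b) t"
  have cont: "continuous_on (dq_dom ?s (dq_dom s U)) (h \<circ> ?e)"
  proof -
    have "continuous_map euclidean (pt_top (Suc (Suc 0))) (\<lambda>z. Ext (pt_of_triple (fst z)) (pt_of_triple (fst (snd z))) (snd (snd z)))"
      by (intro continuous_map_Ext continuous_map_compose[OF _ continuous_map_pt_of_triple, unfolded comp_def])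
        (simp_all only: continuous_map_iff_continuous2 continuous_on_fst continuous_on_snd continuous_on_id)
    then have "continuous_map (top_of_set (dq_dom ?s (dq_dom s U)))
        (subtopology (pt_top (Suc (Suc 0))) (?e ` dq_dom ?s (dq_dom s U))) ?e"
      by (auto simp: continuous_map_in_subtopology split_beta' simp del: pt_top.simps
          intro: continuous_map_from_subtopology)
    moreover have "continuous_map (subtopology (pt_top (Suc (Suc 0))) (?e ` dq_dom ?s (dq_dom s U))) euclidean h"
      using h unfolding diff_quotient_def pt_dom_0 pt_dom_Suc_0 by simp
    ultimately have "continuous_map (top_of_set (dq_dom ?s (dq_dom s U))) euclidean (h \<circ> ?e)"
      by (rule continuous_map_compose)
    then show ?thesis by simp
  qed
  have eq: "(g \<circ> pt_of_triple) (a + ?s t b) - (g \<circ> pt_of_triple) a = s' t ((h \<circ> ?e) (a, b, t))"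
    if "a \<in> dq_dom s U" "a + ?s t b \<in> dq_dom s U" for a b t
  proof -
    have "Ext (pt_of_triple a) (pt_of_triple b) t \<in> pt_dom s (Suc 0) (pt_dom s 0 (Pt ` U))"
      using that unfolding pt_dom_0 pt_dom_Suc_0
      by (intro rev_image_eqI[of "(a, b, t)"]) (simp_all add: dq_dom_def[of ?s])
    then have "g (pt_add (pt_of_triple a) (pt_scale s t (pt_of_triple b))) - g (pt_of_triple a) = s' t (h (Ext (pt_of_triple a) (pt_of_triple b) t))"
      using h by (simp only: diff_quotient_def)
    then show ?thesis by (simp add: pt_add_scale_pt_of_triple)
  qed
  have "C1_on ?s s' (dq_dom s U) (g \<circ> pt_of_triple)"
    unfolding C1_on_def is_dq_def using s s' cont eq
    by (intro conjI exI[of _ "h \<circ> ?e"] topological_module_prod topological_module_mult open_dq_dom U) blast+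
  then show ?thesis
    using g s s' U unfolding C2_on_def diff_quotient_iff_is_dq by blast
qed

section \<open>Rules for derivatives\<close>

lemma C1_on_imp_dq:
  assumes "C1_on s s' U f"
  shows "\<exists>g. is_dq s s' U f g \<and> (\<forall>x\<in>U. \<forall>v. diffl s s' U f x v = g (x, v, 0))"
proof -
  from assms obtain g where g: "is_dq s s' U f g" by (auto simp: C1_on_def)
  have "\<forall>x\<in>U. \<forall>v. diffl s s' U f x v = g (x, v, 0)"
    using diffl_eq_is_dq[OF C1_onD[OF assms] g] by simp
  with g show ?thesis by (intro exI conjI)
qed

text \<open>This is the form in which uniqueness is used throughout: it gives locality of the differential as well as
  the comparison of partial derivatives with derivatives of slices.\<close>

lemma diffl_eq_along_line:
  assumes "C1_on s s' U f" "C1_on s2 s' U2 f2" "x \<in> U" "x2 \<in> U2" "open N" "0 \<in> N"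
    and "\<And>t. t \<in> N \<Longrightarrow> x + s t v \<in> U \<Longrightarrow> x2 + s2 t v2 \<in> U2 \<Longrightarrow>
        f (x + s t v) - f x = f2 (x2 + s2 t v2) - f2 x2"
  shows "diffl s s' U f x v = diffl s2 s' U2 f2 x2 v2"
proof -
  from C1_on_imp_dq[OF assms(1)] obtain g where g: "is_dq s s' U f g" "\<forall>x\<in>U. \<forall>v. diffl s s' U f x v = g (x, v, 0)"
    by (elim exE conjE)
  from C1_on_imp_dq[OF assms(2)] obtain g2 where g2: "is_dq s2 s' U2 f2 g2" "\<forall>x\<in>U2. \<forall>v. diffl s2 s' U2 f2 x v = g2 (x, v, 0)"
    by (elim exE conjE)
  have "g (x, v, 0) = g2 (x2, v2, 0)"
    by (rule is_dq_eq_along_line[OF C1_onD(1)[OF assms(1)] C1_onD(1)[OF assms(2)] C1_onD(2)[OF assms(1)]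
        C1_onD(3)[OF assms(1)] C1_onD(3)[OF assms(2)] g(1) g2(1) assms(3-6)]) (use assms(7) in blast)
  then show ?thesis using g2(2) g(2) assms(3,4) by simp
qed

lemma diffl_local:
  assumes "C1_on s s' U f" "C1_on s s' U2 f2" "open W" "x \<in> W" "W \<subseteq> U" "W \<subseteq> U2"
    and "\<And>y. y \<in> W \<Longrightarrow> f y = f2 y"
  shows "diffl s s' U f x v = diffl s s' U2 f2 x v"
proof (rule diffl_eq_along_line[OF assms(1,2)])
  show "open {t. x + s t v \<in> W}" by (rule open_line_vimage[OF C1_onD(1)[OF assms(1)] assms(3)])
  show "0 \<in> {t. x + s t v \<in> W}" using assms(4) by (simp add: topological_moduleD[OF C1_onD(1)[OF assms(1)]])
  show "x \<in> U" "x \<in> U2" using assms by auto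
qed (use assms in auto)

lemma C1_on_cong:
  assumes "C1_on s s' U f" "\<And>x. x \<in> U \<Longrightarrow> f x = f2 x"
  shows "C1_on s s' U f2"
proof -
  from C1_on_imp_dq[OF assms(1)] obtain g where "is_dq s s' U f g"
    by (elim exE conjE)
  then have "is_dq s s' U f2 g" using assms(2) by (simp add: is_dq_def)
  then show ?thesis using C1_onD[OF assms(1)] by (auto simp: C1_on_def)
qed

lemma C1_on_subset:
  assumes "C1_on s s' U f" "open W" "W \<subseteq> U"
  shows "C1_on s s' W f"
proof -
  from C1_on_imp_dq[OF assms(1)] obtain g where g: "is_dq s s' U f g"
    by (elim exE conjE)
  have "dq_dom s W \<subseteq> dq_dom s U" using assms(3) by (auto simp: dq_dom_def)
  then have "is_dq s s' W f g"
    using g subsetD[OF assms(3)] unfolding is_dq_def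
    by (meson continuous_on_subset)
  then show ?thesis using C1_onD[OF assms(1)] assms(2) by (auto simp: C1_on_def)
qed

lemma diffl_subset:
  assumes "C1_on s s' U f" "open W" "W \<subseteq> U" "x \<in> W"
  shows "diffl s s' W f x v = diffl s s' U f x v"
  by (rule diffl_local[OF C1_on_subset[OF assms(1-3)] assms(1,2,4) order_refl assms(3)]) simp

text \<open>Computes derivatives in directions along which a map is affine, directly from its increments.\<close>

lemma diffl_eq_if_constant_slope:
  assumes f: "C1_on s s' U f" and x: "x \<in> U"
    and c: "\<And>t. x + s t v \<in> U \<Longrightarrow> f (x + s t v) - f x = s' t c"
  shows "diffl s s' U f x v = c"
proof -
  from C1_on_imp_dq[OF f] obtain g where g: "is_dq s s' U f g" "\<forall>x\<in>U. \<forall>v. diffl s s' U f x v = g (x, v, 0)"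
    by (elim exE conjE)
  have "g (x, v, 0) = c"
  proof (rule eq_if_eq_on_units[OF open_line_vimage[OF C1_onD(1)[OF f] C1_onD(3)[OF f]]
        continuous_on_dq_line[OF g(1) x] continuous_on_const])
    fix t :: 'a assume t: "t \<in> {t. x + s t v \<in> U}" "t dvd 1"
    have "s' t (g (x, v, t)) = s' t c" using g(1) c[of t] t x by (simp add: is_dq_def)
    then show "g (x, v, t) = c" using unit_scale_cancel[OF C1_onD(2)[OF f] t(2)] by blast
  next
    show "0 \<in> {t. x + s t v \<in> U}" using x by (simp add: topological_moduleD[OF C1_onD(1)[OF f]])
  qed
  then show ?thesis using g(2) x by simp
qed

lemma is_dq_linear:
  assumes "module_hom s s' f" "continuous_on UNIV f"
  shows "is_dq s s' U f (\<lambda>(x, v, t). f v)"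
proof -
  interpret module_hom s s' f by fact
  have "continuous_on (dq_dom s U) (\<lambda>z. f (fst (snd z)))"
    by (rule continuous_on_compose2[OF assms(2)]) (auto intro!: continuous_on_fst continuous_on_snd continuous_on_id)
  then show ?thesis by (simp add: is_dq_def split_beta' add scale)
qed

lemma C1_on_linear:
  assumes "topological_module s" "topological_module s'" "open U"
    and "module_hom s s' f" "continuous_on UNIV f"
  shows "C1_on s s' U f" and "x \<in> U \<Longrightarrow> diffl s s' U f x v = f v"
  using is_dq_linear[OF assms(4,5), of U] diffl_eq_is_dq[OF assms(1-3) is_dq_linear[OF assms(4,5)]] assms
  by (auto simp: C1_on_def)

text \<open>The chain rule for difference quotients: with \<open>f(x + tv) = f(x) + t f\<^sup>[\<^sup>1\<^sup>](x, v, t)\<close> the increment of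
  \<open>h o f\<close> is an increment of \<open>h\<close> at \<open>f(x)\<close> in the direction \<open>f\<^sup>[\<^sup>1\<^sup>](x, v, t)\<close> with the same parameter \<open>t\<close>.\<close>

lemma is_dq_compose:
  assumes f: "is_dq s s' U f f1" and h: "is_dq s' s'' W h h1" and sub: "f ` U \<subseteq> W"
    and cf: "continuous_on U f"
  shows "is_dq s s'' U (h \<circ> f) (\<lambda>(x, v, t). h1 (f x, f1 (x, v, t), t))"
proof -
  have f1: "continuous_on (dq_dom s U) f1" and eq: "\<And>x v t. x \<in> U \<Longrightarrow> x + s t v \<in> U \<Longrightarrow>
      f (x + s t v) = f x + s' t (f1 (x, v, t))"
    using f by (auto simp: is_dq_def algebra_simps)
  have h1: "continuous_on (dq_dom s' W) h1" using h by (simp add: is_dq_def)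
  have "continuous_on (dq_dom s U) (\<lambda>z. f (fst z))"
    by (rule continuous_on_compose2[OF cf]) (auto simp: dq_dom_def intro!: continuous_on_fst continuous_on_id)
  then have "continuous_on (dq_dom s U) (\<lambda>z. (f (fst z), f1 z, snd (snd z)))"
    by (intro continuous_on_Pair f1 continuous_on_snd continuous_on_id)
  moreover have "(f (fst z), f1 z, snd (snd z)) \<in> dq_dom s' W" if "z \<in> dq_dom s U" for z
    using that sub by (auto simp: dq_dom_def eq[symmetric])
  ultimately have "continuous_on (dq_dom s U) (\<lambda>z. h1 (f (fst z), f1 z, snd (snd z)))"
    by (intro continuous_on_compose2[OF h1]) auto
  moreover have "(h \<circ> f) (x + s t v) - (h \<circ> f) x = s'' t (h1 (f x, f1 (x, v, t), t))"
    if "x \<in> U" "x + s t v \<in> U" for x v t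
  proof -
    have "f x \<in> W" "f x + s' t (f1 (x, v, t)) \<in> W" using that sub by (auto simp: eq[symmetric])
    then show ?thesis using h that by (simp add: is_dq_def eq)
  qed
  ultimately show ?thesis by (simp add: is_dq_def split_beta')
qed

text \<open>The difference quotient at the unit \<open>t = 1\<close> and direction \<open>y - x\<close> expresses \<open>f(y) - f(x)\<close> as a continuous
  function of \<open>y\<close>.\<close>

lemma C1_on_continuous:
  assumes f: "C1_on s s' U f"
  shows "continuous_on U f"
proof (cases "U = {}")
  case False
  note s = C1_onD(1)[OF f] and s' = C1_onD(2)[OF f]
  show ?thesis
  proof (subst continuous_on_eq_continuous_at[OF C1_onD(3)[OF f]], rule ballI)
    fix x assume x: "x \<in> U"
    from C1_on_imp_dq[OF f] obtain g where g: "is_dq s s' U f g"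
      by (elim exE conjE)
    let ?j = "\<lambda>y. (x, y - x, 1) :: _ \<times> _ \<times> 'a"
    have 1: "x + s 1 (y - x) = y" for y by (simp add: topological_moduleD[OF s])
    have eq: "f y = f x + g (?j y)" if "y \<in> U" for y
    proof -
      have "f (x + s 1 (y - x)) - f x = s' 1 (g (?j y))"
        using g x that unfolding is_dq_def by (metis 1)
      then show ?thesis by (simp add: 1 topological_moduleD[OF s'] diff_eq_eq add.commute)
    qed
    have "continuous_on (dq_dom s U) g" using g by (simp add: is_dq_def)
    moreover have "continuous_on U ?j" by (intro continuous_intros)
    ultimately have "continuous_on U (\<lambda>y. g (?j y))"
      by (rule continuous_on_compose2) (use x in \<open>auto simp: dq_dom_def 1\<close>)
    then have "continuous_on U (\<lambda>y. f x + g (?j y))" by (intro continuous_intros)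
    then have "continuous_on U f" by (rule continuous_on_eq) (simp add: eq)
    then show "isCont f x" using x C1_onD(3)[OF f] by (simp add: continuous_on_eq_continuous_at)
  qed
qed simp

lemma C1_on_compose:
  assumes f: "C1_on s s' U f" and h: "C1_on s' s'' W h" and sub: "f ` U \<subseteq> W"
  shows "C1_on s s'' U (h \<circ> f)"
    and "x \<in> U \<Longrightarrow> diffl s s'' U (h \<circ> f) x v = diffl s' s'' W h (f x) (diffl s s' U f x v)"
proof -
  from C1_on_imp_dq[OF f] obtain f1 where f1: "is_dq s s' U f f1" "\<forall>x\<in>U. \<forall>v. diffl s s' U f x v = f1 (x, v, 0)"
    by (elim exE conjE)
  from C1_on_imp_dq[OF h] obtain h1 where h1: "is_dq s' s'' W h h1" "\<forall>x\<in>W. \<forall>v. diffl s' s'' W h x v = h1 (x, v, 0)"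
    by (elim exE conjE)
  note dq = is_dq_compose[OF f1(1) h1(1) sub C1_on_continuous[OF f]]
  show "C1_on s s'' U (h \<circ> f)" using dq C1_onD[OF f] C1_onD[OF h] by (auto simp: C1_on_def)
  show "diffl s s'' U (h \<circ> f) x v = diffl s' s'' W h (f x) (diffl s s' U f x v)" if x: "x \<in> U"
  proof -
    have "diffl s s'' U (h \<circ> f) x v = h1 (f x, f1 (x, v, 0), 0)"
      using diffl_eq_is_dq[OF C1_onD(1)[OF f] C1_onD(2)[OF h] C1_onD(3)[OF f] dq x] by simp
    then show ?thesis using x sub f1(2) h1(2) by (simp add: image_subset_iff)
  qed
qed

lemma C1_on_Pair:
  assumes f: "C1_on s s' U f" and h: "C1_on s s'' U h"
  shows "C1_on s (prod_scale s' s'') U (\<lambda>x. (f x, h x))"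
    and "x \<in> U \<Longrightarrow> diffl s (prod_scale s' s'') U (\<lambda>x. (f x, h x)) x v =
       (diffl s s' U f x v, diffl s s'' U h x v)"
proof -
  from C1_on_imp_dq[OF f] obtain f1 where f1: "is_dq s s' U f f1" "\<forall>x\<in>U. \<forall>v. diffl s s' U f x v = f1 (x, v, 0)"
    by (elim exE conjE)
  from C1_on_imp_dq[OF h] obtain h1 where h1: "is_dq s s'' U h h1" "\<forall>x\<in>U. \<forall>v. diffl s s'' U h x v = h1 (x, v, 0)"
    by (elim exE conjE)
  have dq: "is_dq s (prod_scale s' s'') U (\<lambda>x. (f x, h x)) (\<lambda>z. (f1 z, h1 z))"
    using f1(1) h1(1) by (auto simp: is_dq_def prod_scale_def intro!: continuous_on_Pair)
  have m: "topological_module (prod_scale s' s'')"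
    by (rule topological_module_prod[OF C1_onD(2)[OF f] C1_onD(2)[OF h]])
  show "C1_on s (prod_scale s' s'') U (\<lambda>x. (f x, h x))"
    using dq m C1_onD[OF f] by (auto simp: C1_on_def)
  show "diffl s (prod_scale s' s'') U (\<lambda>x. (f x, h x)) x v =
       (diffl s s' U f x v, diffl s s'' U h x v)" if "x \<in> U"
    using diffl_eq_is_dq[OF C1_onD(1)[OF f] m C1_onD(3)[OF f] dq that] that f1(2) h1(2) by simp
qed

text \<open>For additivity, the increment in the direction \<open>v + w\<close> is the sum of the increments in the direction \<open>v\<close> at
  \<open>x\<close> and in the direction \<open>w\<close> at \<open>x + tv\<close>; the latter base point tends to \<open>x\<close>. For homogeneity, a factor
  \<open>r\<close> of the direction can be moved to the parameter.\<close>

lemma diffl_module_hom: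
  assumes f: "C1_on s s' U f" and x: "x \<in> U"
  shows "module_hom s s' (diffl s s' U f x)"
proof -
  from C1_on_imp_dq[OF f] obtain g where g: "is_dq s s' U f g" "\<forall>x\<in>U. \<forall>v. diffl s s' U f x v = g (x, v, 0)"
    by (elim exE conjE)
  note s = C1_onD(1)[OF f] and s' = C1_onD(2)[OF f] and U = C1_onD(3)[OF f]
  have cg: "continuous_on (dq_dom s U) g" using g(1) by (simp add: is_dq_def)
  have dq: "f (y + s t w) - f y = s' t (g (y, w, t))" if "y \<in> U" "y + s t w \<in> U" for y t w
    using g(1) that by (simp add: is_dq_def)
  have add: "g (x, v + w, 0) = g (x, v, 0) + g (x, w, 0)" for v w
  proof -
    define T where "T = {t. x + s t v \<in> U} \<inter> {t. x + s t (v + w) \<in> U}"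
    have T: "open T" unfolding T_def by (intro open_Int open_line_vimage s U)
    have cs: "continuous_on T (\<lambda>t. x + s t v)"
      by (intro continuous_intros continuous_on_module_scale[OF s])
    have c1: "continuous_on T (\<lambda>t. g (x, v + w, t))"
      by (rule continuous_on_subset[OF continuous_on_dq_line[OF g(1) x]]) (auto simp: T_def)
    have c2: "continuous_on T (\<lambda>t. g (x, v, t))"
      by (rule continuous_on_subset[OF continuous_on_dq_line[OF g(1) x]]) (auto simp: T_def)
    have e: "x + s t v + s t w = x + s t (v + w)" for t
      by (simp add: topological_moduleD[OF s] add.assoc)
    have c3: "continuous_on T (\<lambda>t. g (x + s t v, w, t))"
      by (rule continuous_on_compose2[OF cg continuous_on_Pair[OF cs continuous_on_Pair[OF continuous_on_const continuous_on_id]]])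
        (auto simp: T_def dq_dom_def e)
    have "g (x, v + w, 0) = g (x, v, 0) + g (x + s 0 v, w, 0)"
    proof (rule eq_if_eq_on_units[OF T c1 continuous_on_add[OF c2 c3]])
      fix t :: 'a assume t: "t \<in> T" "t dvd 1"
      have "s' t (g (x, v + w, t)) = (f (x + s t v + s t w) - f (x + s t v)) + (f (x + s t v) - f x)"
        using dq[of x t "v + w"] x t by (simp add: T_def e)
      also have "\<dots> = s' t (g (x + s t v, w, t)) + s' t (g (x, v, t))"
        using dq[of x t v] dq[of "x + s t v" t w] x t by (simp add: T_def e)
      also have "\<dots> = s' t (g (x, v, t) + g (x + s t v, w, t))"
        by (simp add: topological_moduleD[OF s'] add.commute)
      finally show "g (x, v + w, t) = g (x, v, t) + g (x + s t v, w, t)"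
        using unit_scale_cancel[OF s' t(2)] by blast
    qed (simp add: T_def x topological_moduleD[OF s])
    then show ?thesis by (simp add: topological_moduleD[OF s])
  qed
  have scale: "g (x, s r v, 0) = s' r (g (x, v, 0))" for r v
  proof -
    define T where "T = {t. x + s t (s r v) \<in> U}"
    have T: "open T" unfolding T_def by (intro open_line_vimage s U)
    have c1: "continuous_on T (\<lambda>t. g (x, s r v, t))"
      unfolding T_def by (rule continuous_on_dq_line[OF g(1) x])
    have cr: "continuous_on T (\<lambda>t. t * r)" by (intro continuous_intros)
    have c2: "continuous_on T (\<lambda>t. g (x, v, t * r))"
      by (rule continuous_on_compose2[OF cg continuous_on_Pair[OF continuous_on_const continuous_on_Pair[OF continuous_on_const cr]]])
        (auto simp: T_def dq_dom_def x topological_moduleD[OF s])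
    have "g (x, s r v, 0) = s' r (g (x, v, 0 * r))"
    proof (rule eq_if_eq_on_units[OF T c1 continuous_on_module_scale[OF s' continuous_on_const c2]])
      fix t :: 'a assume t: "t \<in> T" "t dvd 1"
      have "s' t (g (x, s r v, t)) = f (x + s (t * r) v) - f x"
        using dq[of x t "s r v"] x t by (simp add: T_def topological_moduleD[OF s])
      also have "\<dots> = s' t (s' r (g (x, v, t * r)))"
        using dq[of x "t * r" v] x t by (simp add: T_def topological_moduleD[OF s] topological_moduleD[OF s'])
      finally show "g (x, s r v, t) = s' r (g (x, v, t * r))"
        using unit_scale_cancel[OF s' t(2)] by blast
    qed (simp add: T_def x topological_moduleD[OF s])
    then show ?thesis by simp
  qed
  show ?thesis
    by (intro module_hom.intro module_hom_axioms.intro topological_moduleD(1) s s')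
      (simp_all add: g(2) x add scale)
qed

lemma C1_on_linear_precompose:
  assumes f: "C1_on s s' U f" and s2: "topological_module s2"
    and p: "module_hom s2 s p" "continuous_on UNIV p" and W: "open W" "p ` W \<subseteq> U"
  shows "C1_on s2 s' W (\<lambda>x. f (p x))"
    and "x \<in> W \<Longrightarrow> diffl s2 s' W (\<lambda>x. f (p x)) x v = diffl s s' U f (p x) (p v)"
  using C1_on_compose[OF C1_on_linear(1)[OF s2 C1_onD(1)[OF f] W(1) p] f W(2)]
    C1_on_linear(2)[OF s2 C1_onD(1)[OF f] W(1) p]
  by (simp_all add: comp_def)

lemma C1_on_linear_postcompose:
  assumes f: "C1_on s s' U f" and s2: "topological_module s2"
    and p: "module_hom s' s2 p" "continuous_on UNIV p"
  shows "C1_on s s2 U (\<lambda>x. p (f x))"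
    and "x \<in> U \<Longrightarrow> diffl s s2 U (\<lambda>x. p (f x)) x v = p (diffl s s' U f x v)"
  using C1_on_compose[OF f C1_on_linear(1)[OF C1_onD(2)[OF f] s2 open_UNIV p] subset_UNIV]
    C1_on_linear(2)[OF C1_onD(2)[OF f] s2 open_UNIV p UNIV_I]
  by (simp_all add: comp_def)

lemma module_homI:
  assumes "topological_module s" "topological_module s'"
    and "\<And>x y. f (x + y) = f x + f y" "\<And>r x. f (s r x) = s' r (f x)"
  shows "module_hom s s' f"
  by (intro module_hom.intro module_hom_axioms.intro topological_moduleD(1) assms)

section \<open>Maps of class \<open>C\<^sup>2\<close>\<close>

text \<open>The differential is the first difference quotient restricted to \<open>t = 0\<close>, that is, its composition with
  a linear map.\<close>

lemma C2_on_tangent: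
  assumes f: "C2_on s s' U f"
  shows "C1_on (prod_scale s s) s' (U \<times> UNIV) (\<lambda>(x, v). diffl s s' U f x v)"
proof -
  obtain g where s: "topological_module s" and s': "topological_module s'" and U: "open U"
    and g: "is_dq s s' U f g" and g1: "C1_on (prod_scale s (prod_scale s (*))) s' (dq_dom s U) g"
    using f by (auto simp: C2_on_def)
  let ?j = "\<lambda>(x, v). (x, v, 0 :: 'a)"
  have ss: "topological_module (prod_scale s s)" "topological_module (prod_scale s (prod_scale s (*)))"
    by (intro topological_module_prod topological_module_mult s)+
  have "module_hom (prod_scale s s) (prod_scale s (prod_scale s (*))) ?j"
    by (intro module_hom.intro module_hom_axioms.intro topological_moduleD(1) ss)
      (auto simp: prod_scale_def)
  moreover have "continuous_on UNIV ?j"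
    unfolding split_beta' by (intro continuous_intros)
  ultimately have "C1_on (prod_scale s s) (prod_scale s (prod_scale s (*))) (U \<times> UNIV) ?j"
    by (intro C1_on_linear ss open_Times U open_UNIV)
  moreover have "?j ` (U \<times> UNIV) \<subseteq> dq_dom s U"
    by (auto simp: dq_dom_def topological_moduleD[OF s])
  ultimately have "C1_on (prod_scale s s) s' (U \<times> UNIV) (g \<circ> ?j)"
    by (rule C1_on_compose(1)[OF _ g1])
  then show ?thesis
    by (rule C1_on_cong) (auto simp: diffl_eq_is_dq[OF s s' U g])
qed

text \<open>Both mixed second difference quotients, multiplied by the product \<open>pq\<close> of the two parameters, give
  \<open>f(x + pw + qv) - f(x + pw) - f(x + qv) + f(x)\<close>. So they agree for units \<open>p\<close>, \<open>q\<close> near zero and,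
  by density in one parameter after the other, at \<open>p = q = 0\<close>.\<close>

lemma second_derivative_symmetric:
  assumes f: "C2_on s s' U f" and x: "x \<in> U"
  shows "diffl (prod_scale s s) s' (U \<times> UNIV) (\<lambda>(x, v). diffl s s' U f x v) (x, v) (w, 0) =
     diffl (prod_scale s s) s' (U \<times> UNIV) (\<lambda>(x, v). diffl s s' U f x v) (x, w) (v, 0)"
proof -
  let ?s = "prod_scale s (prod_scale s (*))"
  obtain g where s: "topological_module s" and s': "topological_module s'" and U: "open U"
    and g: "is_dq s s' U f g" and g1: "C1_on ?s s' (dq_dom s U) g"
    using f by (auto simp: C2_on_def)
  from C1_on_imp_dq[OF g1] obtain g2 where g2: "is_dq ?s s' (dq_dom s U) g g2"
    and dg: "\<forall>x\<in>dq_dom s U. \<forall>v. diffl ?s s' (dq_dom s U) g x v = g2 (x, v, 0)"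
    by (elim exE conjE)
  have cg2: "continuous_on (dq_dom ?s (dq_dom s U)) g2" using g2 by (simp add: is_dq_def)
  have in0: "(x, v, 0) \<in> dq_dom s U" for v using x by (simp add: dq_dom_def topological_moduleD[OF s])
  have red: "diffl (prod_scale s s) s' (U \<times> UNIV) (\<lambda>(x, v). diffl s s' U f x v) (x, v) (w, 0) =
      g2 ((x, v, 0), (w, 0, 0), 0)" for v w
  proof -
    have "diffl (prod_scale s s) s' (U \<times> UNIV) (\<lambda>(x, v). diffl s s' U f x v) (x, v) (w, 0) =
        diffl ?s s' (dq_dom s U) g (x, v, 0) (w, 0, 0)"
      by (rule diffl_eq_along_line[OF C2_on_tangent[OF f] g1 _ in0 open_UNIV UNIV_I])
        (auto simp: x prod_scale_def topological_moduleD[OF s] diffl_eq_is_dq[OF s s' U g])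
    then show ?thesis by (simp add: dg in0)
  qed
  \<comment> \<open>the parameters for which all four corners of the second difference lie in \<open>U\<close>\<close>
  define N where "N = {z. x + s (fst z) w \<in> U} \<inter> {z. x + s (snd z) v \<in> U}
      \<inter> {z. x + s (fst z) w + s (snd z) v \<in> U}"
  have "open N"
  proof -
    have "continuous_on UNIV (\<lambda>z :: 'a \<times> 'a. x + s (fst z) w)"
      "continuous_on UNIV (\<lambda>z :: 'a \<times> 'a. x + s (snd z) v)"
      "continuous_on UNIV (\<lambda>z :: 'a \<times> 'a. x + s (fst z) w + s (snd z) v)"
      by (intro continuous_intros continuous_on_module_scale[OF s])+
    from this[THEN open_vimage[OF U]] show ?thesis by (auto simp: N_def vimage_def intro!: open_Int)
  qed
  moreover have "(0, 0) \<in> N" by (simp add: N_def x topological_moduleD[OF s])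
  ultimately obtain P Q where "open P" "open Q" "(0, 0) \<in> P \<times> Q" "P \<times> Q \<subseteq> N"
    by (rule open_prod_elim)
  then have PQ: "open P" "open Q" "0 \<in> P" "0 \<in> Q" "P \<times> Q \<subseteq> N" by simp_all
  let ?A = "\<lambda>p q. g2 ((x, v, q), (w, 0, 0), p)"
  let ?B = "\<lambda>p q. g2 ((x, w, p), (v, 0, 0), q)"
  have inU: "x + s p w \<in> U" "x + s q v \<in> U" "x + s p w + s q v \<in> U" "x + s q v + s p w \<in> U"
    if "p \<in> P" "q \<in> Q" for p q
    using that PQ(5) by (auto simp: N_def algebra_simps)
  have memA: "((x, v, q), (w, 0, 0), p) \<in> dq_dom ?s (dq_dom s U)" if "p \<in> P" "q \<in> Q" for p q
    using inU[OF that] x by (simp add: dq_dom_def prod_scale_def topological_moduleD[OF s])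
  have memB: "((x, w, p), (v, 0, 0), q) \<in> dq_dom ?s (dq_dom s U)" if "p \<in> P" "q \<in> Q" for p q
    using inU[OF that] x by (simp add: dq_dom_def prod_scale_def topological_moduleD[OF s])
  have dq: "s' t (g (y, u, t)) = f (y + s t u) - f y" if "y \<in> U" "y + s t u \<in> U" for y t u
    using g that by (simp add: is_dq_def)
  have dq2: "g (a + ?s t b) - g a = s' t (g2 (a, b, t))" if "(a, b, t) \<in> dq_dom ?s (dq_dom s U)" for a b t
    using g2 that unfolding is_dq_def dq_dom_def[of ?s] by blast
  have A: "s' q (s' p (?A p q)) = f (x + s p w + s q v) - f (x + s p w) - f (x + s q v) + f x"
    if "p \<in> P" "q \<in> Q" for p q
  proof -
    have "s' p (?A p q) = g (x + s p w, v, q) - g (x, v, q)"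
      using dq2[OF memA[OF that]] by (simp add: prod_scale_def topological_moduleD[OF s])
    then have "s' q (s' p (?A p q)) = s' q (g (x + s p w, v, q)) - s' q (g (x, v, q))"
      by (simp only: topological_moduleD(8)[OF s'])
    then show ?thesis using inU[OF that] x by (simp add: dq)
  qed
  have B: "s' p (s' q (?B p q)) = f (x + s p w + s q v) - f (x + s p w) - f (x + s q v) + f x"
    if "p \<in> P" "q \<in> Q" for p q
  proof -
    have "s' q (?B p q) = g (x + s q v, w, p) - g (x, w, p)"
      using dq2[OF memB[OF that]] by (simp add: prod_scale_def topological_moduleD[OF s])
    then have "s' p (s' q (?B p q)) = s' p (g (x + s q v, w, p)) - s' p (g (x, w, p))"
      by (simp only: topological_moduleD(8)[OF s'])
    then show ?thesis using inU[OF that] x by (simp add: dq add.assoc add.commute[of "s q v"])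
  qed
  have AB_unit: "?A p q = ?B p q" if p: "p \<in> P" "p dvd 1" and q: "q \<in> Q" "q dvd 1" for p q
  proof -
    have "s' p (s' q (?A p q)) = s' p (s' q (?B p q))"
      using A[OF p(1) q(1)] B[OF p(1) q(1)] by (simp add: topological_moduleD[OF s'] mult.commute)
    then show ?thesis using unit_scale_cancel[OF s' p(2)] unit_scale_cancel[OF s' q(2)] by blast
  qed
  have AB0: "?A p 0 = ?B p 0" if p: "p \<in> P" "p dvd 1" for p
  proof (rule eq_if_eq_on_units[OF PQ(2), where f = "?A p" and g = "?B p"])
    show "continuous_on Q (\<lambda>q. ?A p q)" using memA[OF p(1)]
      by (intro continuous_on_compose2[OF cg2] continuous_intros) auto
    show "continuous_on Q (\<lambda>q. ?B p q)" using memB[OF p(1)]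
      by (intro continuous_on_compose2[OF cg2] continuous_intros) auto
  qed (use AB_unit p PQ in auto)
  have "?A 0 0 = ?B 0 0"
  proof (rule eq_if_eq_on_units[OF PQ(1), where f = "\<lambda>p. ?A p 0" and g = "\<lambda>p. ?B p 0"])
    show "continuous_on P (\<lambda>p. ?A p 0)" using memA[OF _ PQ(4)]
      by (intro continuous_on_compose2[OF cg2] continuous_intros) auto
    show "continuous_on P (\<lambda>p. ?B p 0)" using memB[OF _ PQ(4)]
      by (intro continuous_on_compose2[OF cg2] continuous_intros) auto
  qed (use AB0 PQ in auto)
  then show ?thesis by (simp add: red)
qed

section \<open>Manifolds of low differentiability\<close>

text \<open>The degree of differentiability is tracked because the tangent functor lowers it by one and is applied twice.\<close>

definition C1_manifold ::
    "('k::dense_unit_ring, 'i, 'm, 'e::{topological_ab_group_add, t2_space}) mfd \<Rightarrow> bool" where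
  "C1_manifold A \<longleftrightarrow> topological_module (mscale A) \<and>
     (\<forall>i\<in>charts A. inj_on (cmap A i) (cdom A i) \<and> open (img A i)) \<and>
     (\<forall>i\<in>charts A. \<forall>j\<in>charts A.
        C1_on (mscale A) (mscale A) (loc_dom A A id i j) (loc_map A A id i j))"

definition C2_manifold ::
    "('k::dense_unit_ring, 'i, 'm, 'e::{topological_ab_group_add, t2_space}) mfd \<Rightarrow> bool" where
  "C2_manifold A \<longleftrightarrow> topological_module (mscale A) \<and>
     (\<forall>i\<in>charts A. inj_on (cmap A i) (cdom A i) \<and> open (img A i)) \<and>
     (\<forall>i\<in>charts A. \<forall>j\<in>charts A.
        C2_on (mscale A) (mscale A) (loc_dom A A id i j) (loc_map A A id i j))"

definition C1_map ::
    "('k::dense_unit_ring, 'i, 'm, 'e::{topological_ab_group_add, t2_space}) mfd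
      \<Rightarrow> ('k, 'j, 'n, 'g::{topological_ab_group_add, t2_space}) mfd \<Rightarrow> ('m \<Rightarrow> 'n) \<Rightarrow> bool" where
  "C1_map A B f \<longleftrightarrow>
     (\<forall>i\<in>charts A. \<forall>j\<in>charts B. C1_on (mscale A) (mscale B) (loc_dom A B f i j) (loc_map A B f i j))"

lemma smooth_manifold_imp_C2: "smooth_manifold A \<Longrightarrow> C2_manifold A"
  by (simp add: smooth_manifold_def C2_manifold_def smooth_on_imp_C2_on)

lemma C2_manifold_imp_C1: "C2_manifold A \<Longrightarrow> C1_manifold A"
  by (simp add: C1_manifold_def C2_manifold_def C2_on_imp_C1_on)

lemma C1_manifoldD:
  assumes "C1_manifold A"
  shows "topological_module (mscale A)"
    and "i \<in> charts A \<Longrightarrow> inj_on (cmap A i) (cdom A i)"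
    and "i \<in> charts A \<Longrightarrow> open (img A i)"
    and "i \<in> charts A \<Longrightarrow> j \<in> charts A \<Longrightarrow>
      C1_on (mscale A) (mscale A) (loc_dom A A id i j) (loc_map A A id i j)"
    and "C1_map A A id"
  using assms by (auto simp: C1_manifold_def C1_map_def)

lemma C1_mapD:
  "C1_map A B f \<Longrightarrow> i \<in> charts A \<Longrightarrow> j \<in> charts B \<Longrightarrow>
    C1_on (mscale A) (mscale B) (loc_dom A B f i j) (loc_map A B f i j)"
  by (simp add: C1_map_def)

lemma pt_of_in_cdom: "x \<in> img A i \<Longrightarrow> pt_of A i x \<in> cdom A i"
  by (simp add: img_def pt_of_def inv_into_into)

lemma cmap_pt_of: "x \<in> img A i \<Longrightarrow> cmap A i (pt_of A i x) = x"
  by (simp add: img_def pt_of_def f_inv_into_f)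

lemma cmap_in_img: "m \<in> cdom A i \<Longrightarrow> cmap A i m \<in> img A i"
  by (simp add: img_def)

lemma pt_of_cmap: "C1_manifold A \<Longrightarrow> i \<in> charts A \<Longrightarrow> m \<in> cdom A i \<Longrightarrow> pt_of A i (cmap A i m) = m"
  by (simp add: C1_manifold_def pt_of_def)

lemma pt_of_in_points: "i \<in> charts A \<Longrightarrow> x \<in> img A i \<Longrightarrow> pt_of A i x \<in> points A"
  unfolding points_def by (blast intro: pt_of_in_cdom)

lemma loc_dom_subset: "loc_dom A B f i j \<subseteq> img A i"
  by (auto simp: loc_dom_def)

lemma loc_dom_id_self [simp]: "loc_dom A A id i i = img A i"
  by (auto simp: loc_dom_def pt_of_in_cdom)

lemma loc_map_id_self: "x \<in> img A i \<Longrightarrow> loc_map A A id i i x = x"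
  by (simp add: loc_map_def cmap_pt_of)

lemma loc_dom_self: "f ` cdom A i \<subseteq> cdom B j \<Longrightarrow> loc_dom A B f i j = img A i"
  by (auto simp: loc_dom_def dest: pt_of_in_cdom)

lemma loc_map_compose:
  assumes "C1_manifold B" "j \<in> charts B" "x \<in> loc_dom A B f i j"
  shows "loc_map A C (h \<circ> f) i k x = loc_map B C h j k (loc_map A B f i j x)"
    and "loc_map A B f i j x \<in> loc_dom B C h j k \<longleftrightarrow> x \<in> loc_dom A C (h \<circ> f) i k"
  using assms by (auto simp: loc_map_def loc_dom_def pt_of_cmap cmap_in_img)

lemma C1_on_open_preimage:
  assumes "C1_on s s' U f" "open W"
  shows "open {x \<in> U. f x \<in> W}"
proof -
  have "open (f -` W \<inter> U)"
    using continuous_on_open_vimage[OF C1_onD(3)[OF assms(1)], of f] C1_on_continuous[OF assms(1)] assms(2)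
    by simp
  then show ?thesis by (simp add: vimage_def Int_def conj_commute)
qed

text \<open>The chain rule for chart representatives. Taking the identity for one of the two maps gives the cocycle
  condition of the tangent bundle and the compatibility of tangent maps with changes of charts.\<close>

lemma tangent_loc_compose:
  assumes B: "C1_manifold B" and f: "C1_map A B f" and h: "C1_map B C h" and hf: "C1_map A C (h \<circ> f)"
    and i: "i \<in> charts A" and j: "j \<in> charts B" and k: "k \<in> charts C"
    and z: "fst z \<in> loc_dom A B f i j" "fst z \<in> loc_dom A C (h \<circ> f) i k"
  shows "tangent_loc A C (h \<circ> f) i k z = tangent_loc B C h j k (tangent_loc A B f i j z)"
proof -
  obtain x v where z_eq: "z = (x, v)" by (cases z)
  let ?W = "{y \<in> loc_dom A B f i j. loc_map A B f i j y \<in> loc_dom B C h j k}"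
  note cf = C1_mapD[OF f i j] and ch = C1_mapD[OF h j k] and chf = C1_mapD[OF hf i k]
  have W: "open ?W" by (rule C1_on_open_preimage[OF cf C1_onD(3)[OF ch]])
  have sub: "?W \<subseteq> loc_dom A B f i j" "?W \<subseteq> loc_dom A C (h \<circ> f) i k"
    using loc_map_compose(2)[OF B j, of _ A f i C h k] by auto
  have x: "x \<in> ?W" using z loc_map_compose(2)[OF B j, of x A f i C h k] by (simp add: z_eq)
  have eq: "loc_map A C (h \<circ> f) i k y = (loc_map B C h j k \<circ> loc_map A B f i j) y" if "y \<in> ?W" for y
    using loc_map_compose(1)[OF B j, of y A f i C h k] that by simp
  note cfW = C1_on_subset[OF cf W sub(1)]
  have im: "loc_map A B f i j ` ?W \<subseteq> loc_dom B C h j k" by auto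
  have "diffl (mscale A) (mscale C) (loc_dom A C (h \<circ> f) i k) (loc_map A C (h \<circ> f) i k) x v =
      diffl (mscale A) (mscale C) ?W (loc_map B C h j k \<circ> loc_map A B f i j) x v"
    by (rule diffl_local[OF chf C1_on_compose(1)[OF cfW ch im] W x sub(2) order_refl eq])
  also have "\<dots> = diffl (mscale B) (mscale C) (loc_dom B C h j k) (loc_map B C h j k) (loc_map A B f i j x)
      (diffl (mscale A) (mscale B) (loc_dom A B f i j) (loc_map A B f i j) x v)"
    using C1_on_compose(2)[OF cfW ch im x] diffl_subset[OF cf W sub(1) x] by simp
  finally show ?thesis using eq[OF x] by (simp add: tangent_loc_def z_eq)
qed

lemma fst_tangent_loc [simp]: "fst (tangent_loc A B f i j z) = loc_map A B f i j (fst z)"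
  by (simp add: tangent_loc_def split_beta)

text \<open>If a map respects charts with the same index, the other representatives arise from these by transition maps.
  This covers all maps whose tangent maps occur in the construction of \<open>\<Phi>\<^sub>2\<close>.\<close>

lemma C1_mapI:
  assumes A: "C1_manifold A" and B: "C1_manifold B" and charts: "charts A = charts B"
    and dom: "\<And>i. i \<in> charts A \<Longrightarrow> f ` cdom A i \<subseteq> cdom B i"
    and loc: "\<And>i. i \<in> charts A \<Longrightarrow> C1_on (mscale A) (mscale B) (img A i) (loc_map A B f i i)"
  shows "C1_map A B f"
  unfolding C1_map_def
proof (intro ballI)
  fix i j assume i: "i \<in> charts A" and j: "j \<in> charts B"
  have i': "i \<in> charts B" using i charts by simp
  note B_ij = C1_manifoldD(4)[OF B i' j] and ld = loc_dom_self[OF dom[OF i]]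
  let ?W = "{x \<in> img A i. loc_map A B f i i x \<in> loc_dom B B id i j}"
  have W: "open ?W" by (rule C1_on_open_preimage[OF loc[OF i] C1_onD(3)[OF B_ij]])
  have W_eq: "?W = loc_dom A B f i j"
    using loc_map_compose(2)[OF B i', of _ A f i B id j] ld loc_dom_subset[of A B f i j] by auto
  have "C1_on (mscale A) (mscale B) ?W (loc_map B B id i j \<circ> loc_map A B f i i)"
    by (rule C1_on_compose(1)[OF C1_on_subset[OF loc[OF i] W] B_ij]) auto
  then have "C1_on (mscale A) (mscale B) ?W (loc_map A B f i j)"
    by (rule C1_on_cong) (use loc_map_compose(1)[OF B i', of _ A f i B id j] ld in auto)
  then show "C1_on (mscale A) (mscale B) (loc_dom A B f i j) (loc_map A B f i j)"
    by (simp add: W_eq)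
qed


section \<open>The tangent manifold\<close>

lemma charts_tangent [simp]: "charts (tangent A) = charts A"
  and mscale_tangent [simp]: "mscale (tangent A) = prod_scale (mscale A) (mscale A)"
  by (simp_all add: tangent_def)

text \<open>The representative of the identity has constant slope \<open>v\<close> in the direction \<open>v\<close>.\<close>

lemma tangent_loc_id_self:
  assumes A: "C1_manifold A" and i: "i \<in> charts A" and z: "fst z \<in> img A i"
  shows "tangent_loc A A id i i z = z"
proof -
  have "diffl (mscale A) (mscale A) (img A i) (loc_map A A id i i) (fst z) (snd z) = snd z"
    by (rule diffl_eq_if_constant_slope[OF C1_manifoldD(4)[OF A i i, simplified]])
      (simp_all add: z loc_map_id_self)
  then show ?thesis using z by (simp add: tangent_loc_def split_beta loc_map_id_self)
qed

lemma tangent_loc_id_trans: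
  assumes A: "C1_manifold A" and i: "i \<in> charts A" and j: "j \<in> charts A" and k: "k \<in> charts A"
    and z: "fst z \<in> loc_dom A A id i j" "fst z \<in> loc_dom A A id i k"
  shows "tangent_loc A A id j k (tangent_loc A A id i j z) = tangent_loc A A id i k z"
  using tangent_loc_compose[OF A C1_manifoldD(5)[OF A] C1_manifoldD(5)[OF A] _ i j k, of z]
    C1_manifoldD(5)[OF A] z by simp

lemma loc_map_id_in_loc_dom:
  assumes "C1_manifold A" "j \<in> charts A" "x \<in> loc_dom A A id i j"
  shows "loc_map A A id i j x \<in> loc_dom A A id j k \<longleftrightarrow> x \<in> loc_dom A A id i k"
    and "loc_map A A id i j x \<in> img A j"
    and "pt_of A j (loc_map A A id i j x) = pt_of A i x"
  using loc_map_compose(2)[OF assms, of A id k] assms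
  by (auto simp: loc_dom_def loc_map_def cmap_in_img pt_of_cmap)

lemma tangent_vec_iff:
  "(j, y) \<in> tangent_vec A i z \<longleftrightarrow>
    j \<in> charts A \<and> fst z \<in> loc_dom A A id i j \<and> y = tangent_loc A A id i j z"
  by (auto simp: tangent_vec_def)

lemma tangent_vec_self:
  assumes "C1_manifold A" "i \<in> charts A" "fst z \<in> img A i"
  shows "(i, z) \<in> tangent_vec A i z"
  using assms by (simp add: tangent_vec_iff tangent_loc_id_self)

text \<open>By the cocycle condition the equivalence class may be formed from any of its representatives.\<close>

lemma tangent_vec_change_chart:
  assumes A: "C1_manifold A" and i: "i \<in> charts A" and j: "j \<in> charts A"
    and z: "fst z \<in> loc_dom A A id i j"
  shows "tangent_vec A j (tangent_loc A A id i j z) = tangent_vec A i z"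
  using loc_map_id_in_loc_dom(1)[OF A j z] tangent_loc_id_trans[OF A i j _ z]
  by (auto simp: tangent_vec_def)

lemma tangent_vec_eqI:
  assumes A: "C1_manifold A" and i: "i \<in> charts A" and j: "j \<in> charts A"
    and "(j, y) \<in> tangent_vec A i z"
  shows "tangent_vec A i z = tangent_vec A j y"
  using assms tangent_vec_change_chart[OF A i j, of z] by (simp add: tangent_vec_iff)

lemma cmap_tangent_vec:
  assumes "j \<in> charts A" "fst z \<in> loc_dom A A id i j"
  shows "cmap (tangent A) j (tangent_vec A i z) = tangent_loc A A id i j z"
  using assms by (simp add: tangent_def tangent_vec_iff)

lemma cmap_tangent_vec_self:
  assumes "C1_manifold A" "i \<in> charts A" "fst z \<in> img A i"
  shows "cmap (tangent A) i (tangent_vec A i z) = z"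
  using assms by (simp add: cmap_tangent_vec tangent_loc_id_self)

lemma tangent_vec_inject:
  assumes "C1_manifold A" "i \<in> charts A" "fst z \<in> img A i" "fst z' \<in> img A i"
    and "tangent_vec A i z = tangent_vec A i z'"
  shows "z = z'"
  using assms cmap_tangent_vec_self by metis

lemma img_tangent:
  assumes "C1_manifold A" "i \<in> charts A"
  shows "img (tangent A) i = img A i \<times> UNIV"
proof -
  have "img (tangent A) i = (\<lambda>z. cmap (tangent A) i (tangent_vec A i z)) ` (img A i \<times> UNIV)"
    by (simp add: img_def[of "tangent A"] image_image) (simp add: tangent_def image_image)
  also have "\<dots> = (\<lambda>z. z) ` (img A i \<times> UNIV)"
    by (rule image_cong) (auto simp: cmap_tangent_vec_self[OF assms])
  finally show ?thesis by simp
qed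

lemma tangent_vec_in_cdom_self:
  "fst z \<in> img A i \<Longrightarrow> tangent_vec A i z \<in> cdom (tangent A) i"
  by (cases z) (simp add: tangent_def)

lemma cdom_tangentE:
  assumes "p \<in> cdom (tangent A) i"
  obtains z where "fst z \<in> img A i" "p = tangent_vec A i z"
  using assms by (auto simp: tangent_def)

lemma tangent_vec_in_points:
  "i \<in> charts A \<Longrightarrow> fst z \<in> img A i \<Longrightarrow> tangent_vec A i z \<in> points (tangent A)"
  unfolding points_def by (auto intro: tangent_vec_in_cdom_self)

lemma points_tangentE:
  assumes "p \<in> points (tangent A)"
  obtains i z where "i \<in> charts A" "fst z \<in> img A i" "p = tangent_vec A i z"
  using assms by (auto simp: points_def elim: cdom_tangentE)

lemma tangent_vec_in_cdom_iff:
  assumes A: "C1_manifold A" and i: "i \<in> charts A" and j: "j \<in> charts A" and z: "fst z \<in> img A i"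
  shows "tangent_vec A i z \<in> cdom (tangent A) j \<longleftrightarrow> fst z \<in> loc_dom A A id i j"
proof
  assume "tangent_vec A i z \<in> cdom (tangent A) j"
  then obtain y where y: "fst y \<in> img A j" "tangent_vec A i z = tangent_vec A j y"
    by (rule cdom_tangentE)
  then have "(j, y) \<in> tangent_vec A i z" using tangent_vec_self[OF A j] by simp
  then show "fst z \<in> loc_dom A A id i j" by (simp add: tangent_vec_iff)
next
  assume z: "fst z \<in> loc_dom A A id i j"
  then show "tangent_vec A i z \<in> cdom (tangent A) j"
    using tangent_vec_in_cdom_self[of "tangent_loc A A id i j z" A j]
    by (simp add: tangent_vec_change_chart[OF A i j z] loc_map_id_in_loc_dom(2)[OF A j z])
qed

lemma pt_of_tangent:
  assumes A: "C1_manifold A" and i: "i \<in> charts A" and z: "fst z \<in> img A i"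
  shows "pt_of (tangent A) i z = tangent_vec A i z"
proof -
  have z': "z \<in> img (tangent A) i" using z by (cases z) (simp add: img_tangent[OF A i])
  obtain y where y: "fst y \<in> img A i" "pt_of (tangent A) i z = tangent_vec A i y"
    using pt_of_in_cdom[OF z'] by (rule cdom_tangentE)
  have "z = y" using cmap_pt_of[OF z'] y by (simp add: cmap_tangent_vec_self[OF A i])
  with y show ?thesis by simp
qed

lemma loc_dom_tangent:
  assumes A: "C1_manifold A" and i: "i \<in> charts A" and j: "j \<in> charts A"
  shows "loc_dom (tangent A) (tangent A) id i j = loc_dom A A id i j \<times> UNIV"
proof -
  have "z \<in> loc_dom (tangent A) (tangent A) id i j \<longleftrightarrow> fst z \<in> loc_dom A A id i j" for z
  proof (cases "fst z \<in> img A i")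
    case True
    then have "z \<in> img (tangent A) i" by (cases z) (simp add: img_tangent[OF A i])
    then show ?thesis
      using tangent_vec_in_cdom_iff[OF A i j True] by (simp add: loc_dom_def[of "tangent A"] pt_of_tangent[OF A i True])
  next
    case False
    then show ?thesis by (cases z) (auto simp: loc_dom_def img_tangent[OF A i])
  qed
  then show ?thesis by auto
qed

lemma loc_map_tangent:
  assumes A: "C1_manifold A" and i: "i \<in> charts A" and j: "j \<in> charts A"
    and z: "fst z \<in> loc_dom A A id i j"
  shows "loc_map (tangent A) (tangent A) id i j z = tangent_loc A A id i j z"
  using pt_of_tangent[OF A i, of z] cmap_tangent_vec[OF j z] z
  by (simp add: loc_map_def[of "tangent A"] loc_dom_def)

lemma foot_tangent_vec:
  assumes A: "C1_manifold A" and i: "i \<in> charts A" and z: "fst z \<in> img A i"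
  shows "foot A (tangent_vec A i z) = pt_of A i (fst z)"
  unfolding foot_def
proof (rule the_equality)
  have "(i, fst z, snd z) \<in> tangent_vec A i z" using tangent_vec_self[OF assms] by simp
  then show "\<exists>j x v. (j, x, v) \<in> tangent_vec A i z \<and> pt_of A i (fst z) = pt_of A j x" by blast
next
  fix m assume "\<exists>j x v. (j, x, v) \<in> tangent_vec A i z \<and> m = pt_of A j x"
  then obtain j x v where j: "j \<in> charts A" "fst z \<in> loc_dom A A id i j"
    "(x, v) = tangent_loc A A id i j z" "m = pt_of A j x" by (auto simp: tangent_vec_iff)
  then have "x = loc_map A A id i j (fst z)" by (metis fst_conv fst_tangent_loc)
  then show "m = pt_of A i (fst z)" using j loc_map_id_in_loc_dom(3)[OF A j(1,2)] by simp
qed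

lemma foot_in_points:
  assumes "C1_manifold A" "p \<in> points (tangent A)"
  shows "foot A p \<in> points A"
  using assms(2) by (rule points_tangentE) (simp add: foot_tangent_vec[OF assms(1)] pt_of_in_points)

lemma tangent_point_in_chart:
  assumes A: "C1_manifold A" and p: "p \<in> points (tangent A)" and i: "i \<in> charts A" and m: "foot A p \<in> cdom A i"
  shows "\<exists>v. p = tangent_vec A i (cmap A i (foot A p), v)"
proof -
  from p obtain j z where j: "j \<in> charts A" and z: "fst z \<in> img A j" and p_eq: "p = tangent_vec A j z"
    by (rule points_tangentE)
  have ft: "foot A p = pt_of A j (fst z)" by (simp add: p_eq foot_tangent_vec[OF A j z])
  have zi: "fst z \<in> loc_dom A A id j i" using z m by (simp add: loc_dom_def ft)
  let ?y = "tangent_loc A A id j i z"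
  have "p = tangent_vec A i ?y" by (simp add: p_eq tangent_vec_change_chart[OF A j i zi])
  moreover have "fst ?y = cmap A i (foot A p)" by (simp add: loc_map_def ft)
  ultimately have "p = tangent_vec A i (cmap A i (foot A p), snd ?y)" by (metis prod.collapse)
  then show ?thesis ..
qed

lemma cdom_tangent_eq:
  assumes A: "C1_manifold A" and i: "i \<in> charts A"
  shows "cdom (tangent A) i = {p \<in> points (tangent A). foot A p \<in> cdom A i}"
proof (intro set_eqI iffI)
  fix p assume p: "p \<in> cdom (tangent A) i"
  then obtain z where "fst z \<in> img A i" "p = tangent_vec A i z" by (rule cdom_tangentE)
  then show "p \<in> {p \<in> points (tangent A). foot A p \<in> cdom A i}"
    using A i by (simp add: foot_tangent_vec pt_of_in_cdom tangent_vec_in_points)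
next
  fix p assume p: "p \<in> {p \<in> points (tangent A). foot A p \<in> cdom A i}"
  then obtain v where v: "p = tangent_vec A i (cmap A i (foot A p), v)"
    using tangent_point_in_chart[OF A _ i] by blast
  show "p \<in> cdom (tangent A) i"
    by (subst v, rule tangent_vec_in_cdom_self) (use p in \<open>simp add: cmap_in_img\<close>)
qed

lemma inj_on_cmap_tangent:
  assumes "C1_manifold A" "i \<in> charts A"
  shows "inj_on (cmap (tangent A) i) (cdom (tangent A) i)"
proof (rule inj_onI)
  fix p q assume pq: "p \<in> cdom (tangent A) i" "q \<in> cdom (tangent A) i"
    "cmap (tangent A) i p = cmap (tangent A) i q"
  obtain y where y: "fst y \<in> img A i" "p = tangent_vec A i y" using pq(1) by (rule cdom_tangentE)
  obtain z where z: "fst z \<in> img A i" "q = tangent_vec A i z" using pq(2) by (rule cdom_tangentE)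
  show "p = q" using pq(3) y z by (simp add: cmap_tangent_vec_self[OF assms])
qed

text \<open>The transition maps are the tangent maps of those of \<open>A\<close>; their second component is a differential of a map
  of class \<open>C\<^sup>2\<close>.\<close>

lemma C1_manifold_tangent:
  assumes A2: "C2_manifold A"
  shows "C1_manifold (tangent A)"
proof -
  note A = C2_manifold_imp_C1[OF A2]
  have s: "topological_module (mscale A)" by (rule C1_manifoldD(1)[OF A])
  have "C1_on (mscale (tangent A)) (mscale (tangent A)) (loc_dom (tangent A) (tangent A) id i j)
      (loc_map (tangent A) (tangent A) id i j)" if i: "i \<in> charts A" and j: "j \<in> charts A" for i j
  proof -
    have f: "C2_on (mscale A) (mscale A) (loc_dom A A id i j) (loc_map A A id i j)"
      using A2 i j by (simp add: C2_manifold_def)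
    note U = C1_onD(3)[OF C2_on_imp_C1_on[OF f]]
    have "C1_on (prod_scale (mscale A) (mscale A)) (mscale A) (loc_dom A A id i j \<times> UNIV) fst"
      by (rule C1_on_linear[OF topological_module_prod[OF s s] s open_Times[OF U open_UNIV]])
        (auto intro!: module_hom.intro module_hom_axioms.intro topological_moduleD(1)
            topological_module_prod s continuous_on_fst continuous_on_id simp: prod_scale_def)
    then have "C1_on (prod_scale (mscale A) (mscale A)) (mscale A) (loc_dom A A id i j \<times> UNIV)
        (loc_map A A id i j \<circ> fst)"
      by (rule C1_on_compose(1)[OF _ C2_on_imp_C1_on[OF f]]) auto
    from C1_on_Pair(1)[OF this C2_on_tangent[OF f]]
    show ?thesis unfolding loc_dom_tangent[OF A i j] mscale_tangent
      by (rule C1_on_cong) (auto simp: loc_map_tangent[OF A i j] tangent_loc_def)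
  qed
  then show ?thesis
    by (auto simp: C1_manifold_def topological_module_prod s inj_on_cmap_tangent[OF A] img_tangent[OF A]
        intro!: open_Times C1_manifoldD(3)[OF A])
qed

text \<open>The defining property of the tangent map determines it already in one pair of charts. That it holds in the
  others is the chain rule, once for a change of charts in the source and once for one in the target.\<close>

lemma tangent_map_tangent_vec:
  assumes A: "C1_manifold A" and B: "C1_manifold B" and f: "C1_map A B f"
    and i: "i \<in> charts A" and j: "j \<in> charts B" and z: "fst z \<in> loc_dom A B f i j"
  shows "tangent_map A B f (tangent_vec A i z) = tangent_vec B j (tangent_loc A B f i j z)"
  unfolding tangent_map_def
proof (rule the_equality)
  let ?q = "tangent_vec B j (tangent_loc A B f i j z)"
  have zA: "fst z \<in> img A i" using z by (simp add: loc_dom_def)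
  have im: "fst (tangent_loc A B f i j z) \<in> img B j"
    using z by (simp add: loc_map_def loc_dom_def cmap_in_img)
  have "(l, tangent_loc A B f k l y) \<in> ?q"
    if y: "(k, y) \<in> tangent_vec A i z" and l: "l \<in> charts B" and yl: "fst y \<in> loc_dom A B f k l" for k y l
  proof -
    have k: "k \<in> charts A" "fst z \<in> loc_dom A A id i k" "y = tangent_loc A A id i k z"
      using y by (auto simp: tangent_vec_iff)
    have zl: "fst z \<in> loc_dom A B f i l"
      using loc_map_compose(2)[OF A k(1,2), of B f l] yl by (simp add: k(3))
    have "tangent_loc A B f k l y = tangent_loc A B f i l z"
      using tangent_loc_compose[OF A C1_manifoldD(5)[OF A] f _ i k(1) l k(2)] f zl by (simp add: k(3))
    also have "\<dots> = tangent_loc B B id j l (tangent_loc A B f i j z)"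
      using tangent_loc_compose[OF B f C1_manifoldD(5)[OF B] _ i j l z] f zl by simp
    finally show ?thesis
      using loc_map_compose(2)[OF B j z, of B id l] zl l by (simp add: tangent_vec_iff)
  qed
  then show "?q \<in> points (tangent B) \<and>
      (\<forall>(i, z)\<in>tangent_vec A i z. \<forall>j\<in>charts B. fst z \<in> loc_dom A B f i j \<longrightarrow> (j, tangent_loc A B f i j z) \<in> ?q)"
    using tangent_vec_in_points[OF j im] by blast
next
  fix q assume q: "q \<in> points (tangent B) \<and>
      (\<forall>(i, z)\<in>tangent_vec A i z. \<forall>j\<in>charts B. fst z \<in> loc_dom A B f i j \<longrightarrow> (j, tangent_loc A B f i j z) \<in> q)"
  have zA: "fst z \<in> img A i" using z by (simp add: loc_dom_def)
  have mem: "(j, tangent_loc A B f i j z) \<in> q"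
    using q tangent_vec_self[OF A i zA] j z by blast
  from q obtain l y where l: "l \<in> charts B" and "q = tangent_vec B l y" by (auto elim: points_tangentE)
  with mem show "q = tangent_vec B j (tangent_loc A B f i j z)"
    using tangent_vec_eqI[OF B l j] by simp
qed

section \<open>Vector bundles of class \<open>C\<^sup>1\<close>\<close>

text \<open>A common frame for \<open>F\<close> and for \<open>TM\<close>: the latter is the tangent manifold of a manifold of class \<open>C\<^sup>2\<close> and so
  only known to be of class \<open>C\<^sup>1\<close> here.\<close>

definition C1_vector_bundle ::
    "('k::dense_unit_ring, 'i, 'm, 'p, 'v::{topological_ab_group_add, t2_space},
      'w::{topological_ab_group_add, t2_space}) vbundle \<Rightarrow> bool" where
  "C1_vector_bundle F \<longleftrightarrow>
     C1_manifold (base F) \<and> C1_manifold (tot F) \<and> topological_module (fscale F) \<and>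
     mscale (tot F) = prod_scale (mscale (base F)) (fscale F) \<and>
     charts (tot F) = charts (base F) \<and>
     (\<forall>i\<in>charts (base F).
        cdom (tot F) i = {p \<in> points (tot F). vproj F p \<in> cdom (base F) i} \<and>
        img (tot F) i = img (base F) i \<times> UNIV \<and>
        (\<forall>p\<in>cdom (tot F) i. fst (cmap (tot F) i p) = cmap (base F) i (vproj F p))) \<and>
     (\<forall>i\<in>charts (base F). \<forall>j\<in>charts (base F). \<forall>x\<in>loc_dom (base F) (base F) id i j.
        module_hom (fscale F) (fscale F) (\<lambda>w. snd (loc_map (tot F) (tot F) id i j (x, w))))"

text \<open>The transition map \<open>g\<^sub>x\<close> of the fibers from the chart \<open>i\<close> to the chart \<open>j\<close>.\<close>

definition fiber_trans ::
    "('k, 'i, 'm, 'p, 'v, 'w) vbundle \<Rightarrow> 'i \<Rightarrow> 'i \<Rightarrow> 'v \<Rightarrow> 'w \<Rightarrow> 'w" where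
  "fiber_trans F i j x w = snd (loc_map (tot F) (tot F) id i j (x, w))"

lemma vector_bundle_imp_C1: "vector_bundle F \<Longrightarrow> C1_vector_bundle F"
  by (simp add: vector_bundle_def C1_vector_bundle_def C2_manifold_imp_C1 smooth_manifold_imp_C2)

lemma C1_vector_bundleD:
  assumes "C1_vector_bundle F"
  shows "C1_manifold (base F)" "C1_manifold (tot F)" "topological_module (fscale F)"
    and "mscale (tot F) = prod_scale (mscale (base F)) (fscale F)"
    and "charts (tot F) = charts (base F)"
    and "i \<in> charts (base F) \<Longrightarrow> cdom (tot F) i = {p \<in> points (tot F). vproj F p \<in> cdom (base F) i}"
    and "i \<in> charts (base F) \<Longrightarrow> img (tot F) i = img (base F) i \<times> UNIV"
    and "i \<in> charts (base F) \<Longrightarrow> p \<in> cdom (tot F) i \<Longrightarrow> fst (cmap (tot F) i p) = cmap (base F) i (vproj F p)"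
    and "i \<in> charts (base F) \<Longrightarrow> j \<in> charts (base F) \<Longrightarrow> x \<in> loc_dom (base F) (base F) id i j \<Longrightarrow>
      module_hom (fscale F) (fscale F) (fiber_trans F i j x)"
    and "topological_module (mscale (base F))"
  using assms by (auto simp: C1_vector_bundle_def fiber_trans_def[abs_def] C1_manifoldD(1))

lemma tangent_bundle_sel [simp]:
  "base (tangent_bundle M) = M" "tot (tangent_bundle M) = tangent M"
  "vproj (tangent_bundle M) = foot M" "fscale (tangent_bundle M) = mscale M"
  by (simp_all add: tangent_bundle_def)

lemma C1_vector_bundle_tangent:
  assumes M2: "C2_manifold M"
  shows "C1_vector_bundle (tangent_bundle M)"
proof -
  note M = C2_manifold_imp_C1[OF M2]
  have "fst (cmap (tangent M) i p) = cmap M i (foot M p)" if i: "i \<in> charts M" and p: "p \<in> cdom (tangent M) i" for i p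
  proof -
    obtain z where z: "fst z \<in> img M i" "p = tangent_vec M i z" using p by (rule cdom_tangentE)
    then show ?thesis
      by (simp add: cmap_tangent_vec_self[OF M i] foot_tangent_vec[OF M i] cmap_pt_of)
  qed
  moreover have "module_hom (mscale M) (mscale M) (\<lambda>w. snd (loc_map (tangent M) (tangent M) id i j (x, w)))"
    if "i \<in> charts M" "j \<in> charts M" "x \<in> loc_dom M M id i j" for i j x
    using diffl_module_hom[OF C1_manifoldD(4)[OF M that(1,2)] that(3)] that
    by (simp add: loc_map_tangent[OF M] tangent_loc_def)
  ultimately show ?thesis
    using M C1_manifold_tangent[OF M2] C1_manifoldD(1)[OF M]
    by (simp add: C1_vector_bundle_def cdom_tangent_eq[OF M] img_tangent[OF M])
qed

context
  fixes F :: "('k::dense_unit_ring, 'i, 'm, 'p, 'v::{topological_ab_group_add, t2_space},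
      'w::{topological_ab_group_add, t2_space}) vbundle"
  assumes F: "C1_vector_bundle F"
begin

lemma pt_of_tot:
  assumes i: "i \<in> charts (base F)" and x: "x \<in> img (base F) i"
  shows "pt_of (tot F) i (x, w) \<in> cdom (tot F) i"
    and "cmap (tot F) i (pt_of (tot F) i (x, w)) = (x, w)"
    and "pt_of (tot F) i (x, w) \<in> points (tot F)"
    and "vproj F (pt_of (tot F) i (x, w)) = pt_of (base F) i x"
proof -
  have xw: "(x, w) \<in> img (tot F) i" using x by (simp add: C1_vector_bundleD(7)[OF F i])
  show p: "pt_of (tot F) i (x, w) \<in> cdom (tot F) i" by (rule pt_of_in_cdom[OF xw])
  show c: "cmap (tot F) i (pt_of (tot F) i (x, w)) = (x, w)" by (rule cmap_pt_of[OF xw])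
  show "pt_of (tot F) i (x, w) \<in> points (tot F)" and "vproj F (pt_of (tot F) i (x, w)) = pt_of (base F) i x"
    using p C1_vector_bundleD(8)[OF F i p]
      pt_of_cmap[OF C1_vector_bundleD(1)[OF F] i, of "vproj F (pt_of (tot F) i (x, w))"]
    by (simp_all add: c C1_vector_bundleD(6)[OF F i])
qed

lemma tot_point_in_chart:
  assumes i: "i \<in> charts (base F)" and p: "p \<in> points (tot F)" "vproj F p \<in> cdom (base F) i"
  shows "p = pt_of (tot F) i (cmap (base F) i (vproj F p), snd (cmap (tot F) i p))"
proof -
  have p': "p \<in> cdom (tot F) i" using p by (simp add: C1_vector_bundleD(6)[OF F i])
  have "cmap (tot F) i p = (cmap (base F) i (vproj F p), snd (cmap (tot F) i p))"
    using C1_vector_bundleD(8)[OF F i p'] by (simp add: prod_eq_iff)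
  then show ?thesis
    using pt_of_cmap[OF C1_vector_bundleD(2)[OF F] _ p'] i by (simp add: C1_vector_bundleD(5)[OF F])
qed

lemma vproj_in_points:
  assumes "p \<in> points (tot F)"
  shows "vproj F p \<in> points (base F)"
proof -
  from assms obtain i where i: "i \<in> charts (base F)" and p: "p \<in> cdom (tot F) i"
    by (auto simp: points_def[of "tot F"] C1_vector_bundleD(5)[OF F])
  from p have "vproj F p \<in> cdom (base F) i" by (simp add: C1_vector_bundleD(6)[OF F i])
  with i show ?thesis by (auto simp: points_def)
qed

lemma loc_dom_tot:
  assumes i: "i \<in> charts (base F)" and j: "j \<in> charts (base F)"
  shows "loc_dom (tot F) (tot F) id i j = loc_dom (base F) (base F) id i j \<times> UNIV"
  using pt_of_tot[OF i] by (auto simp: loc_dom_def C1_vector_bundleD(6)[OF F j] C1_vector_bundleD(7)[OF F i])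

lemma loc_map_tot:
  assumes i: "i \<in> charts (base F)" and j: "j \<in> charts (base F)"
    and x: "x \<in> loc_dom (base F) (base F) id i j"
  shows "loc_map (tot F) (tot F) id i j (x, w) = (loc_map (base F) (base F) id i j x, fiber_trans F i j x w)"
proof -
  have xi: "x \<in> img (base F) i" using x by (simp add: loc_dom_def)
  have "pt_of (tot F) i (x, w) \<in> cdom (tot F) j"
    using x pt_of_tot[OF i xi] by (simp add: loc_dom_def C1_vector_bundleD(6)[OF F j])
  from C1_vector_bundleD(8)[OF F j this] show ?thesis
    by (simp add: prod_eq_iff fiber_trans_def loc_map_def pt_of_tot(4)[OF i xi])
qed

text \<open>Transition maps of the total space have the form \<open>(x, w) \<mapsto> (\<phi>(x), g\<^sub>x(w))\<close>, and their differential splits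
  accordingly. In the first component the derivative along \<open>(v, w')\<close> is that of \<open>\<phi>\<close> along \<open>v\<close>, since the
  increments agree.\<close>

lemma fiber_trans_C1:
  assumes i: "i \<in> charts (base F)" and j: "j \<in> charts (base F)"
  shows "C1_on (prod_scale (mscale (base F)) (fscale F)) (fscale F)
    (loc_dom (base F) (base F) id i j \<times> UNIV) (\<lambda>(x, w). fiber_trans F i j x w)"
    and "x \<in> loc_dom (base F) (base F) id i j \<Longrightarrow>
      diffl (mscale (tot F)) (mscale (tot F)) (loc_dom (tot F) (tot F) id i j) (loc_map (tot F) (tot F) id i j) (x, w) (v, w') =
      (diffl (mscale (base F)) (mscale (base F)) (loc_dom (base F) (base F) id i j) (loc_map (base F) (base F) id i j) x v,
       diffl (prod_scale (mscale (base F)) (fscale F)) (fscale F)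
        (loc_dom (base F) (base F) id i j \<times> UNIV) (\<lambda>(x, w). fiber_trans F i j x w) (x, w) (v, w'))"
proof -
  let ?U = "loc_dom (base F) (base F) id i j"
  let ?s = "prod_scale (mscale (base F)) (fscale F)"
  let ?G = "loc_map (tot F) (tot F) id i j"
  note sV = C1_vector_bundleD(10)[OF F] and sW = C1_vector_bundleD(3)[OF F]
  have i': "i \<in> charts (tot F)" and j': "j \<in> charts (tot F)" using i j by (simp_all add: C1_vector_bundleD(5)[OF F])
  have G: "C1_on ?s ?s (?U \<times> UNIV) ?G"
    using C1_manifoldD(4)[OF C1_vector_bundleD(2)[OF F] i' j']
    by (simp add: loc_dom_tot[OF i j] C1_vector_bundleD(4)[OF F])
  have f: "module_hom ?s (mscale (base F)) fst" and s: "module_hom ?s (fscale F) snd"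
    by (auto intro!: module_homI topological_module_prod sV sW simp: prod_scale_def)
  note G1 = C1_on_linear_postcompose[OF G sV f continuous_on_fst[OF continuous_on_id]]
    and G2 = C1_on_linear_postcompose[OF G sW s continuous_on_snd[OF continuous_on_id]]
  show T: "C1_on ?s (fscale F) (?U \<times> UNIV) (\<lambda>(x, w). fiber_trans F i j x w)"
    by (rule C1_on_cong[OF G2(1)]) (auto simp: fiber_trans_def)
  assume x: "x \<in> ?U"
  have "fst (diffl ?s ?s (?U \<times> UNIV) ?G (x, w) (v, w')) =
      diffl ?s (mscale (base F)) (?U \<times> UNIV) (\<lambda>z. fst (?G z)) (x, w) (v, w')"
    using G1(2) x by simp
  also have "\<dots> = diffl (mscale (base F)) (mscale (base F)) ?U (loc_map (base F) (base F) id i j) x v"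
    by (rule diffl_eq_along_line[OF G1(1) C1_manifoldD(4)[OF C1_vector_bundleD(1)[OF F] i j] _ x open_UNIV UNIV_I])
      (auto simp: x prod_scale_def loc_map_tot[OF i j])
  finally have 1: "fst (diffl ?s ?s (?U \<times> UNIV) ?G (x, w) (v, w')) =
      diffl (mscale (base F)) (mscale (base F)) ?U (loc_map (base F) (base F) id i j) x v" .
  have "snd (diffl ?s ?s (?U \<times> UNIV) ?G (x, w) (v, w')) =
      diffl ?s (fscale F) (?U \<times> UNIV) (\<lambda>z. snd (?G z)) (x, w) (v, w')"
    using G2(2) x by simp
  also have "\<dots> = diffl ?s (fscale F) (?U \<times> UNIV) (\<lambda>(x, w). fiber_trans F i j x w) (x, w) (v, w')"
    by (rule diffl_eq_along_line[OF G2(1) T _ _ open_UNIV UNIV_I]) (auto simp: x prod_scale_def fiber_trans_def)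
  finally show "diffl (mscale (tot F)) (mscale (tot F)) (loc_dom (tot F) (tot F) id i j) ?G (x, w) (v, w') =
      (diffl (mscale (base F)) (mscale (base F)) ?U (loc_map (base F) (base F) id i j) x v,
       diffl ?s (fscale F) (?U \<times> UNIV) (\<lambda>(x, w). fiber_trans F i j x w) (x, w) (v, w'))"
    using 1 by (simp add: loc_dom_tot[OF i j] C1_vector_bundleD(4)[OF F] prod_eq_iff)
qed

text \<open>The derivative \<open>\<partial>\<^sub>vg\<^sub>x(w)\<close> of the fiber transition map with respect to the base point.\<close>

definition trans_base_deriv where
  "trans_base_deriv i j x w v = diffl (prod_scale (mscale (base F)) (fscale F)) (fscale F)
        (loc_dom (base F) (base F) id i j \<times> UNIV) (\<lambda>(x, w). fiber_trans F i j x w) (x, w) (v, 0)"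

text \<open>\<open>g\<^sub>x\<close> is linear, so the derivative of \<open>g\<close> in the direction \<open>(v, w')\<close> is its derivative with respect to \<open>x\<close>
  plus \<open>g\<^sub>x(w')\<close>.\<close>

lemma tangent_loc_tot:
  assumes i: "i \<in> charts (base F)" and j: "j \<in> charts (base F)"
    and x: "x \<in> loc_dom (base F) (base F) id i j"
  shows "tangent_loc (tot F) (tot F) id i j ((x, w), (v, w')) =
    ((loc_map (base F) (base F) id i j x, fiber_trans F i j x w),
     (snd (tangent_loc (base F) (base F) id i j (x, v)), trans_base_deriv i j x w v + fiber_trans F i j x w'))"
proof -
  let ?U = "loc_dom (base F) (base F) id i j"
  let ?s = "prod_scale (mscale (base F)) (fscale F)"
  let ?D = "diffl ?s (fscale F) (?U \<times> UNIV) (\<lambda>(x, w). fiber_trans F i j x w) (x, w)"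
  note T = fiber_trans_C1(1)[OF i j]
  have xw: "(x, w) \<in> ?U \<times> UNIV" using x by simp
  interpret D: module_hom ?s "fscale F" ?D by (rule diffl_module_hom[OF T xw])
  interpret t: module_hom "fscale F" "fscale F" "fiber_trans F i j x" by (rule C1_vector_bundleD(9)[OF F i j x])
  have "?D (0, w') = fiber_trans F i j x w'"
    by (rule diffl_eq_if_constant_slope[OF T xw])
      (auto simp: prod_scale_def t.add t.scale topological_moduleD[OF C1_vector_bundleD(10)[OF F]])
  moreover have "?D (v, w') = ?D (v, 0) + ?D (0, w')" using D.add[of "(v, 0)" "(0, w')"] by simp
  ultimately show ?thesis
    by (simp add: tangent_loc_def fiber_trans_C1(2)[OF i j x] loc_map_tot[OF i j x] trans_base_deriv_def)
qed

text \<open>Points with only an \<open>\<epsilon>\<^sub>0\<close>-component or only an \<open>\<epsilon>\<^sub>1\<close>-component thus keep this form under a change of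
  charts, which is what the transformation rule of Christoffel tensors is derived from.\<close>

lemma trans_base_deriv_zero:
  assumes i: "i \<in> charts (base F)" and j: "j \<in> charts (base F)"
    and x: "x \<in> loc_dom (base F) (base F) id i j"
  shows "trans_base_deriv i j x w 0 = 0" and "trans_base_deriv i j x 0 v = 0"
proof -
  let ?U = "loc_dom (base F) (base F) id i j"
  let ?s = "prod_scale (mscale (base F)) (fscale F)"
  note T = fiber_trans_C1(1)[OF i j]
  interpret D: module_hom ?s "fscale F" "diffl ?s (fscale F) (?U \<times> UNIV) (\<lambda>(x, w). fiber_trans F i j x w) (x, w)"
    by (rule diffl_module_hom[OF T]) (simp add: x)
  show "trans_base_deriv i j x w 0 = 0" using D.zero by (simp add: trans_base_deriv_def zero_prod_def)
  have t0: "fiber_trans F i j y 0 = 0" if "y \<in> ?U" for y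
  proof -
    interpret t: module_hom "fscale F" "fscale F" "fiber_trans F i j y" by (rule C1_vector_bundleD(9)[OF F i j that])
    show ?thesis by (rule t.zero)
  qed
  show "trans_base_deriv i j x 0 v = 0" unfolding trans_base_deriv_def
    by (rule diffl_eq_if_constant_slope[OF T])
      (auto simp: x t0 prod_scale_def topological_moduleD[OF C1_vector_bundleD(3)[OF F]])
qed


section \<open>Linear connections and their splitting maps\<close>

lemma christoffelD:
  assumes b: "christoffel F L i b" and i: "i \<in> charts (base F)" and x: "x \<in> img (base F) i"
  shows "module_hom (fscale F) (fscale F) (\<lambda>w. b x w v)" and "module_hom (mscale (base F)) (fscale F) (b x w)"
    and "ladd L (tangent_vec (tot F) i ((x, w), (v, w' + b x w v)))
        (tangent_vec (tot F) i ((x, y), (u, y' + b x y u))) =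
      tangent_vec (tot F) i ((x, w + y), (v + u, w' + y' + b x (w + y) (v + u)))"
proof -
  show "module_hom (fscale F) (fscale F) (\<lambda>w. b x w v)" and "module_hom (mscale (base F)) (fscale F) (b x w)"
    using b x by (auto simp: christoffel_def bilinear_map_def Let_def)
  have i': "i \<in> charts (tot F)" using i by (simp add: C1_vector_bundleD(5)[OF F])
  have pt: "pt_of (tangent (tot F)) i ((x, w), z) = tangent_vec (tot F) i ((x, w), z)" for w z
    using pt_of_tangent[OF C1_vector_bundleD(2)[OF F] i', of "((x, w), z)"] x
    by (simp add: C1_vector_bundleD(7)[OF F i])
  from b have "\<forall>x\<in>img (base F) i. \<forall>y z.
      ladd L (case y of (w, v, w') \<Rightarrow> pt_of (tangent (tot F)) i ((x, w), v, w' + b x w v))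
       (case z of (w, v, w') \<Rightarrow> pt_of (tangent (tot F)) i ((x, w), v, w' + b x w v)) =
      (case y + z of (w, v, w') \<Rightarrow> pt_of (tangent (tot F)) i ((x, w), v, w' + b x w v))"
    unfolding christoffel_def Let_def by (elim conjE) assumption
  from this[rule_format, OF x, of "(w, v, w')" "(y, u, y')"]
  show "ladd L (tangent_vec (tot F) i ((x, w), (v, w' + b x w v)))
        (tangent_vec (tot F) i ((x, y), (u, y' + b x y u))) =
      tangent_vec (tot F) i ((x, w + y), (v + u, w' + y' + b x (w + y) (v + u)))"
    by (simp add: pt)
qed

text \<open>The reason is that both charts carry the same addition on the fibers of \<open>TF\<close>. In the chart \<open>i\<close> the point
  \<open>(w, v, b(w, v))\<close> is the sum, for the addition of \<open>L\<close>, of \<open>(w, 0, 0)\<close> and \<open>(0, v, 0)\<close>. The change to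
  the chart \<open>j\<close> maps these to \<open>(g\<^sub>x(w), 0, 0)\<close> and \<open>(0, d\<phi>(v), 0)\<close>, whose sum there has the last component
  \<open>b'(g\<^sub>x(w), d\<phi>(v))\<close>, while the change of charts maps \<open>b(w, v)\<close> to \<open>\<partial>\<^sub>vg\<^sub>x(w) + g\<^sub>x(b(w, v))\<close>.\<close>

lemma christoffel_transform:
  assumes b: "christoffel F L i b" and b': "christoffel F L j b'"
    and i: "i \<in> charts (base F)" and j: "j \<in> charts (base F)"
    and x: "x \<in> loc_dom (base F) (base F) id i j"
  shows "trans_base_deriv i j x w v + fiber_trans F i j x (b x w v) =
    b' (loc_map (base F) (base F) id i j x) (fiber_trans F i j x w) (snd (tangent_loc (base F) (base F) id i j (x, v)))"
proof -
  let ?x = "loc_map (base F) (base F) id i j x"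
  let ?g = "fiber_trans F i j x"
  let ?d = "\<lambda>v. snd (tangent_loc (base F) (base F) id i j (x, v))"
  note base = C1_vector_bundleD(1)[OF F] and tot = C1_vector_bundleD(2)[OF F]
  have i': "i \<in> charts (tot F)" and j': "j \<in> charts (tot F)" using i j by (simp_all add: C1_vector_bundleD(5)[OF F])
  have xi: "x \<in> img (base F) i" using x by (simp add: loc_dom_def)
  have xj: "?x \<in> img (base F) j" by (rule loc_map_id_in_loc_dom(2)[OF base j x])
  have vec: "tangent_vec (tot F) i ((x, w), (v, w')) =
      tangent_vec (tot F) j ((?x, ?g w), (?d v, trans_base_deriv i j x w v + ?g w'))" for w v w'
    using tangent_vec_change_chart[OF tot i' j', of "((x, w), (v, w'))"] x
    by (simp add: loc_dom_tot[OF i j] tangent_loc_tot[OF i j x])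
  interpret g: module_hom "fscale F" "fscale F" ?g by (rule C1_vector_bundleD(9)[OF F i j x])
  interpret d: module_hom "mscale (base F)" "mscale (base F)" ?d
    using diffl_module_hom[OF C1_manifoldD(4)[OF base i j] x] by (simp add: tangent_loc_def)
  have bz: "b x w 0 = 0" "b x 0 v = 0" "b' ?x w 0 = 0" "b' ?x 0 v = 0" for w v
    using module_hom.zero[OF christoffelD(1)[OF b i xi]] module_hom.zero[OF christoffelD(2)[OF b i xi]]
      module_hom.zero[OF christoffelD(1)[OF b' j xj]] module_hom.zero[OF christoffelD(2)[OF b' j xj]]
    by simp_all
  note z = trans_base_deriv_zero[OF i j x]
  have "tangent_vec (tot F) i ((x, w), (v, b x w v)) =
      ladd L (tangent_vec (tot F) i ((x, w), (0, 0))) (tangent_vec (tot F) i ((x, 0), (v, 0)))"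
    using christoffelD(3)[OF b i xi, of w 0 0 0 v 0] by (simp add: bz)
  also have "\<dots> = ladd L (tangent_vec (tot F) j ((?x, ?g w), (0, 0))) (tangent_vec (tot F) j ((?x, 0), (?d v, 0)))"
    by (simp add: vec z g.zero d.zero)
  also have "\<dots> = tangent_vec (tot F) j ((?x, ?g w), (?d v, b' ?x (?g w) (?d v)))"
    using christoffelD(3)[OF b' j xj, of "?g w" 0 0 0 "?d v" 0] by (simp add: bz)
  finally have "tangent_vec (tot F) j ((?x, ?g w), (?d v, trans_base_deriv i j x w v + ?g (b x w v))) =
      tangent_vec (tot F) j ((?x, ?g w), (?d v, b' ?x (?g w) (?d v)))" by (simp add: vec)
  from tangent_vec_inject[OF tot j' _ _ this] show ?thesis
    using xj by (simp add: C1_vector_bundleD(7)[OF F j])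
qed

end

lemma charts_split [simp]: "charts (split_bundle F) = charts (base F)"
  and mscale_split: "mscale (split_bundle F) = prod_scale (mscale (base F))
                 (prod_scale (fscale F) (prod_scale (mscale (base F)) (fscale F)))"
  by (simp_all add: split_bundle_def)

text \<open>The inverse of the bundle chart of \<open>F \<oplus> TM \<oplus> F\<close>, see \<open>pt_of_split\<close>.\<close>

definition split_pt where
  "split_pt F i = (\<lambda>(x, w, v, w').
     (pt_of (tot F) i (x, w), tangent_vec (base F) i (x, v), pt_of (tot F) i (x, w')))"

context
  fixes F :: "('k::dense_unit_ring, 'i, 'm, 'p, 'v::{topological_ab_group_add, t2_space},
      'w::{topological_ab_group_add, t2_space}) vbundle"
  assumes F: "C1_vector_bundle F" and TM: "C1_vector_bundle (tangent_bundle (base F))"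
begin

lemma split_pt_in_cdom:
  assumes i: "i \<in> charts (base F)" and j: "j \<in> charts (base F)" and x: "x \<in> img (base F) i"
  shows "split_pt F i (x, w, v, w') \<in> cdom (split_bundle F) j \<longleftrightarrow> x \<in> loc_dom (base F) (base F) id i j"
proof -
  note M = C1_vector_bundleD(1)[OF F]
  have ft: "foot (base F) (tangent_vec (base F) i (x, v)) = pt_of (base F) i x"
    using foot_tangent_vec[OF M i] x by simp
  show ?thesis
    using x tangent_vec_in_cdom_iff[OF M i j, of "(x, v)"]
    by (auto simp: split_bundle_def split_pt_def ft pt_of_tot(3,4)[OF F i x] C1_vector_bundleD(6)[OF F j] loc_dom_def)
qed

lemma cmap_split_pt:
  assumes i: "i \<in> charts (base F)" and j: "j \<in> charts (base F)"
    and x: "x \<in> loc_dom (base F) (base F) id i j"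
  shows "cmap (split_bundle F) j (split_pt F i (x, w, v, w')) =
    (loc_map (base F) (base F) id i j x, fiber_trans F i j x w, snd (tangent_loc (base F) (base F) id i j (x, v)),
      fiber_trans F i j x w')"
proof -
  note M = C1_vector_bundleD(1)[OF F]
  have xi: "x \<in> img (base F) i" using x by (simp add: loc_dom_def)
  have ft: "foot (base F) (tangent_vec (base F) i (x, v)) = pt_of (base F) i x"
    using foot_tangent_vec[OF M i] xi by simp
  show ?thesis
    using cmap_tangent_vec[OF j, of "(x, v)" i] x
    by (simp add: split_bundle_def split_pt_def ft) (simp add: loc_map_def fiber_trans_def)
qed

lemma cmap_split_pt_self:
  assumes i: "i \<in> charts (base F)" and x: "x \<in> img (base F) i"
  shows "cmap (split_bundle F) i (split_pt F i (x, w, v, w')) = (x, w, v, w')"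
proof -
  note M = C1_vector_bundleD(1)[OF F]
  have ft: "foot (base F) (tangent_vec (base F) i (x, v)) = pt_of (base F) i x"
    using foot_tangent_vec[OF M i] x by simp
  show ?thesis
    using cmap_tangent_vec_self[OF M i, of "(x, v)"] x
    by (simp add: split_bundle_def split_pt_def ft cmap_pt_of pt_of_tot(2)[OF F i x])
qed

lemma cdom_splitE:
  assumes i: "i \<in> charts (base F)" and z: "z \<in> cdom (split_bundle F) i"
  obtains x w v w' where "x \<in> img (base F) i" "z = split_pt F i (x, w, v, w')"
proof -
  note M = C1_vector_bundleD(1)[OF F]
  obtain p t q where z_eq: "z = (p, t, q)" by (cases z)
  have p: "p \<in> cdom (tot F) i" and t: "t \<in> cdom (tangent (base F)) i" and q: "q \<in> cdom (tot F) i"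
    and vp: "vproj F p = foot (base F) t" "vproj F q = foot (base F) t"
    using z by (auto simp: split_bundle_def z_eq)
  obtain y where y: "fst y \<in> img (base F) i" "t = tangent_vec (base F) i y" using t by (rule cdom_tangentE)
  have ft: "foot (base F) t = pt_of (base F) i (fst y)" using y foot_tangent_vec[OF M i] by simp
  have c: "cmap (base F) i (foot (base F) t) = fst y" using y(1) by (simp add: ft cmap_pt_of)
  have "p = pt_of (tot F) i (fst y, snd (cmap (tot F) i p))" "q = pt_of (tot F) i (fst y, snd (cmap (tot F) i q))"
    using tot_point_in_chart[OF F i, of p] tot_point_in_chart[OF F i, of q] p q vp c
    by (simp_all add: C1_vector_bundleD(6)[OF F i])
  then have "z = split_pt F i (fst y, snd (cmap (tot F) i p), snd y, snd (cmap (tot F) i q))"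
    using y(2) by (simp add: z_eq split_pt_def)
  then show ?thesis using that y(1) by blast
qed

lemma img_split:
  assumes i: "i \<in> charts (base F)"
  shows "img (split_bundle F) i = img (base F) i \<times> UNIV"
proof (intro set_eqI iffI)
  fix y assume "y \<in> img (split_bundle F) i"
  then obtain z where z: "z \<in> cdom (split_bundle F) i" "y = cmap (split_bundle F) i z" by (auto simp: img_def)
  from i z(1) obtain x w v w' where "x \<in> img (base F) i" "z = split_pt F i (x, w, v, w')" by (rule cdom_splitE)
  then show "y \<in> img (base F) i \<times> UNIV" using z(2) cmap_split_pt_self[OF i] by simp
next
  fix y assume "y \<in> img (base F) i \<times> (UNIV :: ('w \<times> 'v \<times> 'w) set)"
  then obtain x w v w' where y: "y = (x, w, v, w')" and x: "x \<in> img (base F) i" by (cases y) auto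
  have "split_pt F i y \<in> cdom (split_bundle F) i" using split_pt_in_cdom[OF i i x] x by (simp add: y)
  moreover have "y = cmap (split_bundle F) i (split_pt F i y)" by (simp add: y cmap_split_pt_self[OF i x])
  ultimately show "y \<in> img (split_bundle F) i" unfolding img_def by blast
qed

lemma inj_on_cmap_split:
  assumes i: "i \<in> charts (base F)"
  shows "inj_on (cmap (split_bundle F) i) (cdom (split_bundle F) i)"
proof (rule inj_onI)
  fix y z assume y: "y \<in> cdom (split_bundle F) i" and z: "z \<in> cdom (split_bundle F) i"
    and eq: "cmap (split_bundle F) i y = cmap (split_bundle F) i z"
  from i y obtain x1 w1 v1 w1' where y': "x1 \<in> img (base F) i" "y = split_pt F i (x1, w1, v1, w1')" by (rule cdom_splitE)
  from i z obtain x2 w2 v2 w2' where z': "x2 \<in> img (base F) i" "z = split_pt F i (x2, w2, v2, w2')" by (rule cdom_splitE)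
  show "y = z" using eq y' z' by (simp add: cmap_split_pt_self[OF i])
qed

lemma pt_of_split:
  assumes i: "i \<in> charts (base F)" and x: "x \<in> img (base F) i"
  shows "pt_of (split_bundle F) i (x, w, v, w') = split_pt F i (x, w, v, w')"
proof -
  have "pt_of (split_bundle F) i (cmap (split_bundle F) i (split_pt F i (x, w, v, w'))) = split_pt F i (x, w, v, w')"
    unfolding pt_of_def
    by (rule inv_into_f_f[OF inj_on_cmap_split[OF i]]) (use split_pt_in_cdom[OF i i x] x in simp)
  then show ?thesis by (simp add: cmap_split_pt_self[OF i x])
qed

lemma loc_dom_split:
  assumes i: "i \<in> charts (base F)" and j: "j \<in> charts (base F)"
  shows "loc_dom (split_bundle F) (split_bundle F) id i j = loc_dom (base F) (base F) id i j \<times> UNIV"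
proof -
  have "y \<in> loc_dom (split_bundle F) (split_bundle F) id i j \<longleftrightarrow> fst y \<in> loc_dom (base F) (base F) id i j" for y
  proof (cases "fst y \<in> img (base F) i")
    case True
    then show ?thesis
      by (cases y) (simp add: loc_dom_def[of "split_bundle F"] img_split[OF i] pt_of_split[OF i] split_pt_in_cdom[OF i j])
  next
    case False
    then show ?thesis by (cases y) (auto simp: loc_dom_def img_split[OF i])
  qed
  then show ?thesis by auto
qed

lemma loc_map_split:
  assumes i: "i \<in> charts (base F)" and j: "j \<in> charts (base F)"
    and x: "x \<in> loc_dom (base F) (base F) id i j"
  shows "loc_map (split_bundle F) (split_bundle F) id i j (x, w, v, w') =
    (loc_map (base F) (base F) id i j x, fiber_trans F i j x w, fiber_trans (tangent_bundle (base F)) i j x v, fiber_trans F i j x w')"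
proof -
  have "x \<in> img (base F) i" using x by (simp add: loc_dom_def)
  then show ?thesis
    using cmap_split_pt[OF i j x] loc_map_tangent[OF C1_vector_bundleD(1)[OF F] i j, of "(x, v)"] x
    by (simp add: loc_map_def[of "split_bundle F"] pt_of_split[OF i] fiber_trans_def)
qed

text \<open>The transition maps are assembled from those of the base, of \<open>F\<close> and of \<open>TM\<close>, composed with coordinate
  projections.\<close>

lemma C1_manifold_split: "C1_manifold (split_bundle F)"
proof -
  note sV = C1_vector_bundleD(10)[OF F] and sW = C1_vector_bundleD(3)[OF F]
  let ?sV = "mscale (base F)" and ?sW = "fscale F"
  let ?s = "prod_scale ?sV (prod_scale ?sW (prod_scale ?sV ?sW))"
  have s: "topological_module ?s" by (intro topological_module_prod sV sW)
  have "C1_on ?s ?s (loc_dom (split_bundle F) (split_bundle F) id i j) (loc_map (split_bundle F) (split_bundle F) id i j)"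
    if i: "i \<in> charts (base F)" and j: "j \<in> charts (base F)" for i j
  proof -
    let ?U = "loc_dom (base F) (base F) id i j"
    let ?T = "tangent_bundle (base F)"
    note phi = C1_manifoldD(4)[OF C1_vector_bundleD(1)[OF F] i j]
    have U: "open (?U \<times> UNIV)" by (intro open_Times open_UNIV C1_onD(3)[OF phi])
    have g: "C1_on (prod_scale ?sV ?sW) ?sW (?U \<times> UNIV) (\<lambda>(x, w). fiber_trans F i j x w)"
      by (rule fiber_trans_C1(1)[OF F i j])
    have d: "C1_on (prod_scale ?sV ?sV) ?sV (?U \<times> UNIV) (\<lambda>(x, w). fiber_trans ?T i j x w)"
      using fiber_trans_C1(1)[OF TM, of i j] i j by simp
    have lin: "module_hom ?s ?sV fst" "module_hom ?s (prod_scale ?sV ?sW) (\<lambda>(x, w, v, w'). (x, w))"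
      "module_hom ?s (prod_scale ?sV ?sV) (\<lambda>(x, w, v, w'). (x, v))"
      "module_hom ?s (prod_scale ?sV ?sW) (\<lambda>(x, w, v, w'). (x, w'))"
      by (rule module_homI, intro topological_module_prod sV sW, intro topological_module_prod sV sW,
          (auto simp: prod_scale_def)[2])+
    have cont: "continuous_on UNIV (fst :: 'v \<times> 'w \<times> 'v \<times> 'w \<Rightarrow> 'v)"
      "continuous_on UNIV (\<lambda>(x, w, v, w'). (x, w) :: 'v \<times> 'w)"
      "continuous_on UNIV (\<lambda>(x, w, v, w'). (x, v) :: 'v \<times> 'v)"
      "continuous_on UNIV (\<lambda>(x, w, v, w'). (x, w') :: 'v \<times> 'w)"
      unfolding split_beta' by (intro continuous_on_Pair continuous_on_fst continuous_on_snd continuous_on_id)+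
    have 1: "C1_on ?s ?sV (?U \<times> UNIV) (\<lambda>z. loc_map (base F) (base F) id i j (fst z))"
      by (rule C1_on_linear_precompose(1)[OF phi s lin(1) cont(1) U]) auto
    have 2: "C1_on ?s ?sW (?U \<times> UNIV) (\<lambda>z. (\<lambda>(x, w). fiber_trans F i j x w) ((\<lambda>(x, w, v, w'). (x, w)) z))"
      by (rule C1_on_linear_precompose(1)[OF g s lin(2) cont(2) U]) auto
    have 3: "C1_on ?s ?sV (?U \<times> UNIV) (\<lambda>z. (\<lambda>(x, w). fiber_trans ?T i j x w) ((\<lambda>(x, w, v, w'). (x, v)) z))"
      by (rule C1_on_linear_precompose(1)[OF d s lin(3) cont(3) U]) auto
    have 4: "C1_on ?s ?sW (?U \<times> UNIV) (\<lambda>z. (\<lambda>(x, w). fiber_trans F i j x w) ((\<lambda>(x, w, v, w'). (x, w')) z))"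
      by (rule C1_on_linear_precompose(1)[OF g s lin(4) cont(4) U]) auto
    show ?thesis unfolding loc_dom_split[OF i j]
      by (rule C1_on_cong[OF C1_on_Pair(1)[OF 1 C1_on_Pair(1)[OF 2 C1_on_Pair(1)[OF 3 4]]]])
        (auto simp: loc_map_split[OF i j])
  qed
  then show ?thesis
    using s by (auto simp: C1_manifold_def mscale_split inj_on_cmap_split img_split
        intro!: open_Times C1_manifoldD(3)[OF C1_vector_bundleD(1)[OF F]])
qed

text \<open>The transformation rule makes the conditions that the charts impose on the splitting map compatible.\<close>

lemma splitting_split_pt:
  assumes i: "i \<in> charts (base F)" and x: "x \<in> img (base F) i" and b: "christoffel F L i b"
  shows "splitting F L (split_pt F i (x, w, v, w')) = tangent_vec (tot F) i ((x, w), (v, w' + b x w v))"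
  unfolding splitting_def
proof (rule the_equality)
  let ?p = "tangent_vec (tot F) i ((x, w), (v, w' + b x w v))"
  note tot = C1_vector_bundleD(2)[OF F]
  have i': "i \<in> charts (tot F)" using i by (simp add: C1_vector_bundleD(5)[OF F])
  have xi: "fst ((x, w), (v, w' + b x w v)) \<in> img (tot F) i" using x by (simp add: C1_vector_bundleD(7)[OF F i])
  have "?p \<in> cdom (tangent (tot F)) j \<and> cmap (tangent (tot F)) j ?p =
      (case cmap (split_bundle F) j (split_pt F i (x, w, v, w')) of (x, w, v, w') \<Rightarrow> ((x, w), (v, w' + b' x w v)))"
    if j: "j \<in> charts (base F)" and dom: "split_pt F i (x, w, v, w') \<in> cdom (split_bundle F) j"
      and b': "christoffel F L j b'" for j b'
  proof -
    have j': "j \<in> charts (tot F)" using j by (simp add: C1_vector_bundleD(5)[OF F])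
    have xj: "x \<in> loc_dom (base F) (base F) id i j" using dom by (simp add: split_pt_in_cdom[OF i j x])
    interpret g: module_hom "fscale F" "fscale F" "fiber_trans F i j x" by (rule C1_vector_bundleD(9)[OF F i j xj])
    have "trans_base_deriv F i j x w v + fiber_trans F i j x (b x w v) =
        b' (loc_map (base F) (base F) id i j x) (fiber_trans F i j x w) (snd (tangent_loc (base F) (base F) id i j (x, v)))"
      by (rule christoffel_transform[OF F b b' i j xj])
    then show ?thesis
      using tangent_vec_in_cdom_iff[OF tot i' j' xi] cmap_tangent_vec[OF j', of "((x, w), (v, w' + b x w v))" i]
      by (simp add: cmap_split_pt[OF i j xj] loc_dom_tot[OF F i j] xj tangent_loc_tot[OF F i j xj] g.add add.left_commute)
  qed
  then show "?p \<in> points (tangent (tot F)) \<and>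
     (\<forall>j\<in>charts (base F). \<forall>b'. split_pt F i (x, w, v, w') \<in> cdom (split_bundle F) j \<and> christoffel F L j b' \<longrightarrow>
       ?p \<in> cdom (tangent (tot F)) j \<and> cmap (tangent (tot F)) j ?p =
      (case cmap (split_bundle F) j (split_pt F i (x, w, v, w')) of (x, w, v, w') \<Rightarrow> ((x, w), (v, w' + b' x w v))))"
    using tangent_vec_in_points[OF i' xi] by blast
next
  fix p
  note tot = C1_vector_bundleD(2)[OF F]
  have i': "i \<in> charts (tot F)" using i by (simp add: C1_vector_bundleD(5)[OF F])
  assume "p \<in> points (tangent (tot F)) \<and>
     (\<forall>j\<in>charts (base F). \<forall>b'. split_pt F i (x, w, v, w') \<in> cdom (split_bundle F) j \<and> christoffel F L j b' \<longrightarrow>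
       p \<in> cdom (tangent (tot F)) j \<and> cmap (tangent (tot F)) j p =
      (case cmap (split_bundle F) j (split_pt F i (x, w, v, w')) of (x, w, v, w') \<Rightarrow> ((x, w), (v, w' + b' x w v))))"
  moreover have "split_pt F i (x, w, v, w') \<in> cdom (split_bundle F) i"
    using split_pt_in_cdom[OF i i x] x by simp
  ultimately have p: "p \<in> cdom (tangent (tot F)) i" and
    c: "cmap (tangent (tot F)) i p = ((x, w), (v, w' + b x w v))"
    using i b by (simp_all add: cmap_split_pt_self[OF i x])
  from p obtain z where "fst z \<in> img (tot F) i" "p = tangent_vec (tot F) i z" by (rule cdom_tangentE)
  then show "p = tangent_vec (tot F) i ((x, w), (v, w' + b x w v))"
    using c by (simp add: cmap_tangent_vec_self[OF tot i'])
qed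

end

lemma christoffel_C1:
  assumes F: "C1_vector_bundle F" and b: "christoffel F L i b"
  shows "C1_on (prod_scale (mscale (base F)) (prod_scale (fscale F) (mscale (base F)))) (fscale F)
    (img (base F) i \<times> UNIV) (\<lambda>(x, w, v). b x w v)"
  using b unfolding christoffel_def Let_def UNIV_Times_UNIV
  by (elim conjE) (intro C2_on_imp_C1_on smooth_on_imp_C2_on topological_module_prod
      C1_vector_bundleD(3)[OF F] C1_vector_bundleD(10)[OF F], assumption)

lemma christoffel_slice_C1:
  assumes F: "C1_vector_bundle F" and i: "i \<in> charts (base F)" and b: "christoffel F L i b"
  shows "C1_on (mscale (base F)) (fscale F) (img (base F) i) (\<lambda>y. b y w v)"
    and "x \<in> img (base F) i \<Longrightarrow>
      diffl (mscale (base F)) (fscale F) (img (base F) i) (\<lambda>y. b y w v) x u =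
      diffl (prod_scale (mscale (base F)) (prod_scale (fscale F) (mscale (base F)))) (fscale F)
        (img (base F) i \<times> UNIV) (\<lambda>(x, w, v). b x w v) (x, w, v) (u, 0, 0)"
proof -
  note sV = C1_vector_bundleD(10)[OF F] and sW = C1_vector_bundleD(3)[OF F]
  note B = christoffel_C1[OF F b] and U = C1_manifoldD(3)[OF C1_vector_bundleD(1)[OF F] i]
  let ?sV = "mscale (base F)" and ?sW = "fscale F"
  let ?s = "prod_scale ?sV (prod_scale ?sW ?sV)"
  have s: "topological_module ?s" by (intro topological_module_prod sV sW)
  have dq: "is_dq ?sV ?s (img (base F) i) (\<lambda>y. (y, w, v)) (\<lambda>(y, u, t). (u, 0, 0))"
    by (auto simp: is_dq_def prod_scale_def zero_prod_def split_beta' topological_moduleD[OF sV] topological_moduleD[OF sW]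
        intro!: continuous_on_Pair continuous_on_fst continuous_on_snd continuous_on_id continuous_on_const)
  then have "C1_on ?sV ?s (img (base F) i) (\<lambda>y. (y, w, v))"
    using s sV U by (auto simp: C1_on_def)
  from C1_on_compose(1)[OF this B]
  show slice: "C1_on ?sV ?sW (img (base F) i) (\<lambda>y. b y w v)" by (auto simp: comp_def)
  show "diffl ?sV ?sW (img (base F) i) (\<lambda>y. b y w v) x u =
      diffl ?s ?sW (img (base F) i \<times> UNIV) (\<lambda>(x, w, v). b x w v) (x, w, v) (u, 0, 0)"
    if x: "x \<in> img (base F) i"
    by (rule diffl_eq_along_line[OF slice B x _ open_UNIV UNIV_I])
      (auto simp: x prod_scale_def topological_moduleD[OF sV] topological_moduleD[OF sW])
qed

text \<open>The product rule for \<open>b\<^sub>x(w, v)\<close>: the differential is additive, and \<open>b\<close> has constant slope in the directions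
  of its two linear arguments.\<close>

lemma christoffel_derivative:
  assumes F: "C1_vector_bundle F" and i: "i \<in> charts (base F)" and b: "christoffel F L i b"
    and x: "x \<in> img (base F) i"
  shows "diffl (prod_scale (mscale (base F)) (prod_scale (fscale F) (mscale (base F)))) (fscale F)
        (img (base F) i \<times> UNIV) (\<lambda>(x, w, v). b x w v) (x, w, v) (u, w', v') =
      diffl (mscale (base F)) (fscale F) (img (base F) i) (\<lambda>y. b y w v) x u + b x w' v + b x w v'"
proof -
  note sV = C1_vector_bundleD(10)[OF F] and sW = C1_vector_bundleD(3)[OF F]
  note B = christoffel_C1[OF F b]
  let ?sV = "mscale (base F)" and ?sW = "fscale F"
  let ?s = "prod_scale ?sV (prod_scale ?sW ?sV)"
  let ?D = "diffl ?s ?sW (img (base F) i \<times> UNIV) (\<lambda>(x, w, v). b x w v) (x, w, v)"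
  have xwv: "(x, w, v) \<in> img (base F) i \<times> UNIV" using x by simp
  interpret D: module_hom ?s ?sW ?D by (rule diffl_module_hom[OF B xwv])
  interpret b1: module_hom ?sW ?sW "\<lambda>w. b x w v" by (rule christoffelD(1)[OF F b i x])
  interpret b2: module_hom ?sV ?sW "b x w" by (rule christoffelD(2)[OF F b i x])
  have "?D (u, w', v') = ?D (u, 0, 0) + ?D (0, w', 0) + ?D (0, 0, v')"
    using D.add[of "(u, 0, 0)" "(0, w', 0)"] D.add[of "(u, w', 0)" "(0, 0, v')"] by simp
  moreover have "?D (0, w', 0) = b x w' v"
    by (rule diffl_eq_if_constant_slope[OF B xwv])
      (auto simp: prod_scale_def topological_moduleD[OF sV] b1.add b1.scale)
  moreover have "?D (0, 0, v') = b x w v'"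
    by (rule diffl_eq_if_constant_slope[OF B xwv])
      (auto simp: prod_scale_def topological_moduleD[OF sV] topological_moduleD[OF sW] b2.add b2.scale)
  ultimately show ?thesis using christoffel_slice_C1(2)[OF F i b x] by simp
qed

text \<open>A linear map is its own differential. This is applied to the projections of \<open>F \<oplus> TM \<oplus> F\<close>.\<close>

lemma tangent_map_linear_chart:
  assumes A: "C1_manifold A" and B: "C1_manifold B" and charts: "charts A = charts B"
    and dom: "\<And>i. i \<in> charts A \<Longrightarrow> f ` cdom A i \<subseteq> cdom B i"
    and p: "module_hom (mscale A) (mscale B) p" "continuous_on UNIV p"
    and loc: "\<And>i x. i \<in> charts A \<Longrightarrow> x \<in> img A i \<Longrightarrow> loc_map A B f i i x = p x"
    and i: "i \<in> charts A" and x: "x \<in> img A i"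
  shows "tangent_map A B f (tangent_vec A i (x, v)) = tangent_vec B i (p x, p v)"
proof -
  have C1: "C1_on (mscale A) (mscale B) (img A i) (loc_map A B f i i)" if "i \<in> charts A" for i
    by (rule C1_on_cong[OF C1_on_linear(1)[OF C1_manifoldD(1)[OF A] C1_manifoldD(1)[OF B] C1_manifoldD(3)[OF A that] p]])
      (simp add: loc that)
  have f: "C1_map A B f" by (rule C1_mapI[OF A B charts dom C1])
  note ld = loc_dom_self[OF dom[OF i]]
  interpret p: module_hom "mscale A" "mscale B" p by (rule p)
  have "diffl (mscale A) (mscale B) (img A i) (loc_map A B f i i) x v = p v"
    by (rule diffl_eq_if_constant_slope[OF C1[OF i] x]) (simp add: loc i x p.add p.scale)
  then have "tangent_loc A B f i i (x, v) = (p x, p v)"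
    by (simp add: tangent_loc_def ld loc i x)
  then show ?thesis
    using tangent_map_tangent_vec[OF A B f i, of i "(x, v)"] i x by (simp add: ld charts)
qed


section \<open>The derived connection in a chart\<close>

text \<open>Chart coordinates on \<open>A\<^sup>2F\<close>, listed by the degree of their axes.\<close>

definition axes_pt where
  "axes_pt F i x w0 v1 v2 w01 w02 v12 w012 =
     \<lparr>ax0 = pt_of (tot F) i (x, w0), ax1 = tangent_vec (base F) i (x, v1), ax2 = tangent_vec (base F) i (x, v2),
      ax01 = pt_of (tot F) i (x, w01), ax02 = pt_of (tot F) i (x, w02), ax12 = tangent_vec (base F) i (x, v12),
      ax012 = pt_of (tot F) i (x, w012)\<rparr>"

text \<open>Chart coordinates on \<open>T\<^sup>2F\<close>, listed in the order of the iterated tangent chart: first a point of \<open>TF\<close>, then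
  its \<open>\<epsilon>\<^sub>2\<close>-direction.\<close>

definition second_pt where
  "second_pt F i x w0 v1 w01 v2 w02 v12 w012 =
     tangent_vec (tangent (tot F)) i (((x, w0), (v1, w01)), ((v2, w02), (v12, w012)))"

context
  fixes F :: "('k::dense_unit_ring, 'i, 'm, 'p, 'v::{topological_ab_group_add, t2_space},
      'w::{topological_ab_group_add, t2_space}) vbundle"
  assumes VB: "vector_bundle F"
begin

lemma vector_bundleD:
  shows "C1_vector_bundle F" "C2_manifold (base F)" "C2_manifold (tot F)"
    and "C1_vector_bundle (tangent_bundle (base F))"
    and "C1_manifold (base F)" "C1_manifold (tot F)"
    and "C1_manifold (tangent (base F))" "C1_manifold (tangent (tot F))" "C1_manifold (split_bundle F)"
    and "charts (tot F) = charts (base F)"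
proof -
  show 1: "C1_vector_bundle F" by (rule vector_bundle_imp_C1[OF VB])
  show M2: "C2_manifold (base F)" and T2: "C2_manifold (tot F)"
    using VB by (simp_all add: vector_bundle_def smooth_manifold_imp_C2)
  show TM: "C1_vector_bundle (tangent_bundle (base F))" by (rule C1_vector_bundle_tangent[OF M2])
  show "C1_manifold (base F)" "C1_manifold (tot F)"
    "C1_manifold (tangent (base F))" "C1_manifold (tangent (tot F))" "C1_manifold (split_bundle F)"
    by (intro C2_manifold_imp_C1 C1_manifold_tangent M2 T2 C1_manifold_split 1 TM)+
  show "charts (tot F) = charts (base F)" by (rule C1_vector_bundleD(5)[OF 1])
qed

lemma tangent_map_split_projections:
  assumes i: "i \<in> charts (base F)" and x: "x \<in> img (base F) i"
  shows "tangent_map (split_bundle F) (tot F) fst (tangent_vec (split_bundle F) i ((x, w, v, w'), (u, w1, v1, w1'))) =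
      tangent_vec (tot F) i ((x, w), (u, w1))" (is ?T1)
    and "tangent_map (split_bundle F) (tangent (base F)) (fst \<circ> snd)
        (tangent_vec (split_bundle F) i ((x, w, v, w'), (u, w1, v1, w1'))) =
      tangent_vec (tangent (base F)) i ((x, v), (u, v1))" (is ?T2)
    and "tangent_map (split_bundle F) (tot F) (snd \<circ> snd)
        (tangent_vec (split_bundle F) i ((x, w, v, w'), (u, w1, v1, w1'))) =
      tangent_vec (tot F) i ((x, w'), (u, w1'))" (is ?T3)
proof -
  note D = vector_bundleD
  note sV = C1_vector_bundleD(10)[OF D(1)] and sW = C1_vector_bundleD(3)[OF D(1)]
  let ?sV = "mscale (base F)" and ?sW = "fscale F"
  let ?s = "prod_scale ?sV (prod_scale ?sW (prod_scale ?sV ?sW))"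
  have lin: "module_hom ?s (prod_scale ?sV ?sW) (\<lambda>(x, w, v, w'). (x, w))"
    "module_hom ?s (prod_scale ?sV ?sV) (\<lambda>(x, w, v, w'). (x, v))"
    "module_hom ?s (prod_scale ?sV ?sW) (\<lambda>(x, w, v, w'). (x, w'))"
    by (rule module_homI, intro topological_module_prod sV sW, intro topological_module_prod sV sW,
        (auto simp: prod_scale_def)[2])+
  have cont: "continuous_on UNIV (\<lambda>(x, w, v, w'). (x, w) :: 'v \<times> 'w)"
    "continuous_on UNIV (\<lambda>(x, w, v, w'). (x, v) :: 'v \<times> 'v)"
    "continuous_on UNIV (\<lambda>(x, w, v, w'). (x, w') :: 'v \<times> 'w)"
    unfolding split_beta' by (intro continuous_on_Pair continuous_on_fst continuous_on_snd continuous_on_id)+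
  have xs: "(x, w, v, w') \<in> img (split_bundle F) i" using x by (simp add: img_split[OF D(1,4) i])
  have loc: "loc_map (split_bundle F) (tot F) fst k k y = (\<lambda>(x, w, v, w'). (x, w)) y"
    "loc_map (split_bundle F) (tangent (base F)) (fst \<circ> snd) k k y = (\<lambda>(x, w, v, w'). (x, v)) y"
    "loc_map (split_bundle F) (tot F) (snd \<circ> snd) k k y = (\<lambda>(x, w, v, w'). (x, w')) y"
    if k: "k \<in> charts (base F)" and y: "y \<in> img (split_bundle F) k" for k y
  proof -
    obtain x w v w' where y_eq: "y = (x, w, v, w')" by (cases y)
    have x: "x \<in> img (base F) k" using y by (simp add: y_eq img_split[OF D(1,4) k])
    show "loc_map (split_bundle F) (tot F) fst k k y = (\<lambda>(x, w, v, w'). (x, w)) y"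
      "loc_map (split_bundle F) (tangent (base F)) (fst \<circ> snd) k k y = (\<lambda>(x, w, v, w'). (x, v)) y"
      "loc_map (split_bundle F) (tot F) (snd \<circ> snd) k k y = (\<lambda>(x, w, v, w'). (x, w')) y"
      using x by (simp_all add: loc_map_def y_eq pt_of_split[OF D(1,4) k] split_pt_def
          pt_of_tot(2)[OF D(1) k] cmap_tangent_vec_self[OF D(5) k])
  qed
  have dom: "fst ` cdom (split_bundle F) k \<subseteq> cdom (tot F) k"
    "(fst \<circ> snd) ` cdom (split_bundle F) k \<subseteq> cdom (tangent (base F)) k"
    "(snd \<circ> snd) ` cdom (split_bundle F) k \<subseteq> cdom (tot F) k" for k
    by (auto simp: split_bundle_def)
  have ms: "mscale (split_bundle F) = ?s" "mscale (tot F) = prod_scale ?sV ?sW"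
    by (simp_all add: mscale_split C1_vector_bundleD(4)[OF D(1)])
  show ?T1
    using tangent_map_linear_chart[OF D(9,6) _ dom(1) _ cont(1) _ _ xs, of "(u, w1, v1, w1')"] lin(1) loc(1) i
    by (simp add: ms D(10))
  show ?T2
    using tangent_map_linear_chart[OF D(9,7) _ dom(2) _ cont(2) _ _ xs, of "(u, w1, v1, w1')"] lin(2) loc(2) i
    by (simp add: ms)
  show ?T3
    using tangent_map_linear_chart[OF D(9,6) _ dom(3) _ cont(3) _ _ xs, of "(u, w1, v1, w1')"] lin(3) loc(3) i
    by (simp add: ms D(10))
qed

text \<open>The three tangent maps are coordinate projections, and together they recover all coordinates. A second
  candidate is first moved to the chart \<open>i\<close>, which is possible since its image under the first
  projection lies over that chart.\<close>

lemma tangent_split_eq: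
  assumes i: "i \<in> charts (base F)" and x: "x \<in> img (base F) i"
  shows "tangent_split F (tangent_vec (tot F) i ((x, w), (u, w1)))
      (tangent_vec (tangent (base F)) i ((x, v), (u, v1))) (tangent_vec (tot F) i ((x, w'), (u, w1'))) =
    tangent_vec (split_bundle F) i ((x, w, v, w'), (u, w1, v1, w1'))" (is "_ = ?z")
  unfolding tangent_split_def
proof (rule the_equality)
  note D = vector_bundleD
  have "?z \<in> points (tangent (split_bundle F))"
    by (rule tangent_vec_in_points) (simp_all add: i x img_split[OF D(1,4) i])
  then show "?z \<in> points (tangent (split_bundle F)) \<and>
        tangent_map (split_bundle F) (tot F) fst ?z = tangent_vec (tot F) i ((x, w), (u, w1)) \<and>
        tangent_map (split_bundle F) (tangent (base F)) (fst \<circ> snd) ?z = tangent_vec (tangent (base F)) i ((x, v), (u, v1)) \<and>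
        tangent_map (split_bundle F) (tot F) (snd \<circ> snd) ?z = tangent_vec (tot F) i ((x, w'), (u, w1'))"
    by (simp add: tangent_map_split_projections[OF i x])
next
  note D = vector_bundleD
  have i': "i \<in> charts (tot F)" "i \<in> charts (tangent (base F))" "i \<in> charts (split_bundle F)"
    using i by (simp_all add: D(10))
  fix z assume z: "z \<in> points (tangent (split_bundle F)) \<and>
        tangent_map (split_bundle F) (tot F) fst z = tangent_vec (tot F) i ((x, w), (u, w1)) \<and>
        tangent_map (split_bundle F) (tangent (base F)) (fst \<circ> snd) z = tangent_vec (tangent (base F)) i ((x, v), (u, v1)) \<and>
        tangent_map (split_bundle F) (tot F) (snd \<circ> snd) z = tangent_vec (tot F) i ((x, w'), (u, w1'))"
  from z obtain k y where k: "k \<in> charts (split_bundle F)" and y: "fst y \<in> img (split_bundle F) k"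
    and zy: "z = tangent_vec (split_bundle F) k y" by (auto elim: points_tangentE)
  have k': "k \<in> charts (base F)" "k \<in> charts (tot F)" using k by (simp_all add: D(10))
  obtain x2 w2 v2 w2' u3 w3 v3 w3' where y_eq: "y = ((x2, w2, v2, w2'), (u3, w3, v3, w3'))"
    by (metis surj_pair)
  have x2: "x2 \<in> img (base F) k" using y by (simp add: y_eq img_split[OF D(1,4) k'(1)])
  have "tangent_vec (tot F) k ((x2, w2), (u3, w3)) = tangent_vec (tot F) i ((x, w), (u, w1))"
    using z by (simp add: zy y_eq tangent_map_split_projections[OF k'(1) x2])
  then have "(i, ((x, w), (u, w1))) \<in> tangent_vec (tot F) k ((x2, w2), (u3, w3))"
    using tangent_vec_self[OF D(6) i'(1), of "((x, w), (u, w1))"] x by (simp add: C1_vector_bundleD(7)[OF D(1) i])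
  then have "x2 \<in> loc_dom (base F) (base F) id k i"
    by (simp add: tangent_vec_iff loc_dom_tot[OF D(1) k'(1) i])
  then have y_dom: "fst y \<in> loc_dom (split_bundle F) (split_bundle F) id k i"
    by (simp add: y_eq loc_dom_split[OF D(1,4) k'(1) i])
  define y' where "y' = tangent_loc (split_bundle F) (split_bundle F) id k i y"
  have zy': "z = tangent_vec (split_bundle F) i y'"
    unfolding zy y'_def by (rule tangent_vec_change_chart[OF D(9) k i'(3) y_dom, symmetric])
  have y'_img: "fst y' \<in> img (split_bundle F) i"
    unfolding y'_def using loc_map_id_in_loc_dom(2)[OF D(9) i'(3) y_dom] by simp
  obtain x4 w4 v4 w4' u5 w5 v5 w5' where y'_eq: "y' = ((x4, w4, v4, w4'), (u5, w5, v5, w5'))"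
    by (metis surj_pair)
  have x4: "x4 \<in> img (base F) i" using y'_img by (simp add: y'_eq img_split[OF D(1,4) i])
  have 1: "tangent_vec (tot F) i ((x4, w4), (u5, w5)) = tangent_vec (tot F) i ((x, w), (u, w1))"
    and 2: "tangent_vec (tangent (base F)) i ((x4, v4), (u5, v5)) = tangent_vec (tangent (base F)) i ((x, v), (u, v1))"
    and 3: "tangent_vec (tot F) i ((x4, w4'), (u5, w5')) = tangent_vec (tot F) i ((x, w'), (u, w1'))"
    using z by (simp_all add: zy' y'_eq tangent_map_split_projections[OF i x4])
  have "y' = ((x, w, v, w'), (u, w1, v1, w1'))"
    using tangent_vec_inject[OF D(6) i'(1) _ _ 1] tangent_vec_inject[OF D(7) i'(2) _ _ 2]
      tangent_vec_inject[OF D(6) i'(1) _ _ 3] x x4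
    by (simp add: y'_eq C1_vector_bundleD(7)[OF D(1) i] img_tangent[OF D(5) i])
  then show "z = ?z" by (simp add: zy')
qed

lemma splitting_loc_map:
  assumes i: "i \<in> charts (base F)" and b: "christoffel F L i b" and x: "x \<in> img (base F) i"
  shows "loc_map (split_bundle F) (tangent (tot F)) (splitting F L) i i (x, w, v, w') = ((x, w), (v, w' + b x w v))"
  using x cmap_tangent_vec_self[OF vector_bundleD(6), of i "((x, w), (v, w' + b x w v))"] i
  by (simp add: loc_map_def pt_of_split[OF vector_bundleD(1,4) i x]
      splitting_split_pt[OF vector_bundleD(1,4) i x b] vector_bundleD(10) C1_vector_bundleD(7)[OF vector_bundleD(1) i])

text \<open>\<open>\<Phi>\<^sub>1\<close> is linear in its coordinates except for the summand \<open>b\<^sub>x(w, v)\<close>. It is therefore built from coordinate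
  projections and \<open>b\<close> by pairing and addition, and its differential is computed along this construction.\<close>

lemma splitting_chart_C1:
  assumes i: "i \<in> charts (base F)" and b: "christoffel F L i b"
  shows "C1_on (mscale (split_bundle F)) (mscale (tangent (tot F))) (img (split_bundle F) i)
      (loc_map (split_bundle F) (tangent (tot F)) (splitting F L) i i)"
    and "x \<in> img (base F) i \<Longrightarrow>
      diffl (mscale (split_bundle F)) (mscale (tangent (tot F))) (img (split_bundle F) i)
      (loc_map (split_bundle F) (tangent (tot F)) (splitting F L) i i) (x, w, v, w') (u, w1, v1, w1') =
      ((u, w1), (v1, w1' + (diffl (mscale (base F)) (fscale F) (img (base F) i) (\<lambda>y. b y w v) x u + b x w1 v + b x w v1)))"
proof -
  note D = vector_bundleD
  note sV = C1_vector_bundleD(10)[OF D(1)] and sW = C1_vector_bundleD(3)[OF D(1)]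
  note B = christoffel_C1[OF D(1) b]
  let ?sV = "mscale (base F)" and ?sW = "fscale F"
  let ?s = "prod_scale ?sV (prod_scale ?sW (prod_scale ?sV ?sW))"
  let ?s3 = "prod_scale ?sV (prod_scale ?sW ?sV)"
  let ?U = "img (base F) i"
  let ?S = "loc_map (split_bundle F) (tangent (tot F)) (splitting F L) i i"
  have s: "topological_module ?s" by (intro topological_module_prod sV sW)
  have U4: "open (?U \<times> (UNIV :: ('w \<times> 'v \<times> 'w) set))"
    by (intro open_Times open_UNIV C1_manifoldD(3)[OF D(5) i])
  let ?lin = "\<lambda>(x, w, v, w'). ((x, w), v)"
  let ?b = "\<lambda>z. (\<lambda>(x, w, v). b x w v) ((\<lambda>(x, w, v, w' :: 'w). (x, w, v)) z)"
  let ?w' = "\<lambda>(x :: 'v, w :: 'w, v :: 'v, w'). w' :: 'w"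
  have lin: "module_hom ?s (prod_scale (prod_scale ?sV ?sW) ?sV) ?lin"
    "module_hom ?s ?s3 (\<lambda>(x, w, v, w'). (x, w, v))" "module_hom ?s ?sW ?w'"
    "module_hom (prod_scale ?sW ?sW) ?sW (\<lambda>z. fst z + snd z)"
    by (rule module_homI, intro topological_module_prod sV sW, intro topological_module_prod sV sW,
        (auto simp: prod_scale_def algebra_simps topological_moduleD[OF sW])[2])+
  have cont: "continuous_on UNIV (\<lambda>(x, w, v, w' :: 'w). ((x, w), v) :: ('v \<times> 'w) \<times> 'v)"
    "continuous_on UNIV (\<lambda>(x, w, v, w' :: 'w). (x, w, v) :: 'v \<times> 'w \<times> 'v)"
    "continuous_on UNIV ?w'"
    "continuous_on UNIV (\<lambda>z. fst z + snd z :: 'w)"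
    unfolding split_beta' by (intro continuous_on_Pair continuous_on_fst continuous_on_snd continuous_on_id continuous_on_add)+
  note 1 = C1_on_linear[OF s topological_module_prod[OF topological_module_prod[OF sV sW] sV] U4 lin(1) cont(1)]
  have sub: "(\<lambda>(x, w, v, w' :: 'w). (x, w, v)) ` (?U \<times> UNIV) \<subseteq> ?U \<times> UNIV" by auto
  note 2 = C1_on_linear_precompose[OF B s lin(2) cont(2) U4 sub]
  note 3 = C1_on_linear[OF s sW U4 lin(3) cont(3)]
  note 4 = C1_on_linear_postcompose[OF C1_on_Pair(1)[OF 3(1) 2(1)] sW lin(4) cont(4)]
  note 5 = C1_on_Pair[OF 1(1) 4(1)]
  \<comment> \<open>the value is first formed as \<open>(((x, w), v), w' + b\<^sub>x(w, v))\<close>, which has to be bracketed differently\<close>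
  have r: "module_hom (prod_scale (prod_scale (prod_scale ?sV ?sW) ?sV) ?sW) (prod_scale (prod_scale ?sV ?sW) (prod_scale ?sV ?sW))
      (\<lambda>z. (fst (fst z), snd (fst z), snd z))"
    by (rule module_homI) (auto intro!: topological_module_prod sV sW simp: prod_scale_def)
  have rc: "continuous_on UNIV (\<lambda>z :: (('v \<times> 'w) \<times> 'v) \<times> 'w. (fst (fst z), snd (fst z), snd z))"
    by (intro continuous_on_Pair continuous_on_fst continuous_on_snd continuous_on_id)
  note 6 = C1_on_linear_postcompose[OF 5(1) _ r rc, OF topological_module_prod[OF topological_module_prod[OF sV sW] topological_module_prod[OF sV sW]]]
  have ms: "mscale (split_bundle F) = ?s" "mscale (tangent (tot F)) = prod_scale (prod_scale ?sV ?sW) (prod_scale ?sV ?sW)"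
    by (simp_all add: mscale_split C1_vector_bundleD(4)[OF D(1)])
  show S: "C1_on (mscale (split_bundle F)) (mscale (tangent (tot F))) (img (split_bundle F) i) ?S"
    unfolding ms img_split[OF D(1,4) i]
    by (rule C1_on_cong[OF 6(1)]) (auto simp: splitting_loc_map[OF i b])
  assume x: "x \<in> ?U"
  have x4: "(x, w, v, w') \<in> ?U \<times> UNIV" using x by simp
  have "diffl (mscale (split_bundle F)) (mscale (tangent (tot F))) (img (split_bundle F) i) ?S (x, w, v, w') (u, w1, v1, w1') =
      diffl ?s (prod_scale (prod_scale ?sV ?sW) (prod_scale ?sV ?sW)) (?U \<times> UNIV)
       (\<lambda>z. (fst (fst (?lin z, fst (?w' z, ?b z) + snd (?w' z, ?b z))), snd (fst (?lin z, fst (?w' z, ?b z) + snd (?w' z, ?b z))),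
          snd (?lin z, fst (?w' z, ?b z) + snd (?w' z, ?b z)))) (x, w, v, w') (u, w1, v1, w1')"
    unfolding ms img_split[OF D(1,4) i]
    by (rule diffl_local[OF S[unfolded ms img_split[OF D(1,4) i]] 6(1) U4 x4 order_refl order_refl])
      (auto simp: splitting_loc_map[OF i b])
  also have "\<dots> = ((u, w1), (v1, w1' + (diffl (mscale (base F)) (fscale F) (img (base F) i) (\<lambda>y. b y w v) x u + b x w1 v + b x w v1)))"
    unfolding 6(2)[OF x4] 5(2)[OF x4] 4(2)[OF x4] C1_on_Pair(2)[OF 3(1) 2(1) x4] 2(2)[OF x4]
      1(2)[OF x4] 3(2)[OF x4]
    by (simp add: christoffel_derivative[OF D(1) i b x])
  finally show "diffl (mscale (split_bundle F)) (mscale (tangent (tot F))) (img (split_bundle F) i) ?S (x, w, v, w') (u, w1, v1, w1') =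
      ((u, w1), (v1, w1' + (diffl (mscale (base F)) (fscale F) (img (base F) i) (\<lambda>y. b y w v) x u + b x w1 v + b x w v1)))" .
qed

lemma splitting_C1_map:
  assumes L: "linear_connection F L"
  shows "C1_map (split_bundle F) (tangent (tot F)) (splitting F L)"
proof (rule C1_mapI)
  note D = vector_bundleD
  show "C1_manifold (split_bundle F)" "C1_manifold (tangent (tot F))" by (fact D)+
  show "charts (split_bundle F) = charts (tangent (tot F))" by (simp add: D(10))
  fix i assume "i \<in> charts (split_bundle F)"
  then have i: "i \<in> charts (base F)" by simp
  obtain b where b: "christoffel F L i b" using L i by (auto simp: linear_connection_def)
  show "C1_on (mscale (split_bundle F)) (mscale (tangent (tot F))) (img (split_bundle F) i)
      (loc_map (split_bundle F) (tangent (tot F)) (splitting F L) i i)"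
    by (rule splitting_chart_C1(1)[OF i b])
  show "splitting F L ` cdom (split_bundle F) i \<subseteq> cdom (tangent (tot F)) i"
  proof (rule image_subsetI)
    fix z assume "z \<in> cdom (split_bundle F) i"
    with cdom_splitE[OF D(1,4) i this] obtain x w v w' where x: "x \<in> img (base F) i"
      and z: "z = split_pt F i (x, w, v, w')" by metis
    show "splitting F L z \<in> cdom (tangent (tot F)) i"
      unfolding z splitting_split_pt[OF D(1,4) i x b]
      by (rule tangent_vec_in_cdom_self) (simp add: x C1_vector_bundleD(7)[OF D(1) i])
  qed
qed

text \<open>The splittings of the three components of \<open>F \<oplus> TM \<oplus> F\<close> give the coordinates at
  which the tangent map of \<open>\<Phi>\<^sub>1\<close> is evaluated; the product rule for \<open>b\<close> then produces the last three summands.\<close>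

lemma derived_splitting_axes_pt:
  assumes L: "linear_connection F L" and i: "i \<in> charts (base F)" and x: "x \<in> img (base F) i"
    and b: "christoffel F L i b" and c: "christoffel (tangent_bundle (base F)) L' i c"
  shows "derived_splitting F L L' (axes_pt F i x w0 v1 v2 w01 w02 v12 w012) =
    second_pt F i x w0 v1 (w01 + b x w0 v1) v2 (w02 + b x w0 v2) (v12 + c x v1 v2)
      (w012 + b x w01 v2 + (diffl (mscale (base F)) (fscale F) (img (base F) i) (\<lambda>y. b y w0 v1) x v2
        + b x (w02 + b x w0 v2) v1 + b x w0 (v12 + c x v1 v2)))"
proof -
  note D = vector_bundleD
  have i': "i \<in> charts (split_bundle F)" "i \<in> charts (tangent (tot F))"
    using i by (simp_all add: D(10))
  have s1: "splitting F L (pt_of (tot F) i (x, w), tangent_vec (base F) i (x, v), pt_of (tot F) i (x, w')) =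
      tangent_vec (tot F) i ((x, w), (v, w' + b x w v))" for w v w'
    using splitting_split_pt[OF D(1,4) i x b] by (simp add: split_pt_def)
  have s2: "splitting (tangent_bundle (base F)) L' (tangent_vec (base F) i (x, u), tangent_vec (base F) i (x, v), tangent_vec (base F) i (x, u')) =
      tangent_vec (tangent (base F)) i ((x, u), (v, u' + c x u v))" for u v u'
    using splitting_split_pt[OF D(4) _ _ _ c, of x u v u'] D(4) i x
    by (simp add: split_pt_def pt_of_tangent[OF D(5) i])
  let ?z = "((x, w0, v1, w01), (v2, w02 + b x w0 v2, v12 + c x v1 v2, w012 + b x w01 v2))"
  have dom: "loc_dom (split_bundle F) (tangent (tot F)) (splitting F L) i i = img (split_bundle F) i"
    by (auto simp: loc_dom_def img_split[OF D(1,4) i] pt_of_split[OF D(1,4) i]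
          splitting_split_pt[OF D(1,4) i _ b] tangent_vec_in_cdom_self C1_vector_bundleD(7)[OF D(1) i])
  have "derived_splitting F L L' (axes_pt F i x w0 v1 v2 w01 w02 v12 w012) =
      tangent_map (split_bundle F) (tangent (tot F)) (splitting F L) (tangent_vec (split_bundle F) i ?z)"
    by (simp add: derived_splitting_def axes_pt_def s1 s2 tangent_split_eq[OF i x])
  also have "\<dots> = tangent_vec (tangent (tot F)) i
      (tangent_loc (split_bundle F) (tangent (tot F)) (splitting F L) i i ?z)"
  proof (rule tangent_map_tangent_vec[OF D(9,8) splitting_C1_map[OF L] i'])
    show "fst ?z \<in> loc_dom (split_bundle F) (tangent (tot F)) (splitting F L) i i"
      using x by (simp add: dom img_split[OF D(1,4) i])
  qed
  also have "tangent_loc (split_bundle F) (tangent (tot F)) (splitting F L) i i ?z =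
      (((x, w0), (v1, w01 + b x w0 v1)), ((v2, w02 + b x w0 v2), (v12 + c x v1 v2,
        w012 + b x w01 v2 + (diffl (mscale (base F)) (fscale F) (img (base F) i) (\<lambda>y. b y w0 v1) x v2
        + b x (w02 + b x w0 v2) v1 + b x w0 (v12 + c x v1 v2)))))"
    using splitting_chart_C1(2)[OF i b x]
    by (simp add: tangent_loc_def dom splitting_loc_map[OF i b x])
  finally show ?thesis by (simp add: second_pt_def)
qed

end

section \<open>The flip\<close>

text \<open>In the transition map \<open>(x, v\<^sub>1, v\<^sub>2, v\<^sub>1\<^sub>2) \<mapsto> (\<phi>(x), d\<phi>(x)v\<^sub>1, d\<phi>(x)v\<^sub>2, d\<^sup>2\<phi>(x)(v\<^sub>1, v\<^sub>2) + d\<phi>(x)v\<^sub>1\<^sub>2)\<close> the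
  second derivative is symmetric.\<close>

lemma tangent_tangent_loc_flip:
  assumes A2: "C2_manifold A" and i: "i \<in> charts A" and j: "j \<in> charts A"
    and x: "x \<in> loc_dom A A id i j"
    and y: "tangent_loc (tangent A) (tangent A) id i j ((x, v1), (v2, v12)) = ((y0, y1), (y2, y12))"
  shows "tangent_loc (tangent A) (tangent A) id i j ((x, v2), (v1, v12)) = ((y0, y2), (y1, y12))"
proof -
  note A = C2_manifold_imp_C1[OF A2]
  let ?T = "tangent_bundle A"
  let ?U = "loc_dom A A id i j"
  let ?f = "loc_map A A id i j"
  let ?s = "mscale A"
  have T: "C1_vector_bundle ?T" by (rule C1_vector_bundle_tangent[OF A2])
  have f: "C2_on ?s ?s ?U ?f" using A2 i j by (simp add: C2_manifold_def)
  have trans: "fiber_trans ?T i j y v = diffl ?s ?s ?U ?f y v" if "y \<in> ?U" for y v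
    using that by (simp add: fiber_trans_def loc_map_tangent[OF A i j] tangent_loc_def)
  have deriv: "trans_base_deriv ?T i j x w v =
      diffl (prod_scale ?s ?s) ?s (?U \<times> UNIV) (\<lambda>(x, v). diffl ?s ?s ?U ?f x v) (x, w) (v, 0)" for w v
  proof -
    have 1: "C1_on (prod_scale ?s ?s) ?s (?U \<times> UNIV) (\<lambda>(x, w). fiber_trans ?T i j x w)"
      using fiber_trans_C1(1)[OF T, of i j] i j by simp
    show ?thesis
      unfolding trans_base_deriv_def[OF T] tangent_bundle_sel
      by (rule diffl_local[OF 1 C2_on_tangent[OF f] C1_onD(3)[OF 1] _ order_refl order_refl])
        (auto simp: x trans)
  qed
  have "trans_base_deriv ?T i j x v2 v1 = trans_base_deriv ?T i j x v1 v2"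
    unfolding deriv by (rule second_derivative_symmetric[OF f x])
  then show ?thesis
    using tangent_loc_tot[OF T, of i j x v1 v2 v12] tangent_loc_tot[OF T, of i j x v2 v1 v12] i j x y
    by (simp add: trans[OF x] tangent_loc_def[of A])
qed

text \<open>The flip acts on each representative separately, so it maps an equivalence class to an equivalence class
  only because it commutes with the transition maps of \<open>TTA\<close>.\<close>

lemma flip_tangent_vec:
  assumes A2: "C2_manifold A" and i: "i \<in> charts A"
  shows "flip (tangent_vec (tangent A) i ((x, v1), (v2, v12))) = tangent_vec (tangent A) i ((x, v2), (v1, v12))"
proof -
  note A = C2_manifold_imp_C1[OF A2]
  let ?T = "\<lambda>j. tangent_loc (tangent A) (tangent A) id i j"
  let ?fl = "\<lambda>(j, (x0, x1), (x2, x12)). (j, (x0, x2), (x1, x12))"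
  have flip: "?fl (j, ?T j ((x, v1), (v2, v12))) = (j, ?T j ((x, v2), (v1, v12)))"
    if j: "j \<in> charts A" and x: "x \<in> loc_dom A A id i j" for j
  proof -
    obtain y0 y1 y2 y12 where y: "?T j ((x, v1), (v2, v12)) = ((y0, y1), (y2, y12))" by (metis surj_pair)
    show ?thesis using tangent_tangent_loc_flip[OF A2 i j x y] y by simp
  qed
  have vec: "tangent_vec (tangent A) i ((x, u1), (u2, u12)) =
      (\<lambda>j. (j, ?T j ((x, u1), (u2, u12)))) ` {j \<in> charts A. x \<in> loc_dom A A id i j}" for u1 u2 u12
    unfolding tangent_vec_def charts_tangent by (auto simp: loc_dom_tangent[OF A i])
  show ?thesis
    unfolding flip_def vec image_image by (intro image_cong refl) (elim CollectE conjE, rule flip)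
qed


section \<open>Fibers in charts\<close>

lemma fiber_in_chart:
  assumes G: "C1_vector_bundle G" and i: "i \<in> charts (base G)" and m: "m \<in> cdom (base G) i"
  shows "fiber G m = range (\<lambda>w. pt_of (tot G) i (cmap (base G) i m, w))"
proof (intro set_eqI iffI)
  fix p assume "p \<in> fiber G m"
  then have "p \<in> points (tot G)" "vproj G p = m" by (simp_all add: fiber_def)
  then show "p \<in> range (\<lambda>w. pt_of (tot G) i (cmap (base G) i m, w))"
    using tot_point_in_chart[OF G i, of p] m by (metis rangeI)
next
  fix p assume "p \<in> range (\<lambda>w. pt_of (tot G) i (cmap (base G) i m, w))"
  then obtain w where "p = pt_of (tot G) i (cmap (base G) i m, w)" by auto
  then show "p \<in> fiber G m"
    using pt_of_tot(3,4)[OF G i cmap_in_img[OF m]] pt_of_cmap[OF C1_vector_bundleD(1)[OF G] i m]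
    by (simp add: fiber_def)
qed

lemma pt_of_tot_in_fiber:
  assumes G: "C1_vector_bundle G" and i: "i \<in> charts (base G)" and m: "m \<in> cdom (base G) i"
  shows "pt_of (tot G) i (cmap (base G) i m, w) \<in> fiber G m"
  by (simp add: fiber_in_chart[OF assms])

lemma fiber_zero_in_chart:
  assumes G: "C1_vector_bundle G" and i: "i \<in> charts (base G)" and m: "m \<in> cdom (base G) i"
  shows "fiber_zero G m = pt_of (tot G) i (cmap (base G) i m, 0)"
  unfolding fiber_zero_def
proof (rule the_equality)
  let ?x = "cmap (base G) i m"
  have x: "?x \<in> img (base G) i" by (rule cmap_in_img[OF m])
  have "snd (cmap (tot G) j (pt_of (tot G) i (?x, 0))) = 0" if j: "j \<in> charts (base G)" and mj: "m \<in> cdom (base G) j" for j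
  proof -
    have "?x \<in> loc_dom (base G) (base G) id i j"
      using x mj by (simp add: loc_dom_def pt_of_cmap[OF C1_vector_bundleD(1)[OF G] i m])
    then show ?thesis
      using module_hom.zero[OF C1_vector_bundleD(9)[OF G i j]] by (simp add: fiber_trans_def loc_map_def)
  qed
  then show "pt_of (tot G) i (?x, 0) \<in> fiber G m \<and>
      (\<forall>j\<in>charts (base G). m \<in> cdom (base G) j \<longrightarrow> snd (cmap (tot G) j (pt_of (tot G) i (?x, 0))) = 0)"
    using pt_of_tot_in_fiber[OF G i m] by blast
next
  fix p assume p: "p \<in> fiber G m \<and> (\<forall>i\<in>charts (base G). m \<in> cdom (base G) i \<longrightarrow> snd (cmap (tot G) i p) = 0)"
  then obtain w where "p = pt_of (tot G) i (cmap (base G) i m, w)" using fiber_in_chart[OF G i m] by auto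
  then show "p = pt_of (tot G) i (cmap (base G) i m, 0)"
    using p i m pt_of_tot(2)[OF G i cmap_in_img[OF m], of w] by auto
qed

lemma fiber_add_in_chart:
  assumes G: "C1_vector_bundle G" and i: "i \<in> charts (base G)" and x: "x \<in> img (base G) i"
  shows "fiber_add G (pt_of (tot G) i (x, w)) (pt_of (tot G) i (x, w')) = pt_of (tot G) i (x, w + w')"
  unfolding fiber_add_def pt_of_tot(4)[OF G i x]
proof (rule the_equality)
  let ?m = "pt_of (base G) i x"
  have m: "?m \<in> cdom (base G) i" "cmap (base G) i ?m = x" using x by (simp_all add: pt_of_in_cdom cmap_pt_of)
  have "snd (cmap (tot G) j (pt_of (tot G) i (x, w + w'))) =
      snd (cmap (tot G) j (pt_of (tot G) i (x, w))) + snd (cmap (tot G) j (pt_of (tot G) i (x, w')))"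
    if j: "j \<in> charts (base G)" and mj: "?m \<in> cdom (base G) j" for j
  proof -
    have "x \<in> loc_dom (base G) (base G) id i j" using x mj by (simp add: loc_dom_def)
    then show ?thesis
      using module_hom.add[OF C1_vector_bundleD(9)[OF G i j]] by (simp add: fiber_trans_def loc_map_def)
  qed
  then show "pt_of (tot G) i (x, w + w') \<in> fiber G ?m \<and>
      (\<forall>j\<in>charts (base G). ?m \<in> cdom (base G) j \<longrightarrow> snd (cmap (tot G) j (pt_of (tot G) i (x, w + w'))) =
      snd (cmap (tot G) j (pt_of (tot G) i (x, w))) + snd (cmap (tot G) j (pt_of (tot G) i (x, w'))))"
    using pt_of_tot_in_fiber[OF G i m(1)] m(2) by simp
next
  let ?m = "pt_of (base G) i x"
  have m: "?m \<in> cdom (base G) i" "cmap (base G) i ?m = x" using x by (simp_all add: pt_of_in_cdom cmap_pt_of)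
  fix r assume r: "r \<in> fiber G ?m \<and>
      (\<forall>j\<in>charts (base G). ?m \<in> cdom (base G) j \<longrightarrow> snd (cmap (tot G) j r) =
      snd (cmap (tot G) j (pt_of (tot G) i (x, w))) + snd (cmap (tot G) j (pt_of (tot G) i (x, w'))))"
  then obtain y where "r = pt_of (tot G) i (x, y)" using fiber_in_chart[OF G i m(1)] m(2) by auto
  then show "r = pt_of (tot G) i (x, w + w')"
    using r i m(1) pt_of_tot(2)[OF G i x] by auto
qed


section \<open>The curvature tensor in a chart\<close>

text \<open>Derivatives with respect to \<open>x\<close> inherit linearity in a parameter, since differentiation commutes with sums and
  with scalar multiplication.\<close>

lemma diffl_module_hom_parameter:
  fixes s :: "'k::dense_unit_ring \<Rightarrow> 'e::{topological_ab_group_add, t2_space} \<Rightarrow> 'e"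
    and s' :: "'k \<Rightarrow> 'g::{topological_ab_group_add, t2_space} \<Rightarrow> 'g"
  assumes C1: "\<And>p. C1_on s s' U (\<lambda>y. h y p)" and hom: "\<And>y. y \<in> U \<Longrightarrow> module_hom sp s' (h y)"
    and sp: "module sp" and x: "x \<in> U"
  shows "module_hom sp s' (\<lambda>p. diffl s s' U (\<lambda>y. h y p) x u)"
proof -
  note s' = C1_onD(2)[OF C1] and U = C1_onD(3)[OF C1]
  have lin: "module_hom (prod_scale s' s') s' (\<lambda>z. fst z + snd z)" "module_hom s' s' (s' r)" for r
    by (rule module_homI, intro topological_module_prod s', rule s',
        (auto simp: prod_scale_def algebra_simps topological_moduleD[OF s'])[2])+
  have cont: "continuous_on UNIV (\<lambda>z. fst z + snd z :: 'g)" "continuous_on UNIV (s' r)" for r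
    by (intro continuous_on_add continuous_on_fst continuous_on_snd continuous_on_id
        continuous_on_module_scale[OF s', of _ "\<lambda>_. r" "\<lambda>x. x"] continuous_on_const)+
  have add: "diffl s s' U (\<lambda>y. h y (p + q)) x u = diffl s s' U (\<lambda>y. h y p) x u + diffl s s' U (\<lambda>y. h y q) x u" for p q
  proof -
    note c = C1_on_linear_postcompose[OF C1_on_Pair(1)[OF C1[of p] C1[of q]] s' lin(1) cont(1)]
    have "diffl s s' U (\<lambda>y. h y (p + q)) x u = diffl s s' U (\<lambda>y. fst (h y p, h y q) + snd (h y p, h y q)) x u"
      by (rule diffl_local[OF C1 c(1) U x order_refl order_refl]) (simp add: module_hom.add[OF hom])
    then show ?thesis unfolding c(2)[OF x] by (simp add: C1_on_Pair(2)[OF C1 C1 x])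
  qed
  have scale: "diffl s s' U (\<lambda>y. h y (sp r p)) x u = s' r (diffl s s' U (\<lambda>y. h y p) x u)" for r p
  proof -
    note c = C1_on_linear_postcompose[OF C1[of p] s' lin(2)[of r] cont(2)[of r]]
    have "diffl s s' U (\<lambda>y. h y (sp r p)) x u = diffl s s' U (\<lambda>y. s' r (h y p)) x u"
      by (rule diffl_local[OF C1 c(1) U x order_refl order_refl]) (simp add: module_hom.scale[OF hom])
    then show ?thesis unfolding c(2)[OF x] .
  qed
  show ?thesis
    by (intro module_hom.intro module_hom_axioms.intro sp topological_moduleD(1)[OF s'] add scale)
qed

text \<open>For symmetric \<open>c\<close>, the \<open>\<epsilon>\<^sub>0\<epsilon>\<^sub>1\<epsilon>\<^sub>2\<close>-component of \<open>\<kappa> o \<Phi>\<^sub>2 o \<kappa>\<close> minus that of \<open>\<Phi>\<^sub>2\<close>; it is the negative of the curvature of the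
  covariant derivative \<open>\<nabla>\<^sub>vs = \<partial>\<^sub>vs - b\<^sub>x(s, v)\<close>.\<close>

definition curv where
  "curv F i b x w0 v1 v2 = b x (b x w0 v1) v2 - b x (b x w0 v2) v1
     + diffl (mscale (base F)) (fscale F) (img (base F) i) (\<lambda>y. b y w0 v2) x v1
     - diffl (mscale (base F)) (fscale F) (img (base F) i) (\<lambda>y. b y w0 v1) x v2"

lemma trilinear_curv:
  assumes F: "C1_vector_bundle F" and i: "i \<in> charts (base F)" and b: "christoffel F L i b"
    and x: "x \<in> img (base F) i"
  shows "trilinear_map (fscale F) (mscale (base F)) (mscale (base F)) (fscale F) (curv F i b x)"
proof -
  note sV = C1_vector_bundleD(10)[OF F] and sW = C1_vector_bundleD(3)[OF F]
  let ?sV = "mscale (base F)" and ?sW = "fscale F"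
  let ?d = "\<lambda>w v u. diffl ?sV ?sW (img (base F) i) (\<lambda>y. b y w v) x u"
  have b1: "module_hom ?sW ?sW (\<lambda>w. b x w v)" and b2: "module_hom ?sV ?sW (b x w)" for v w
    by (rule christoffelD[OF F b i x])+
  have d1: "module_hom ?sW ?sW (\<lambda>w. ?d w v u)" for v u
    by (rule diffl_module_hom_parameter[OF christoffel_slice_C1(1)[OF F i b] _ topological_moduleD(1)[OF sW] x])
      (rule christoffelD(1)[OF F b i])
  have d2: "module_hom ?sV ?sW (\<lambda>v. ?d w v u)" for w u
    by (rule diffl_module_hom_parameter[OF christoffel_slice_C1(1)[OF F i b] _ topological_moduleD(1)[OF sV] x])
      (rule christoffelD(2)[OF F b i])
  have d3: "module_hom ?sV ?sW (?d w v)" for w v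
    by (rule diffl_module_hom[OF christoffel_slice_C1(1)[OF F i b] x])
  note add = module_hom.add[OF b1] module_hom.add[OF b2] module_hom.add[OF d1] module_hom.add[OF d2] module_hom.add[OF d3]
  note scale = module_hom.scale[OF b1] module_hom.scale[OF b2] module_hom.scale[OF d1] module_hom.scale[OF d2] module_hom.scale[OF d3]
  show ?thesis
    unfolding trilinear_map_def curv_def
    by (intro conjI allI module_homI sV sW)
      (simp_all add: add scale topological_moduleD(2,8)[OF sW] algebra_simps)
qed

lemma flip_axes_axes_pt:
  "flip_axes (axes_pt F i x w0 v1 v2 w01 w02 v12 w012) = axes_pt F i x w0 v2 v1 w02 w01 v12 w012"
  by (simp add: flip_axes_def axes_pt_def)

lemma flip_axes_flip_axes [simp]: "flip_axes (flip_axes a) = a"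
  by (simp add: flip_axes_def)

context
  fixes F :: "('k::dense_unit_ring, 'i, 'm, 'p, 'v::{topological_ab_group_add, t2_space},
      'w::{topological_ab_group_add, t2_space}) vbundle"
  assumes VB: "vector_bundle F"
begin

lemmas vb_facts = vector_bundleD[OF VB]

lemma tangent_fiber_in_chart:
  assumes i: "i \<in> charts (base F)" and m: "m \<in> cdom (base F) i"
  shows "fiber (tangent_bundle (base F)) m = range (\<lambda>v. tangent_vec (base F) i (cmap (base F) i m, v))"
  using fiber_in_chart[OF vb_facts(4), of i m] i m by (simp add: pt_of_tangent[OF vb_facts(5) i] cmap_in_img)

lemma axes_pt_in_axes_fiber:
  assumes i: "i \<in> charts (base F)" and x: "x \<in> img (base F) i"
  shows "axes_pt F i x w0 v1 v2 w01 w02 v12 w012 \<in> axes_fiber F (pt_of (base F) i x)"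
    and "axes_pt F i x w0 v1 v2 w01 w02 v12 w012 \<in> axes_bundle F"
proof -
  note m = pt_of_in_cdom[OF x]
  show *: "axes_pt F i x w0 v1 v2 w01 w02 v12 w012 \<in> axes_fiber F (pt_of (base F) i x)"
    by (simp add: axes_fiber_def axes_pt_def fiber_in_chart[OF vb_facts(1) i m] tangent_fiber_in_chart[OF i m] cmap_pt_of[OF x])
  show "axes_pt F i x w0 v1 v2 w01 w02 v12 w012 \<in> axes_bundle F"
    unfolding axes_bundle_def using * pt_of_in_points[OF i x] by blast
qed

lemma axes_fiber_in_chart:
  assumes i: "i \<in> charts (base F)" and m: "m \<in> cdom (base F) i" and a: "a \<in> axes_fiber F m"
  obtains w0 v1 v2 w01 w02 v12 w012 where "a = axes_pt F i (cmap (base F) i m) w0 v1 v2 w01 w02 v12 w012"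
proof -
  from a obtain w0 v1 v2 w01 w02 v12 w012 where
    "ax0 a = pt_of (tot F) i (cmap (base F) i m, w0)" "ax1 a = tangent_vec (base F) i (cmap (base F) i m, v1)"
    "ax2 a = tangent_vec (base F) i (cmap (base F) i m, v2)" "ax01 a = pt_of (tot F) i (cmap (base F) i m, w01)"
    "ax02 a = pt_of (tot F) i (cmap (base F) i m, w02)" "ax12 a = tangent_vec (base F) i (cmap (base F) i m, v12)"
    "ax012 a = pt_of (tot F) i (cmap (base F) i m, w012)"
    unfolding axes_fiber_def fiber_in_chart[OF vb_facts(1) i m] tangent_fiber_in_chart[OF i m] by auto
  then have "a = axes_pt F i (cmap (base F) i m) w0 v1 v2 w01 w02 v12 w012"
    by (cases a) (simp add: axes_pt_def)
  then show ?thesis by (rule that)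
qed

lemma second_pt_in_fiber:
  assumes i: "i \<in> charts (base F)" and x: "x \<in> img (base F) i"
  shows "second_pt F i x w0 v1 w01 v2 w02 v12 w012 \<in> second_tangent_fiber F (pt_of (base F) i x)"
proof -
  have i': "i \<in> charts (tot F)" "i \<in> charts (tangent (tot F))" using i by (simp_all add: vb_facts(10))
  have x': "(x, w0) \<in> img (tot F) i" "((x, w0), (v1, w01)) \<in> img (tangent (tot F)) i"
    using x by (simp_all add: C1_vector_bundleD(7)[OF vb_facts(1) i] img_tangent[OF vb_facts(6) i'(1)])
  show ?thesis
    using x' by (simp add: second_tangent_fiber_def second_pt_def second_tangent_def
        tangent_vec_in_points[OF i'(2)] foot_tangent_vec[OF vb_facts(8) i'(2)] pt_of_tangent[OF vb_facts(6) i'(1)]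
        foot_tangent_vec[OF vb_facts(6) i'(1)] pt_of_tot(4)[OF vb_facts(1) i x])
qed

lemma second_tangent_fiber_in_chart:
  assumes i: "i \<in> charts (base F)" and m: "m \<in> cdom (base F) i" and p: "p \<in> second_tangent_fiber F m"
  obtains w0 v1 w01 v2 w02 v12 w012 where "p = second_pt F i (cmap (base F) i m) w0 v1 w01 v2 w02 v12 w012"
proof -
  have i': "i \<in> charts (tot F)" "i \<in> charts (tangent (tot F))" using i by (simp_all add: vb_facts(10))
  have p': "p \<in> points (tangent (tangent (tot F)))" and
    pm: "vproj F (foot (tot F) (foot (tangent (tot F)) p)) = m"
    using p by (simp_all add: second_tangent_fiber_def second_tangent_def)
  note f1 = foot_in_points[OF vb_facts(8) p']
  note f2 = foot_in_points[OF vb_facts(6) f1]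
  have c: "foot (tangent (tot F)) p \<in> cdom (tangent (tot F)) i"
    using f1 f2 m pm by (simp add: cdom_tangent_eq[OF vb_facts(6) i'(1)] C1_vector_bundleD(6)[OF vb_facts(1) i])
  obtain u where u: "p = tangent_vec (tangent (tot F)) i (cmap (tangent (tot F)) i (foot (tangent (tot F)) p), u)"
    using tangent_point_in_chart[OF vb_facts(8) p' i'(2) c] by blast
  obtain x w0 v1 w01 where y: "cmap (tangent (tot F)) i (foot (tangent (tot F)) p) = ((x, w0), (v1, w01))"
    by (metis surj_pair)
  obtain v2 w02 v12 w012 where u_eq: "u = ((v2, w02), (v12, w012))" by (metis surj_pair)
  have p_eq: "p = second_pt F i x w0 v1 w01 v2 w02 v12 w012"
    using u unfolding y u_eq second_pt_def .
  have x: "x \<in> img (base F) i"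
    using cmap_in_img[OF c] by (simp add: y img_tangent[OF vb_facts(6) i'(1)] C1_vector_bundleD(7)[OF vb_facts(1) i])
  have "m = pt_of (base F) i x"
    using second_pt_in_fiber[OF i x, of w0 v1 w01 v2 w02 v12 w012] pm
    by (simp add: p_eq second_tangent_fiber_def)
  then have "cmap (base F) i m = x" by (simp add: cmap_pt_of[OF x])
  then show ?thesis using that p_eq by simp
qed

lemma second_pt_inject:
  assumes i: "i \<in> charts (base F)" and x: "x \<in> img (base F) i"
    and eq: "second_pt F i x w0 v1 w01 v2 w02 v12 w012 = second_pt F i x w0' v1' w01' v2' w02' v12' w012'"
  shows "w0 = w0' \<and> v1 = v1' \<and> w01 = w01' \<and> v2 = v2' \<and> w02 = w02' \<and> v12 = v12' \<and> w012 = w012'"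
proof -
  have i': "i \<in> charts (tot F)" "i \<in> charts (tangent (tot F))" using i by (simp_all add: vb_facts(10))
  show ?thesis
    using tangent_vec_inject[OF vb_facts(8) i'(2) _ _ eq[unfolded second_pt_def]] x
    by (simp add: img_tangent[OF vb_facts(6) i'(1)] C1_vector_bundleD(7)[OF vb_facts(1) i])
qed

lemma flip_second_pt:
  assumes i: "i \<in> charts (base F)"
  shows "flip (second_pt F i x w0 v1 w01 v2 w02 v12 w012) = second_pt F i x w0 v2 w02 v1 w01 v12 w012"
  unfolding second_pt_def by (rule flip_tangent_vec[OF vb_facts(3)]) (simp add: i vb_facts(10))

context
  fixes L :: "('k, 'i, 'v, 'w) connection" and L' :: "('k, 'i, 'v, 'v) connection"
  assumes L: "linear_connection F L" and L': "torsionfree_connection (base F) L'"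
begin

lemma connection_charts:
  assumes i: "i \<in> charts (base F)"
  shows "\<exists>b c. christoffel F L i b \<and> christoffel (tangent_bundle (base F)) L' i c \<and>
    (\<forall>x\<in>img (base F) i. \<forall>u v. c x u v = c x v u)"
proof -
  obtain b where b: "christoffel F L i b" using L i by (auto simp: linear_connection_def)
  obtain c where c: "christoffel (tangent_bundle (base F)) L' i c"
    using L' i by (auto simp: torsionfree_connection_def linear_connection_def)
  have "c x u v = c x v u" if "x \<in> img (base F) i" for x u v
    using L' i c that by (simp add: torsionfree_connection_def)
  with b c show ?thesis by blast
qed

lemma derived_splitting_in_fiber:
  assumes m: "m \<in> points (base F)" and a: "a \<in> axes_fiber F m"
  shows "derived_splitting F L L' a \<in> second_tangent_fiber F m"
proof -
  obtain i where i: "i \<in> charts (base F)" and mi: "m \<in> cdom (base F) i" using m by (auto simp: points_def)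
  from connection_charts[OF i] obtain b c
    where bc: "christoffel F L i b" "christoffel (tangent_bundle (base F)) L' i c" by blast
  from i mi a obtain w0 v1 v2 w01 w02 v12 w012
    where a: "a = axes_pt F i (cmap (base F) i m) w0 v1 v2 w01 w02 v12 w012" by (rule axes_fiber_in_chart)
  note x = cmap_in_img[OF mi]
  show ?thesis
    using second_pt_in_fiber[OF i x] pt_of_cmap[OF vb_facts(5) i mi]
    by (simp add: a derived_splitting_axes_pt[OF VB L i x bc])
qed

text \<open>\<open>\<Phi>\<^sub>2\<close> preserves the point of \<open>M\<close>, and over a chart a triangular map can be inverted one coordinate after the
  other.\<close>

lemma inj_on_derived_splitting: "inj_on (derived_splitting F L L') (axes_bundle F)"
proof (rule inj_onI)
  fix a a' assume "a \<in> axes_bundle F" "a' \<in> axes_bundle F"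
    and eq: "derived_splitting F L L' a = derived_splitting F L L' a'"
  then obtain m m' where m: "m \<in> points (base F)" "a \<in> axes_fiber F m" and m': "m' \<in> points (base F)" "a' \<in> axes_fiber F m'"
    by (auto simp: axes_bundle_def)
  have mm: "m' = m"
    using derived_splitting_in_fiber[OF m] derived_splitting_in_fiber[OF m'] eq
    by (simp add: second_tangent_fiber_def)
  obtain i where i: "i \<in> charts (base F)" and mi: "m \<in> cdom (base F) i" using m(1) by (auto simp: points_def)
  from connection_charts[OF i] obtain b c
    where bc: "christoffel F L i b" "christoffel (tangent_bundle (base F)) L' i c" by blast
  note x = cmap_in_img[OF mi]
  from i mi m(2) obtain w0 v1 v2 w01 w02 v12 w012
    where a: "a = axes_pt F i (cmap (base F) i m) w0 v1 v2 w01 w02 v12 w012" by (rule axes_fiber_in_chart)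
  from i mi m'(2)[unfolded mm] obtain w0' v1' v2' w01' w02' v12' w012'
    where a': "a' = axes_pt F i (cmap (base F) i m) w0' v1' v2' w01' w02' v12' w012'" by (rule axes_fiber_in_chart)
  have "w0 = w0' \<and> v1 = v1' \<and> v2 = v2' \<and> w01 = w01' \<and> w02 = w02' \<and> v12 = v12' \<and> w012 = w012'"
    using second_pt_inject[OF i x eq[unfolded a a' derived_splitting_axes_pt[OF VB L i x bc]]] by auto
  then show "a = a'" by (simp add: a a')
qed

text \<open>After exchanging the indices 1 and 2 the two sides agree on all axes of degree
  at most two; on \<open>\<epsilon>\<^sub>1\<epsilon>\<^sub>2\<close> this is the symmetry of \<open>c\<close>. In the top component everything cancels
  but the terms collected in \<open>curv\<close>.\<close>

lemma derived_splitting_flip_axes_pt: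
  assumes i: "i \<in> charts (base F)" and x: "x \<in> img (base F) i" and b: "christoffel F L i b"
  shows "flip (derived_splitting F L L' (axes_pt F i x w0 v2 v1 w02 w01 v12 w012)) =
    derived_splitting F L L' (axes_pt F i x w0 v1 v2 w01 w02 v12 (w012 + curv F i b x w0 v1 v2))"
proof -
  from connection_charts[OF i] obtain c where c: "christoffel (tangent_bundle (base F)) L' i c"
    and sym: "\<And>x u v. x \<in> img (base F) i \<Longrightarrow> c x u v = c x v u" by blast
  note b1 = module_hom.add[OF christoffelD(1)[OF vb_facts(1) b i x]]
  show ?thesis
    by (simp add: derived_splitting_axes_pt[OF VB L i x b c] flip_second_pt[OF i] sym[OF x, of v2 v1])
      (simp add: curv_def b1 algebra_simps)
qed

lemma inv_into_flip_axes:
  assumes i: "i \<in> charts (base F)" and x: "x \<in> img (base F) i"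
  shows "inv_into (axes_bundle F) flip_axes (axes_pt F i x w0 v1 v2 w01 w02 v12 w012) =
    axes_pt F i x w0 v2 v1 w02 w01 v12 w012"
  by (rule inv_into_f_eq) (auto simp: flip_axes_axes_pt axes_pt_in_axes_fiber[OF i x]
      intro: inj_on_inverseI[of _ flip_axes])

lemma inv_into_derived_splitting:
  assumes i: "i \<in> charts (base F)" and x: "x \<in> img (base F) i"
  shows "inv_into (axes_bundle F) (derived_splitting F L L')
      (derived_splitting F L L' (axes_pt F i x w0 v1 v2 w01 w02 v12 w012)) = axes_pt F i x w0 v1 v2 w01 w02 v12 w012"
  by (rule inv_into_f_f[OF inj_on_derived_splitting axes_pt_in_axes_fiber(2)[OF i x]])

lemma curvature_derived_splitting:
  assumes i: "i \<in> charts (base F)" and x: "x \<in> img (base F) i" and b: "christoffel F L i b"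
  shows "curvature F L L' (derived_splitting F L L' (axes_pt F i x w0 v1 v2 w01 w02 v12 w012)) =
    derived_splitting F L L' (axes_pt F i x w0 v1 v2 w01 w02 v12 (w012 + curv F i b x w0 v1 v2))"
  by (simp add: curvature_def inv_into_derived_splitting[OF i x] inv_into_flip_axes[OF i x]
      derived_splitting_flip_axes_pt[OF i x b])

lemma axes_curvature_axes_pt:
  assumes i: "i \<in> charts (base F)" and x: "x \<in> img (base F) i" and b: "christoffel F L i b"
  shows "axes_curvature F L L' (axes_pt F i x w0 v1 v2 w01 w02 v12 w012) =
    axes_pt F i x w0 v1 v2 w01 w02 v12 (w012 + curv F i b x w0 v1 v2)"
  by (simp add: axes_curvature_def curvature_derived_splitting[OF i x b] inv_into_derived_splitting[OF i x])

text \<open>Every point of the chart is a value of \<open>\<Phi>\<^sub>2\<close>, which is solved for its argument from the lower axes upwards.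
  A translation of the top component passes through \<open>\<Phi>\<^sub>2\<close> unchanged.\<close>

lemma curvature_second_pt:
  assumes i: "i \<in> charts (base F)" and x: "x \<in> img (base F) i" and b: "christoffel F L i b"
  shows "curvature F L L' (second_pt F i x w0 v1 w01 v2 w02 v12 w012) =
    second_pt F i x w0 v1 w01 v2 w02 v12 (w012 + curv F i b x w0 v1 v2)"
proof -
  from connection_charts[OF i] obtain c where c: "christoffel (tangent_bundle (base F)) L' i c" by blast
  define y01 y02 y12 where "y01 = w01 - b x w0 v1" and "y02 = w02 - b x w0 v2" and "y12 = v12 - c x v1 v2"
  \<comment> \<open>the shift of the top component by \<open>\<Phi>\<^sub>2\<close> at this argument\<close>
  define r where "r = b x y01 v2 + (diffl (mscale (base F)) (fscale F) (img (base F) i) (\<lambda>y. b y w0 v1) x v2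
        + b x (y02 + b x w0 v2) v1 + b x w0 (y12 + c x v1 v2))"
  have Phi: "derived_splitting F L L' (axes_pt F i x w0 v1 v2 y01 y02 y12 (y - r)) =
      second_pt F i x w0 v1 w01 v2 w02 v12 y" for y
    by (simp add: derived_splitting_axes_pt[OF VB L i x b c] r_def add.assoc)
      (simp add: y01_def y02_def y12_def)
  show ?thesis
    using curvature_derived_splitting[OF i x b, of w0 v1 v2 y01 y02 y12 "w012 - r"]
      Phi[of w012] Phi[of "w012 + curv F i b x w0 v1 v2"] by (simp add: algebra_simps)
qed

lemma top_component_axes_curvature:
  assumes i: "i \<in> charts (base F)" and m: "m \<in> cdom (base F) i" and b: "christoffel F L i b"
    and x: "x = cmap (base F) i m"
  shows "top_component F (axes_curvature F L L') (tangent_vec (base F) i (x, v1)) (tangent_vec (base F) i (x, v2))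
      (pt_of (tot F) i (x, w0)) = pt_of (tot F) i (x, curv F i b x w0 v1 v2)"
proof -
  have xi: "x \<in> img (base F) i" using m by (simp add: x cmap_in_img)
  have vp: "vproj F (pt_of (tot F) i (x, w0)) = m"
    using pt_of_tot(4)[OF vb_facts(1) i xi] pt_of_cmap[OF vb_facts(5) i m] by (simp add: x)
  have oT: "fiber_zero (tangent_bundle (base F)) m = tangent_vec (base F) i (x, 0)"
    using fiber_zero_in_chart[OF vb_facts(4), of i m] i m pt_of_tangent[OF vb_facts(5) i, of "(x, 0)"] xi by (simp add: x)
  have oF: "fiber_zero F m = pt_of (tot F) i (x, 0)"
    using fiber_zero_in_chart[OF vb_facts(1) i m] by (simp add: x)
  show ?thesis
    using axes_curvature_axes_pt[OF i xi b, of w0 v1 v2 0 0 0 0]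
    by (simp add: top_component_def vp oT oF axes_pt_def)
qed

end

end

theorem theorem18p3:
  fixes F :: "('k::dense_unit_ring, 'i, 'm, 'p, 'v::{topological_ab_group_add, t2_space},
               'w::{topological_ab_group_add, t2_space}) vbundle"
    and L :: "('k, 'i, 'v, 'w) connection"
    and L' :: "('k, 'i, 'v, 'v) connection"
  assumes "vector_bundle F"
    and "linear_connection F L"
    and "torsionfree_connection (base F) L'"
  shows "let TM = tangent_bundle (base F);
             R = curvature F L L';
             Rt = axes_curvature F L L';
             Rtop = top_component F Rt
         in
           (\<forall>L''. torsionfree_connection (base F) L'' \<longrightarrow>
              (\<forall>p\<in>points (second_tangent F). curvature F L L'' p = R p)) \<and>
           (\<forall>m\<in>points (base F). R \<in> Gm23 F m) \<and>
           (\<forall>m\<in>points (base F). \<forall>v1\<in>fiber TM m. \<forall>v2\<in>fiber TM m. \<forall>w0\<in>fiber F m.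
              Rtop v1 v2 w0 \<in> fiber F m) \<and>
           (\<forall>m\<in>points (base F). \<forall>v\<in>axes_fiber F m.
              Rt v = v\<lparr>ax012 := fiber_add F (ax012 v) (Rtop (ax1 v) (ax2 v) (ax0 v))\<rparr>) \<and>
           (\<forall>i\<in>charts (base F). \<forall>b. christoffel F L i b \<longrightarrow>
              (\<forall>m\<in>cdom (base F) i. \<forall>v1\<in>fiber TM m. \<forall>v2\<in>fiber TM m. \<forall>w0\<in>fiber F m.
                 let x = cmap (base F) i m;
                     x1 = snd (cmap (tot TM) i v1);
                     x2 = snd (cmap (tot TM) i v2);
                     y0 = snd (cmap (tot F) i w0);
                     d = (\<lambda>u f. diffl (mscale (base F)) (fscale F) (img (base F) i) f x u)
                 in snd (cmap (tot F) i (Rtop v1 v2 w0)) =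
                    - (b x (b x y0 x2) x1 - b x (b x y0 x1) x2
                       + d x2 (\<lambda>y. b y y0 x1) - d x1 (\<lambda>y. b y y0 x2))))"
proof -
  note VB = assms(1) and L = assms(2) and L' = assms(3)
  note D = vector_bundleD[OF VB]
  let ?TM = "tangent_bundle (base F)"
  let ?R = "curvature F L L'"
  let ?Rt = "axes_curvature F L L'"
  let ?Rtop = "top_component F ?Rt"
  have chart: "\<exists>i b. i \<in> charts (base F) \<and> m \<in> cdom (base F) i \<and> christoffel F L i b"
    if "m \<in> points (base F)" for m
    using that L by (auto simp: points_def linear_connection_def)
  have independent: "curvature F L L'' p = ?R p"
    if L'': "torsionfree_connection (base F) L''" and p: "p \<in> points (second_tangent F)" for L'' p
  proof -
    define m where "m = vproj F (foot (tot F) (foot (tangent (tot F)) p))"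
    have p': "p \<in> second_tangent_fiber F m" using p by (simp add: second_tangent_fiber_def m_def)
    have "m \<in> points (base F)"
      unfolding m_def using p
      by (intro vproj_in_points[OF D(1)] foot_in_points[OF D(6)] foot_in_points[OF D(8)]) (simp add: second_tangent_def)
    then obtain i b where i: "i \<in> charts (base F)" and mi: "m \<in> cdom (base F) i" and b: "christoffel F L i b"
      using chart by blast
    from second_tangent_fiber_in_chart[OF VB i mi p'] obtain w0 v1 w01 v2 w02 v12 w012
      where p_eq: "p = second_pt F i (cmap (base F) i m) w0 v1 w01 v2 w02 v12 w012" .
    show ?thesis
      unfolding p_eq curvature_second_pt[OF VB L L' i cmap_in_img[OF mi] b]
        curvature_second_pt[OF VB L L'' i cmap_in_img[OF mi] b] ..
  qed
  have Gm: "?R \<in> Gm23 F m" if m: "m \<in> points (base F)" for m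
    unfolding Gm23_def
  proof (intro CollectI conjI ballI impI)
    show "?R ` second_tangent_fiber F m \<subseteq> second_tangent_fiber F m"
    proof (rule image_subsetI)
      fix p assume p: "p \<in> second_tangent_fiber F m"
      obtain i b where i: "i \<in> charts (base F)" and mi: "m \<in> cdom (base F) i" and b: "christoffel F L i b"
        using chart[OF m] by blast
      from second_tangent_fiber_in_chart[OF VB i mi p] obtain w0 v1 w01 v2 w02 v12 w012
        where p_eq: "p = second_pt F i (cmap (base F) i m) w0 v1 w01 v2 w02 v12 w012" .
      show "?R p \<in> second_tangent_fiber F m"
        using second_pt_in_fiber[OF VB i cmap_in_img[OF mi]]
        by (simp add: p_eq curvature_second_pt[OF VB L L' i cmap_in_img[OF mi] b] pt_of_cmap[OF D(5) i mi])
    qed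
  next
    fix i assume i: "i \<in> charts (base F)" and mi: "m \<in> cdom (base F) i"
    obtain b where b: "christoffel F L i b" using L i by (auto simp: linear_connection_def)
    let ?x = "cmap (base F) i m"
    note x = cmap_in_img[OF mi]
    have i': "i \<in> charts (tot F)" "i \<in> charts (tangent (tot F))" using i by (simp_all add: D(10))
    have c: "cmap (second_tangent F) i (second_pt F i ?x w0 v1 w01 v2 w02 v12 w012) =
        (((?x, w0), (v1, w01)), ((v2, w02), (v12, w012)))" for w0 v1 w01 v2 w02 v12 w012
      using x by (simp add: second_tangent_def second_pt_def cmap_tangent_vec_self[OF D(8) i'(2)]
          img_tangent[OF D(6) i'(1)] C1_vector_bundleD(7)[OF D(1) i])
    have "cmap (second_tangent F) i (?R p) = (case cmap (second_tangent F) i p of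
        (((x, w0), (v1, w01)), ((v2, w02), (v12, w012))) \<Rightarrow>
          (((x, w0), (v1, w01)), ((v2, w02), (v12, w012 + curv F i b ?x w0 v1 v2))))"
      if p: "p \<in> second_tangent_fiber F m" for p
    proof -
      from second_tangent_fiber_in_chart[OF VB i mi p] obtain w0 v1 w01 v2 w02 v12 w012
        where p_eq: "p = second_pt F i ?x w0 v1 w01 v2 w02 v12 w012" .
      show ?thesis unfolding p_eq curvature_second_pt[OF VB L L' i x b] c by simp
    qed
    then show "\<exists>g. trilinear_map (fscale F) (mscale (base F)) (mscale (base F)) (fscale F) g \<and>
        (\<forall>p\<in>second_tangent_fiber F m. cmap (second_tangent F) i (?R p) =
          (case cmap (second_tangent F) i p of (((x, w0), (v1, w01)), ((v2, w02), (v12, w012))) \<Rightarrow>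
             (((x, w0), (v1, w01)), ((v2, w02), (v12, w012 + g w0 v1 v2)))))"
      using trilinear_curv[OF D(1) i b x] by blast
  qed
  have top: "\<exists>x1 x2 y0. v1 = tangent_vec (base F) i (cmap (base F) i m, x1) \<and>
      v2 = tangent_vec (base F) i (cmap (base F) i m, x2) \<and> w0 = pt_of (tot F) i (cmap (base F) i m, y0) \<and>
      ?Rtop v1 v2 w0 = pt_of (tot F) i (cmap (base F) i m, curv F i b (cmap (base F) i m) y0 x1 x2)"
    if i: "i \<in> charts (base F)" and mi: "m \<in> cdom (base F) i" and b: "christoffel F L i b"
      and v1: "v1 \<in> fiber ?TM m" and v2: "v2 \<in> fiber ?TM m" and w0: "w0 \<in> fiber F m" for i m b v1 v2 w0
    using v1 v2 w0 top_component_axes_curvature[OF VB L L' i mi b refl]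
    unfolding tangent_fiber_in_chart[OF VB i mi] fiber_in_chart[OF D(1) i mi] by blast
  have top_in: "?Rtop v1 v2 w0 \<in> fiber F m"
    if m: "m \<in> points (base F)" and v: "v1 \<in> fiber ?TM m" "v2 \<in> fiber ?TM m" "w0 \<in> fiber F m" for m v1 v2 w0
  proof -
    obtain i b where i: "i \<in> charts (base F)" and mi: "m \<in> cdom (base F) i" and b: "christoffel F L i b"
      using chart[OF m] by blast
    show ?thesis using top[OF i mi b v] pt_of_tot_in_fiber[OF D(1) i mi] by metis
  qed
  have Rt: "?Rt v = v\<lparr>ax012 := fiber_add F (ax012 v) (?Rtop (ax1 v) (ax2 v) (ax0 v))\<rparr>"
    if m: "m \<in> points (base F)" and v: "v \<in> axes_fiber F m" for m v
  proof -
    obtain i b where i: "i \<in> charts (base F)" and mi: "m \<in> cdom (base F) i" and b: "christoffel F L i b"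
      using chart[OF m] by blast
    let ?x = "cmap (base F) i m"
    note x = cmap_in_img[OF mi]
    from axes_fiber_in_chart[OF VB i mi v] obtain w0 v1 v2 w01 w02 v12 w012
      where v_eq: "v = axes_pt F i ?x w0 v1 v2 w01 w02 v12 w012" .
    show ?thesis
      unfolding v_eq axes_curvature_axes_pt[OF VB L L' i x b]
      by (simp add: axes_pt_def top_component_axes_curvature[OF VB L L' i mi b refl] fiber_add_in_chart[OF D(1) i x])
  qed
  have formula: "snd (cmap (tot F) i (?Rtop v1 v2 w0)) =
      curv F i b (cmap (base F) i m) (snd (cmap (tot F) i w0)) (snd (cmap (tangent (base F)) i v1))
        (snd (cmap (tangent (base F)) i v2))"
    if i: "i \<in> charts (base F)" and b: "christoffel F L i b" and mi: "m \<in> cdom (base F) i"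
      and v: "v1 \<in> fiber ?TM m" "v2 \<in> fiber ?TM m" "w0 \<in> fiber F m" for i m b v1 v2 w0
    using top[OF i mi b v] cmap_in_img[OF mi]
    by (auto simp: pt_of_tot(2)[OF D(1) i] cmap_tangent_vec_self[OF D(5) i])
  show ?thesis
    unfolding Let_def
    using independent Gm top_in Rt
    by (intro conjI ballI allI impI) (simp_all add: formula curv_def algebra_simps)
qed

end
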